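(* Let $\Bbbk$ be a field and consider the group $G=\langle x,y : [[x,y],x]=[[x,y],y]=1\rangle$. Let $D$ denote the Ore field of fractions of the group algebra $\Bbbk[G]$. Then $$1+y(1-y)^{-2}\quad\text{and}\quad 1+y(1-y)^{-2}x(1-x)^{-2}y(1-y)^{-2}$$ are symmetric elements with respect to the canonical involution on $D$ and freely generate a free group $\Bbbk$-algebra in $D$.
   Context: Here $[x,y]=x^{-1}y^{-1}xy$, so $G$ is the free nilpotent group of class $2$ on two generators; $\Bbbk[G]$ is a noetherian domain, hence has an Ore (skew) field of fractions $D$. The canonical involution on $\Bbbk[G]$ is the map $\sum_{g\in G}ga_g\mapsto\sum_{g\in G}g^{-1}a_g$ (finite sums, $a_g\in\Bbbk$); it extends uniquely to a $\Bbbk$-involution (a $\Bbbk$-linear anti-automorphism of order at most $2$) of $D$, also called canonical. An element is symmetric if it is fixed by the involution. Elements $u,v\in D$ freely generate a free group $\Bbbk$-algebra in $D$ if the $\Bbbk$-algebra homomorphism from the group algebra over $\Bbbk$ of the free group on two generators to $D$, sending the two generators to $u$ and $v$, is injective. *)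

theory Defs
  imports Complex_Main "HOL-Library.Poly_Mapping"
begin

section \<open>Groups given by two generators and relators\<close>

datatype gen = GenX | GenY

text \<open>A word is a list of letters; the letter (g, False) stands for the generator g and (g, True)
  for its formal inverse.\<close>

type_synonym word = "(gen \<times> bool) list"

definition winv :: "word \<Rightarrow> word" where
  "winv w = rev (map (\<lambda>(g, e). (g, \<not> e)) w)"

definition wcomm :: "word \<Rightarrow> word \<Rightarrow> word" where
  "wcomm u v = winv u @ winv v @ u @ v"

text \<open>The congruence on words that defines the group with generators x, y and relators R.\<close>

inductive pres_eq :: "word set \<Rightarrow> word \<Rightarrow> word \<Rightarrow> bool" for R where
  refl: "pres_eq R u u"
| sym: "pres_eq R u v \<Longrightarrow> pres_eq R v u"
| trans: "pres_eq R u v \<Longrightarrow> pres_eq R v w \<Longrightarrow> pres_eq R u w"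
| cancel: "pres_eq R (u @ [(g, e), (g, \<not> e)] @ v) (u @ v)"
| relator: "r \<in> R \<Longrightarrow> pres_eq R (u @ r @ v) (u @ v)"

lemma equivp_pres_eq: "equivp (pres_eq R)"
  by (rule equivpI) (auto simp: reflp_def symp_def transp_def intro: pres_eq.intros)

lemma pres_eq_context: "pres_eq R u v \<Longrightarrow> pres_eq R (p @ u @ q) (p @ v @ q)"
proof (induction rule: pres_eq.induct)
  case (cancel u g e v)
  show ?case using pres_eq.cancel[of R "p @ u" g e "v @ q"] by simp
next
  case (relator r u v)
  then show ?case using pres_eq.relator[of r R "p @ u" "v @ q"] by simp
qed (blast intro: pres_eq.intros)+

lemma pres_eq_append:
  assumes "pres_eq R u u'" "pres_eq R v v'"
  shows "pres_eq R (u @ v) (u' @ v')"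
  using pres_eq_context[OF assms(1), of "[]" v] pres_eq_context[OF assms(2), of u' "[]"]
  by (auto intro: pres_eq.trans)

lemma winv_append [simp]: "winv (u @ v) = winv v @ winv u"
  by (simp add: winv_def)

lemma winv_winv [simp]: "winv (winv u) = u"
  by (induction u) (auto simp: winv_def)

lemma pres_eq_right_inverse: "pres_eq R (u @ winv u) []"
proof (induction u rule: rev_induct)
  case Nil
  show ?case by (simp add: winv_def pres_eq.refl)
next
  case (snoc l u)
  obtain g e where l: "l = (g, e)" by (cases l)
  have "pres_eq R (u @ [(g, e), (g, \<not> e)] @ winv u) (u @ winv u)"
    by (rule pres_eq.cancel)
  with snoc show ?case by (auto simp: l winv_def intro: pres_eq.trans)
qed

lemma pres_eq_left_inverse: "pres_eq R (winv u @ u) []"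
  using pres_eq_right_inverse[of R "winv u"] by simp

lemma pres_eq_winv:
  assumes "pres_eq R u v"
  shows "pres_eq R (winv u) (winv v)"
proof -
  have "pres_eq R (winv u @ v @ winv v) (winv u @ u @ winv v)"
    using pres_eq_context[OF assms, of "winv u" "winv v"] by (rule pres_eq.sym)
  moreover have "pres_eq R (winv u @ v @ winv v) (winv u)"
    using pres_eq_append[OF pres_eq.refl[of R "winv u"] pres_eq_right_inverse[of R v]] by simp
  moreover have "pres_eq R (winv u @ u @ winv v) (winv v)"
    using pres_eq_append[OF pres_eq_left_inverse[of R u] pres_eq.refl[of R "winv v"]] by simp
  ultimately show ?thesis by (blast intro: pres_eq.intros)
qed

text \<open>Both groups below are written additively, although they are not commutative: the
  convolution product on finitely supported functions in \<open>HOL-Library.Poly_Mapping\<close> is set up for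
  additive monoids of exponents. Hence \<open>g + h\<close> is the product gh, \<open>0\<close> the identity
  and \<open>- g\<close> the inverse of g, and the type \<open>'g \<Rightarrow>\<^sub>0 'k\<close> is the group algebra of \<open>'g\<close> over \<open>'k\<close>.\<close>

subsection \<open>The free group on two generators\<close>

quotient_type free2 = word / "pres_eq {}"
  by (rule equivp_pres_eq)

instantiation free2 :: group_add
begin

lift_definition zero_free2 :: free2 is "[]" .
lift_definition plus_free2 :: "free2 \<Rightarrow> free2 \<Rightarrow> free2" is "(@)" by (rule pres_eq_append)
lift_definition uminus_free2 :: "free2 \<Rightarrow> free2" is winv by (rule pres_eq_winv)
lift_definition minus_free2 :: "free2 \<Rightarrow> free2 \<Rightarrow> free2" is "\<lambda>u v. u @ winv v"
  by (intro pres_eq_append pres_eq_winv)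

instance
  by standard (transfer; simp add: pres_eq.refl pres_eq_left_inverse)+

end

lift_definition free_x :: free2 is "[(GenX, False)]" .
lift_definition free_y :: free2 is "[(GenY, False)]" .

subsection \<open>The group $\langle x, y : [[x,y],x] = [[x,y],y] = 1\rangle$\<close>

definition nil2_relators :: "word set" where
  "nil2_relators =
    (let x = [(GenX, False)]; y = [(GenY, False)]
     in {wcomm (wcomm x y) x, wcomm (wcomm x y) y})"

quotient_type nil2 = word / "pres_eq nil2_relators"
  by (rule equivp_pres_eq)

instantiation nil2 :: group_add
begin

lift_definition zero_nil2 :: nil2 is "[]" .
lift_definition plus_nil2 :: "nil2 \<Rightarrow> nil2 \<Rightarrow> nil2" is "(@)" by (rule pres_eq_append)
lift_definition uminus_nil2 :: "nil2 \<Rightarrow> nil2" is winv by (rule pres_eq_winv)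
lift_definition minus_nil2 :: "nil2 \<Rightarrow> nil2 \<Rightarrow> nil2" is "\<lambda>u v. u @ winv v"
  by (intro pres_eq_append pres_eq_winv)

instance
  by standard (transfer; simp add: pres_eq.refl pres_eq_left_inverse)+

end

lift_definition nil2_x :: nil2 is "[(GenX, False)]" .
lift_definition nil2_y :: nil2 is "[(GenY, False)]" .

section \<open>Fields of fractions, involutions, free group algebras\<close>

definition unital_ring_hom :: "('r::ring_1 \<Rightarrow> 's::ring_1) \<Rightarrow> bool" where
  "unital_ring_hom f \<longleftrightarrow>
    f 1 = 1 \<and> (\<forall>a b. f (a + b) = f a + f b) \<and> (\<forall>a b. f (a * b) = f a * f b)"

text \<open>The embedding \<open>\<iota>\<close> makes \<open>'d\<close> a (right) Ore field of fractions of \<open>'r\<close>; this determines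
  \<open>\<iota>\<close> up to a unique isomorphism.\<close>

definition ore_field_of_fractions :: "('r::ring_1 \<Rightarrow> 'd::division_ring) \<Rightarrow> bool" where
  "ore_field_of_fractions \<iota> \<longleftrightarrow>
    unital_ring_hom \<iota> \<and> inj \<iota> \<and> (\<forall>d. \<exists>a b. b \<noteq> 0 \<and> d = \<iota> a * inverse (\<iota> b))"

definition group_algebra_involution ::
    "('g::group_add \<Rightarrow>\<^sub>0 'k::field) \<Rightarrow> ('g \<Rightarrow>\<^sub>0 'k)" where
  "group_algebra_involution a =
    (\<Sum>g\<in>Poly_Mapping.keys a. Poly_Mapping.single (- g) (Poly_Mapping.lookup a g))"

text \<open>The scalar c of \<open>'k\<close> acts on \<open>'d\<close> through the image of \<open>c\<cdot>1\<close> under \<open>\<iota>\<close>.\<close>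

definition scalar_image ::
    "(('g::group_add \<Rightarrow>\<^sub>0 'k::field) \<Rightarrow> 'd::division_ring) \<Rightarrow> 'k \<Rightarrow> 'd" where
  "scalar_image \<iota> c = \<iota> (Poly_Mapping.single 0 c)"

definition involution_over :: "('k \<Rightarrow> 'd::division_ring) \<Rightarrow> ('d \<Rightarrow> 'd) \<Rightarrow> bool" where
  "involution_over \<eta> \<sigma> \<longleftrightarrow>
    (\<forall>a b. \<sigma> (a + b) = \<sigma> a + \<sigma> b) \<and> (\<forall>c a. \<sigma> (\<eta> c * a) = \<eta> c * \<sigma> a) \<and>
    (\<forall>a b. \<sigma> (a * b) = \<sigma> b * \<sigma> a) \<and> (\<forall>a. \<sigma> (\<sigma> a) = a)"

definition canonical_involution ::
    "(('g::group_add \<Rightarrow>\<^sub>0 'k::field) \<Rightarrow> 'd::division_ring) \<Rightarrow> ('d \<Rightarrow> 'd) \<Rightarrow> bool" where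
  "canonical_involution \<iota> \<sigma> \<longleftrightarrow>
    involution_over (scalar_image \<iota>) \<sigma> \<and> (\<forall>a. \<sigma> (\<iota> a) = \<iota> (group_algebra_involution a))"

lemma canonical_involution_unique:
  assumes "ore_field_of_fractions \<iota>" "canonical_involution \<iota> \<sigma>" "canonical_involution \<iota> \<tau>"
  shows "\<sigma> = \<tau>"
proof
  fix d
  have frac: "\<rho> (\<iota> a * inverse (\<iota> b)) =
      inverse (\<iota> (group_algebra_involution b)) * \<iota> (group_algebra_involution a)"
    if \<rho>: "canonical_involution \<iota> \<rho>" and nz: "\<iota> b \<noteq> 0" for \<rho> a b
  proof -
    have anti: "\<rho> (u * v) = \<rho> v * \<rho> u" and invol: "\<rho> (\<rho> u) = u"
      and ext: "\<rho> (\<iota> c) = \<iota> (group_algebra_involution c)" for u v c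
      using \<rho> by (auto simp: canonical_involution_def involution_over_def)
    have "\<rho> 1 = 1" using anti[of "\<rho> 1" 1] invol[of 1] by simp
    then have "\<rho> (inverse (\<iota> b)) * \<rho> (\<iota> b) = 1"
      using anti[of "\<iota> b" "inverse (\<iota> b)"] nz by simp
    then have "\<rho> (inverse (\<iota> b)) = inverse (\<rho> (\<iota> b))"
      by (metis inverse_inverse_eq inverse_unique)
    then show ?thesis by (simp add: anti ext)
  qed
  obtain a b where "b \<noteq> 0" and d: "d = \<iota> a * inverse (\<iota> b)"
    using assms(1) unfolding ore_field_of_fractions_def by blast
  moreover have "\<iota> 0 = 0"
    using assms(1) unfolding ore_field_of_fractions_def unital_ring_hom_def
    by (metis add_cancel_right_right)
  ultimately have nz: "\<iota> b \<noteq> 0"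
    using assms(1) unfolding ore_field_of_fractions_def by (metis injD)
  show "\<sigma> d = \<tau> d" unfolding d frac[OF assms(2) nz] frac[OF assms(3) nz] by simp
qed

text \<open>For a central embedding \<open>\<eta>\<close> of the field of scalars into \<open>'d\<close>, there is at most one algebra
  homomorphism \<open>\<phi>\<close> from the group algebra of the free group with the prescribed values u and v on
  the generators, and there is one iff u and v are nonzero.\<close>

definition free_group_algebra_hom ::
    "('k::field \<Rightarrow> 'd::division_ring) \<Rightarrow> 'd \<Rightarrow> 'd \<Rightarrow> ((free2 \<Rightarrow>\<^sub>0 'k) \<Rightarrow> 'd) \<Rightarrow> bool" where
  "free_group_algebra_hom \<eta> u v \<phi> \<longleftrightarrow>
    unital_ring_hom \<phi> \<and> (\<forall>c a. \<phi> (Poly_Mapping.single 0 c * a) = \<eta> c * \<phi> a) \<and>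
    \<phi> (Poly_Mapping.single free_x 1) = u \<and> \<phi> (Poly_Mapping.single free_y 1) = v"

definition freely_generate_group_algebra ::
    "('k::field \<Rightarrow> 'd::division_ring) \<Rightarrow> 'd \<Rightarrow> 'd \<Rightarrow> bool" where
  "freely_generate_group_algebra \<eta> u v \<longleftrightarrow> (\<exists>\<phi>. free_group_algebra_hom \<eta> u v \<phi> \<and> inj \<phi>)"

end

theory Submission
  imports Defs "HOL-Algebra.Algebraic_Closure_Type"
begin

text \<open>
  Let \<open>q\<close> be the central commutator of the generators, so that \<open>x y = q y x\<close>, and let \<open>K = k(q)\<close>. The
  division ring contains the field \<open>K(y)\<close>, on which conjugation by \<open>x\<close> is the automorphism
  \<open>\<sigma> : f(y) \<mapsto> f(q y)\<close>, with inverse \<open>\<tau>\<close>. Put \<open>A = y (1 - y)\<^sup>-\<^sup>2\<close> and \<open>B = x (1 - x)\<^sup>-\<^sup>2\<close>. Both are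
  invariant under inversion of their variable, which makes \<open>u = 1 + A\<close> and \<open>v = 1 + A B A\<close> symmetric.
  The rest of the proof shows that they generate a free group algebra.

  \<^bold>\<open>Normal forms.\<close> Put \<open>C = v - 1 = A B A\<close> and \<open>E = 1 - v\<^sup>-\<^sup>1\<close>. As the inverse of \<open>B\<close> is
  \<open>x - 2 + x\<^sup>-\<^sup>1\<close>, one finds \<open>E = A P\<^sup>-\<^sup>1 A\<close> with \<open>P = x - (2 - A\<^sup>2) + x\<^sup>-\<^sup>1\<close>. Because of \<open>C E = E C = C - E\<close>,
  the group algebra of the free group is spanned by the products
  \<open>u\<^sup>n H u\<^sup>n' H' u\<^sup>n'' \<dots>\<close> with factors \<open>H, H', \<dots> \<in> {C, E}\<close> whose inner exponents may vanish only between equal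
  factors (\<open>normal_span_UNIV\<close>). So it is enough that the values of these products in the division ring are linearly
  independent (\<open>normal_forms_independent\<close>).

  \<^bold>\<open>Paths.\<close> Since \<open>B = (1 - x)\<^sup>-\<^sup>1 x (1 - x)\<^sup>-\<^sup>1\<close>, such a value is, up to factors at its two ends, a
  product \<open>\<pi>\<^sup>-\<^sup>1 a \<pi>'\<^sup>-\<^sup>1 a' \<dots>\<close> of inverses of the two operators \<open>1 - x\<close> and \<open>P\<close>, separated by gaps that are
  \<open>x\<close> or \<open>A\<^sup>2 u\<^sup>n\<close>. Let \<open>R = K(y)[x, x\<^sup>-\<^sup>1; \<sigma>]\<close> be the ring of difference operators. The modules \<open>R/R(1 - x)\<close> and
  \<open>R/RP\<close> are simple and not isomorphic, their endomorphisms are constants, and the gaps define linearly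
  independent classes of extensions between them. These properties alone imply that
  the products are independent over the coefficients in \<open>R\<close>
  (\<open>leading_coefficients_negligible\<close>): in a relation of minimal length some leading coefficient may be taken to
  be 1, multiplication by the corresponding operator removes it and so forces all leading coefficients to be
  constants, and then the same multiplication produces a shorter relation, whose leading coefficients say that
  a combination of gaps is a split extension.

  \<^bold>\<open>Difference equations.\<close> The properties of the modules are statements about equations such as
  \<open>f - \<sigma> f = a\<close> in \<open>K(y)\<close> (\<open>first_order_gap\<close>, \<open>second_order_gap\<close>, \<open>self_extension_gap\<close>, \<open>riccati\<close>). The
  data of these equations have poles at sixth roots of unity only, hence at no more than one point of any orbit
  of \<open>c \<mapsto> q c\<close>. A rational solution has finitely many poles; reading the equation as a recursion along an orbit
  from both ends shows that it is regular everywhere except at 0 and infinity. A comparison of lowest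
  terms at 0, and the symmetry \<open>y \<mapsto> y\<^sup>-\<^sup>1\<close>, then show that it is constant.
\<close>

section \<open>Rational functions evaluated in a division ring\<close>

lemma unital_ring_homD:
  assumes "unital_ring_hom f"
  shows "f 1 = 1" "f (a + b) = f a + f b" "f (a * b) = f a * f b" "f 0 = 0" "f (- a) = - f a"
    "f (a - b) = f a - f b" "f (a ^ n) = f a ^ n" "f (sum g S) = (\<Sum>i\<in>S. f (g i))"
    "f (numeral k) = numeral k"
proof -
  show 1: "f 1 = 1" and add: "\<And>a b. f (a + b) = f a + f b" and mult: "\<And>a b. f (a * b) = f a * f b"
    using assms by (simp_all add: unital_ring_hom_def)
  show 0: "f 0 = 0" using add[of 0 0] by simp
  show neg: "\<And>a. f (- a) = - f a" using add 0 by (metis add.right_inverse add_eq_0_iff)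
  show "f (a - b) = f a - f b" using add[of a "- b"] by (simp add: neg)
  show "f (a ^ n) = f a ^ n" by (induction n) (simp_all add: 1 mult)
  show "f (sum g S) = (\<Sum>i\<in>S. f (g i))"
    by (induction S rule: infinite_finite_induct) (simp_all add: 0 add)
  have "f (of_nat n) = of_nat n" for n
    by (induction n) (simp_all add: 0 1 add)
  from this[of "numeral k"] show "f (numeral k) = numeral k"
    by simp
qed

lemma unital_ring_hom_field:
  fixes f :: "'l::field \<Rightarrow> 'd::division_ring"
  assumes "unital_ring_hom f"
  shows "f a = 0 \<longleftrightarrow> a = 0" "f (inverse a) = inverse (f a)" "f a = f b \<longleftrightarrow> a = b"
    "f (a powi n) = f a powi n" "f a * f b = f b * f a"
proof -
  note h = unital_ring_homD[OF assms]
  have inv: "f a * f (inverse a) = 1" if "a \<noteq> 0" for a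
    using that by (metis h(1,3) right_inverse)
  show z: "f a = 0 \<longleftrightarrow> a = 0" for a
    using inv[of a] h(4) by (cases "a = 0") auto
  show i: "f (inverse a) = inverse (f a)" for a
    using inv[of a] h(4) by (cases "a = 0") (auto simp: inverse_unique)
  show "f a = f b \<longleftrightarrow> a = b"
    using z[of "a - b"] by (simp add: h)
  show "f (a powi n) = f a powi n"
    by (simp add: power_int_def h i)
  show "f a * f b = f b * f a"
    by (metis h(3) mult.commute)
qed

lemma unital_ring_hom_divide:
  fixes f :: "'l::field \<Rightarrow> 'm::field"
  assumes "unital_ring_hom f"
  shows "f (a / b) = f a / f b"
  by (simp add: divide_inverse unital_ring_homD[OF assms] unital_ring_hom_field[OF assms])

lemma unital_ring_hom_comp:
  "unital_ring_hom f \<Longrightarrow> unital_ring_hom g \<Longrightarrow> unital_ring_hom (\<lambda>a. f (g a))"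
  by (simp add: unital_ring_hom_def)

text \<open>The ring that receives the values is not commutative, so evaluation at \<open>t\<close> is a homomorphism only if \<open>t\<close>
  commutes with the coefficients. For rational functions \<open>t\<close> must also be transcendental over them.\<close>

definition poly_hom :: "('a::comm_ring_1 \<Rightarrow> 'd::ring_1) \<Rightarrow> 'd \<Rightarrow> 'a poly \<Rightarrow> 'd" where
  "poly_hom \<phi> t p = (\<Sum>i\<le>degree p. \<phi> (coeff p i) * t ^ i)"

text \<open>The numerator and denominator are an arbitrary choice, on which the value does not depend when no
  nonzero polynomial vanishes at \<open>t\<close>.\<close>

definition ratfun_hom :: "('a::field \<Rightarrow> 'd::division_ring) \<Rightarrow> 'd \<Rightarrow> 'a poly fract \<Rightarrow> 'd" where
  "ratfun_hom \<phi> t f =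
    (let (p, q) = (SOME (p, q). q \<noteq> 0 \<and> f = Fract p q) in poly_hom \<phi> t p * inverse (poly_hom \<phi> t q))"

definition rconst :: "'a::field \<Rightarrow> 'a poly fract" where
  "rconst c = to_fract [:c:]"

definition rvar :: "'a::field poly fract" where
  "rvar = to_fract [:0, 1:]"

lemma unital_ring_hom_rconst: "unital_ring_hom rconst"
proof -
  have "[:a + b:] = [:a:] + [:b:]" "[:a * b:] = [:a:] * [:b:]" for a b :: 'a
    by (simp_all add: mult.commute)
  then show ?thesis
    by (simp add: unital_ring_hom_def rconst_def flip: one_pCons del: add_pCons mult_pCons_left mult_pCons_right)
qed

lemmas rconst_simps = unital_ring_homD[OF unital_ring_hom_rconst]
  unital_ring_hom_field[OF unital_ring_hom_rconst] unital_ring_hom_divide[OF unital_ring_hom_rconst]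

lemma rvar_nz [simp]: "rvar \<noteq> 0"
  by (simp add: rvar_def)

lemma poly_hom_eq_sum:
  assumes "unital_ring_hom \<phi>" "degree p \<le> n"
  shows "poly_hom \<phi> t p = (\<Sum>i\<le>n. \<phi> (coeff p i) * t ^ i)"
  unfolding poly_hom_def using assms
  by (intro sum.mono_neutral_left) (auto simp: unital_ring_homD coeff_eq_0)

lemma poly_hom_pCons:
  assumes "unital_ring_hom \<phi>" "\<And>a. t * \<phi> a = \<phi> a * t"
  shows "poly_hom \<phi> t (pCons a p) = \<phi> a + t * poly_hom \<phi> t p"
proof -
  have "poly_hom \<phi> t (pCons a p) = (\<Sum>i\<le>Suc (degree p). \<phi> (coeff (pCons a p) i) * t ^ i)"
    by (rule poly_hom_eq_sum) (use assms in \<open>auto simp: degree_pCons_le\<close>)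
  also have "\<dots> = \<phi> a + (\<Sum>i\<le>degree p. \<phi> (coeff p i) * t ^ Suc i)"
    by (subst sum.atMost_Suc_shift) simp
  also have "(\<Sum>i\<le>degree p. \<phi> (coeff p i) * t ^ Suc i) = t * poly_hom \<phi> t p"
    unfolding poly_hom_def sum_distrib_left
    by (intro sum.cong) (simp_all add: assms(2) flip: mult.assoc)
  finally show ?thesis .
qed

lemma unital_ring_hom_poly_hom:
  assumes \<phi>: "unital_ring_hom \<phi>" and comm: "\<And>a. t * \<phi> a = \<phi> a * t"
  shows "unital_ring_hom (poly_hom \<phi> t)"
proof -
  note h = unital_ring_homD[OF \<phi>] and pc = poly_hom_pCons[OF \<phi> comm]
  have 0: "poly_hom \<phi> t 0 = 0" by (simp add: poly_hom_def h)
  have add: "poly_hom \<phi> t (p + q) = poly_hom \<phi> t p + poly_hom \<phi> t q" for p q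
  proof -
    let ?n = "max (degree p) (degree q)"
    have "poly_hom \<phi> t (p + q) = (\<Sum>i\<le>?n. \<phi> (coeff (p + q) i) * t ^ i)"
      by (rule poly_hom_eq_sum[OF \<phi>]) (simp add: degree_add_le_max)
    also have "\<dots> = poly_hom \<phi> t p + poly_hom \<phi> t q"
      by (simp add: poly_hom_eq_sum[OF \<phi>, of _ ?n] h algebra_simps sum.distrib)
    finally show ?thesis .
  qed
  have comm': "poly_hom \<phi> t p * t = t * poly_hom \<phi> t p" for p
    by (induction p) (simp_all add: 0 pc algebra_simps comm)
  have scal: "\<phi> a * poly_hom \<phi> t p = poly_hom \<phi> t (smult a p)" for a p
  proof (induction p)
    case (pCons b p)
    have "\<phi> a * (t * poly_hom \<phi> t p) = t * (\<phi> a * poly_hom \<phi> t p)"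
      by (simp add: comm flip: mult.assoc)
    then show ?case using pCons by (simp add: pc h distrib_left)
  qed (simp add: 0)
  have "poly_hom \<phi> t (p * q) = poly_hom \<phi> t p * poly_hom \<phi> t q" for p q
  proof (induction p)
    case (pCons a p)
    then show ?case
      by (simp add: pc add h scal distrib_right mult.assoc)
  qed (simp add: 0)
  moreover have "poly_hom \<phi> t 1 = 1" by (simp add: poly_hom_def h)
  ultimately show ?thesis using add by (simp add: unital_ring_hom_def)
qed

lemma commute_inverse_left:
  fixes a b :: "'d::division_ring"
  assumes "a * b = b * a"
  shows "inverse a * b = b * inverse a"
proof (cases "a = 0")
  case False
  then have "inverse a * b = inverse a * (b * a) * inverse a"
    by (simp add: mult.assoc)
  also have "\<dots> = inverse a * (a * b) * inverse a"
    by (simp add: assms)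
  also have "\<dots> = b * inverse a"
    using False by (simp flip: mult.assoc)
  finally show ?thesis .
qed simp

lemma ratfun_hom:
  fixes \<phi> :: "'a::field \<Rightarrow> 'd::division_ring"
  assumes \<phi>: "unital_ring_hom \<phi>" and comm: "\<And>a. t * \<phi> a = \<phi> a * t"
    and nz: "\<And>p. p \<noteq> 0 \<Longrightarrow> poly_hom \<phi> t p \<noteq> 0"
  shows unital_ring_hom_ratfun_hom: "unital_ring_hom (ratfun_hom \<phi> t)"
    and ratfun_hom_rconst: "ratfun_hom \<phi> t (rconst c) = \<phi> c"
    and ratfun_hom_rvar: "ratfun_hom \<phi> t rvar = t"
proof -
  let ?h = "poly_hom \<phi> t"
  note hom = unital_ring_hom_poly_hom[OF \<phi> comm]
  note h = unital_ring_homD[OF hom]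
  have com: "?h p * ?h q = ?h q * ?h p" for p q
    by (metis h(3) mult.commute)
  have comi: "inverse (?h q) * ?h p = ?h p * inverse (?h q)" for p q
    by (rule commute_inverse_left) (rule com)
  have val: "ratfun_hom \<phi> t (Fract p q) = ?h p * inverse (?h q)" if q: "q \<noteq> 0" for p q
  proof -
    define pq where "pq = (SOME (p', q'). q' \<noteq> 0 \<and> Fract p q = Fract p' q')"
    have "case pq of (p', q') \<Rightarrow> q' \<noteq> 0 \<and> Fract p q = Fract p' q'"
      unfolding pq_def by (rule someI[of _ "(p, q)"]) (use q in auto)
    then obtain p' q' where pq: "pq = (p', q')" "q' \<noteq> 0" "Fract p q = Fract p' q'"
      by (cases pq) auto
    then have "p * q' = p' * q" using q by (simp add: eq_fract)
    then have e: "?h p * ?h q' = ?h p' * ?h q" by (metis h(3))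
    have nz': "?h q \<noteq> 0" "?h q' \<noteq> 0" using nz q pq(2) by auto
    have "?h p * inverse (?h q) = ?h p * ?h q' * inverse (?h q') * inverse (?h q)"
      using nz' by (simp add: mult.assoc)
    also have "\<dots> = ?h p' * (?h q * inverse (?h q')) * inverse (?h q)"
      by (simp add: e mult.assoc)
    also have "\<dots> = ?h p' * inverse (?h q') * (?h q * inverse (?h q))"
      by (simp only: mult.assoc comi[of q' q, symmetric])
    also have "\<dots> = ?h p' * inverse (?h q')"
      using nz' by simp
    finally show ?thesis
      by (simp add: ratfun_hom_def pq_def[symmetric] pq(1))
  qed
  have "ratfun_hom \<phi> t (f * g) = ratfun_hom \<phi> t f * ratfun_hom \<phi> t g" for f g
  proof (cases f, cases g)
    fix a b c d assume f: "f = Fract a b" "b \<noteq> 0" and g: "g = Fract c d" "d \<noteq> 0"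
    then have "?h b \<noteq> 0" "?h d \<noteq> 0" using nz by auto
    then have "inverse (?h (b * d)) = inverse (?h b) * inverse (?h d)"
      by (simp add: h com[of b d] nonzero_inverse_mult_distrib)
    moreover have "?h c * (inverse (?h b) * inverse (?h d)) = inverse (?h b) * (?h c * inverse (?h d))"
      by (simp only: comi[of b c] flip: mult.assoc)
    ultimately show ?thesis using f g
      by (simp add: val h(3) mult.assoc)
  qed
  moreover have "ratfun_hom \<phi> t (f + g) = ratfun_hom \<phi> t f + ratfun_hom \<phi> t g" for f g
  proof (cases f, cases g)
    fix a b c d assume f: "f = Fract a b" "b \<noteq> 0" and g: "g = Fract c d" "d \<noteq> 0"
    then have nz': "?h b \<noteq> 0" "?h d \<noteq> 0" using nz by auto
    have "inverse (?h (b * d)) = inverse (?h b) * inverse (?h d)"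
      using nz' by (simp add: h com[of b d] nonzero_inverse_mult_distrib)
    moreover have "?h (a * d) * (inverse (?h b) * inverse (?h d)) = ?h a * inverse (?h b)"
    proof -
      have "?h d * (inverse (?h b) * inverse (?h d)) = inverse (?h b) * (?h d * inverse (?h d))"
        by (simp only: comi[of b d, symmetric] flip: mult.assoc)
      then show ?thesis using nz' by (simp add: h mult.assoc)
    qed
    moreover have "?h (c * b) * (inverse (?h b) * inverse (?h d)) = ?h c * inverse (?h d)"
      using nz' by (simp add: h mult.assoc) (simp flip: mult.assoc)
    ultimately show ?thesis using f g
      by (simp add: val h(2) distrib_right)
  qed
  moreover have "ratfun_hom \<phi> t 1 = 1"
    by (simp add: One_fract_def val h)
  ultimately show "unital_ring_hom (ratfun_hom \<phi> t)"
    by (simp add: unital_ring_hom_def)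
  show "ratfun_hom \<phi> t (rconst c) = \<phi> c" "ratfun_hom \<phi> t rvar = t"
    by (simp_all add: rconst_def rvar_def to_fract_def val h)
      (simp_all add: poly_hom_def unital_ring_homD[OF \<phi>])
qed

lemma poly_hom_rconst_rvar: "poly_hom rconst rvar p = to_fract p"
proof (induction p)
  case (pCons a p)
  have "to_fract (pCons a p) = rconst a + rvar * to_fract p"
    by (simp add: rconst_def rvar_def flip: to_fract_add to_fract_mult)
  with pCons show ?case
    by (simp add: poly_hom_pCons unital_ring_hom_rconst mult.commute)
qed (simp add: poly_hom_def rconst_simps)

lemma ratfun_hom_unique:
  fixes f g :: "'a::field poly fract \<Rightarrow> 'd::division_ring"
  assumes "unital_ring_hom f" "unital_ring_hom g"
    and c: "\<And>c. f (rconst c) = g (rconst c)" and v: "f rvar = g rvar"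
  shows "f r = g r"
proof -
  note hf = unital_ring_homD[OF assms(1)] unital_ring_hom_field(1,2)[OF assms(1)]
  note hg = unital_ring_homD[OF assms(2)] unital_ring_hom_field(1,2)[OF assms(2)]
  have p: "f (to_fract p) = g (to_fract p)" for p
    unfolding poly_hom_rconst_rvar[symmetric] poly_hom_def
    by (simp add: hf hg c v)
  show ?thesis
  proof (cases r)
    case (Fract a b)
    then show ?thesis
      by (simp add: Fract_conv_to_fract divide_inverse hf hg p)
  qed
qed

text \<open>Dedekind's argument for the independence of characters. Comparing \<open>\<alpha>\<close> with \<open>\<beta>\<close> multiplies the term
  with index \<open>i\<close> by \<open>l i\<close>; subtracting \<open>l j\<close> times the relation removes the term with index \<open>j\<close>. It serves twice,
  for the powers of \<open>y\<close> over \<open>K\<close> and for those of \<open>x\<close> over \<open>K(y)\<close>.\<close>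

lemma dedekind_independence:
  fixes \<phi> :: "'a::field \<Rightarrow> 'd::division_ring" and m :: "'i \<Rightarrow> 'd" and \<alpha> \<beta> :: "'d \<Rightarrow> 'd"
  assumes \<phi>: "unital_ring_hom \<phi>" and m_nz: "\<And>i. m i \<noteq> 0" and l: "inj l"
    and \<alpha>: "\<And>a b. \<alpha> (a + b) = \<alpha> a + \<alpha> b" and \<beta>: "\<And>a b. \<beta> (a + b) = \<beta> a + \<beta> b"
    and \<beta>_inj: "\<And>a. \<beta> a = 0 \<Longrightarrow> a = 0"
    and eigen: "\<And>a i. \<alpha> (\<phi> a * m i) = \<beta> (\<phi> (a * l i) * m i)"
    and "finite S" "(\<Sum>i\<in>S. \<phi> (c i) * m i) = 0" "i \<in> S"
  shows "c i = 0"
  using assms(8-10)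
proof (induction S arbitrary: c i rule: finite_induct)
  case (insert j S)
  note h = unital_ring_homD[OF \<phi>] unital_ring_hom_field(1)[OF \<phi>]
  have zero: "f 0 = 0" if "\<And>a b. f (a + b) = f a + f b" for f :: "'d \<Rightarrow> 'd"
    by (metis add_0_right add_left_cancel that)
  have sum: "f (\<Sum>i\<in>T. g i) = (\<Sum>i\<in>T. f (g i))" if "\<And>a b. f (a + b) = f a + f b" for f :: "'d \<Rightarrow> 'd" and g T
    by (induction T rule: infinite_finite_induct) (simp_all add: that zero)
  let ?I = "insert j S" and ?d = "\<lambda>i. c i * (l i - l j)"
  have "\<beta> (\<Sum>i\<in>?I. \<phi> (?d i) * m i) + \<beta> (\<phi> (l j) * (\<Sum>i\<in>?I. \<phi> (c i) * m i)) =
      \<beta> (\<Sum>i\<in>?I. \<phi> (c i * l i) * m i)"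
    by (simp add: \<beta>[symmetric] sum_distrib_left sum.distrib[symmetric] h(3,6) right_diff_distrib
        left_diff_distrib mult.commute[of _ "l j"] mult.assoc del: sum.insert)
  also have "\<dots> = \<alpha> (\<Sum>i\<in>?I. \<phi> (c i) * m i)"
    by (simp only: sum[of \<beta>, OF \<beta>] sum[of \<alpha>, OF \<alpha>] eigen)
  also have "\<dots> = 0" using insert.prems(1) zero[of \<alpha>, OF \<alpha>] by simp
  finally have "(\<Sum>i\<in>?I. \<phi> (?d i) * m i) = 0"
    using insert.prems(1) zero[of \<beta>, OF \<beta>] \<beta>_inj by simp
  then have "(\<Sum>i\<in>S. \<phi> (?d i) * m i) = 0"
    using insert.hyps by (simp add: h)
  then have "?d i = 0" if "i \<in> S" for i
    using insert.IH[of ?d i] that by blast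
  then have c0: "c i = 0" if "i \<in> S" for i
    using that insert.hyps l by (auto simp: inj_eq)
  then have "\<phi> (c j) * m j = 0"
    using insert.prems(1) insert.hyps by (simp add: h)
  then have "c j = 0" using m_nz by (simp add: h)
  then show ?case using insert.prems(2) c0 by auto
qed simp

section \<open>Values and poles of rational functions\<close>

lemma to_fract_divide_eq_iff:
  "r \<noteq> 0 \<Longrightarrow> r' \<noteq> 0 \<Longrightarrow> to_fract p / to_fract r = to_fract p' / to_fract r' \<longleftrightarrow> p * r' = p' * r"
  by (simp add: eq_fract flip: Fract_conv_to_fract)

lemma to_fract_power: "to_fract (p ^ n) = to_fract p ^ n"
  by (induction n) simp_all

lemma to_fract_smult: "to_fract (smult k p) = rconst k * to_fract p"
  by (simp add: rconst_def flip: to_fract_mult)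

text \<open>The substitutions \<open>f(y) \<mapsto> f(Q y)\<close> and \<open>f(y) \<mapsto> f(y\<^sup>-\<^sup>1)\<close>.\<close>

definition dilate :: "'c::field \<Rightarrow> 'c poly fract \<Rightarrow> 'c poly fract" where
  "dilate Q = ratfun_hom rconst (rconst Q * rvar)"

definition recip :: "'c::field poly fract \<Rightarrow> 'c poly fract" where
  "recip = ratfun_hom rconst (inverse rvar)"

lemma poly_hom_dilate:
  "poly_hom rconst (rconst Q * rvar) p = to_fract (pcompose p [:0, Q:])"
proof (induction p)
  case (pCons a p)
  have "to_fract (pcompose (pCons a p) [:0, Q:]) = rconst a + rconst Q * rvar * to_fract (pcompose p [:0, Q:])"
    by (simp add: rconst_def rvar_def pcompose_pCons flip: to_fract_add to_fract_mult)
  with pCons show ?case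
    by (simp add: poly_hom_pCons unital_ring_hom_rconst mult.commute)
qed (simp add: poly_hom_def rconst_simps)

lemma dilate_nz: "Q \<noteq> 0 \<Longrightarrow> p \<noteq> 0 \<Longrightarrow> poly_hom rconst (rconst Q * rvar) p \<noteq> 0"
  by (simp add: poly_hom_dilate pcompose_eq_0_iff)

lemma dilate:
  assumes "Q \<noteq> 0"
  shows unital_ring_hom_dilate: "unital_ring_hom (dilate Q)"
    and dilate_rconst: "dilate Q (rconst c) = rconst c"
    and dilate_rvar: "dilate Q rvar = rconst Q * rvar"
  unfolding dilate_def
  using ratfun_hom[OF unital_ring_hom_rconst mult.commute dilate_nz[OF assms]] by blast+

lemma dilate_to_fract:
  assumes "Q \<noteq> 0"
  shows "dilate Q (to_fract p) = to_fract (pcompose p [:0, Q:])"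
proof -
  note h = unital_ring_homD[OF unital_ring_hom_dilate[OF assms]]
  have "dilate Q (poly_hom rconst rvar p) = poly_hom rconst (rconst Q * rvar) p"
    by (simp add: poly_hom_def h dilate_rconst dilate_rvar assms)
  then show ?thesis by (simp add: poly_hom_dilate poly_hom_rconst_rvar)
qed

lemma dilate_dilate:
  assumes "Q \<noteq> 0" "R \<noteq> 0"
  shows "dilate Q (dilate R f) = dilate (Q * R) f"
proof (rule ratfun_hom_unique[where f = "\<lambda>f. dilate Q (dilate R f)" and g = "dilate (Q * R)"])
  show "unital_ring_hom (\<lambda>f. dilate Q (dilate R f))" "unital_ring_hom (dilate (Q * R))"
    using assms by (simp_all add: unital_ring_hom_dilate unital_ring_hom_comp)
  show "dilate Q (dilate R rvar) = dilate (Q * R) rvar"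
    using assms by (simp add: dilate_rvar dilate_rconst rconst_simps mult_ac
        unital_ring_homD[OF unital_ring_hom_dilate])
  show "dilate Q (dilate R (rconst c)) = dilate (Q * R) (rconst c)" for c
    using assms by (simp add: dilate_rconst)
qed

lemma dilate_1 [simp]: "dilate 1 f = f"
  by (rule ratfun_hom_unique[where g = "\<lambda>f. f"])
    (simp_all add: unital_ring_hom_dilate dilate_rconst dilate_rvar rconst_simps,
     simp add: unital_ring_hom_def)

text \<open>Multiplied by a power of the variable, \<open>p(1/y)\<close> becomes the polynomial with the reversed coefficients.\<close>

lemma poly_hom_recip:
  fixes p :: "'a::field poly"
  shows "poly_hom rconst (inverse rvar) p * rvar ^ degree p =
    to_fract (\<Sum>i\<le>degree p. monom (coeff p i) (degree p - i))"
proof -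
  have "rconst (coeff p i) * inverse rvar ^ i * rvar ^ degree p = to_fract (monom (coeff p i) (degree p - i))"
    if "i \<le> degree p" for i
  proof -
    have "to_fract (monom c n) = rconst c * rvar ^ n" for c :: 'a and n
      by (simp add: monom_altdef rconst_def rvar_def to_fract_power flip: to_fract_mult to_fract_power)
    moreover have "inverse rvar ^ i * rvar ^ degree p = (rvar :: 'a poly fract) ^ (degree p - i)"
      using that by (simp add: power_diff field_simps)
    ultimately show ?thesis by (simp add: mult.assoc)
  qed
  then show ?thesis
    by (simp add: poly_hom_def sum_distrib_right)
qed

lemma coeff_0_reflected:
  fixes p :: "'a::comm_monoid_add poly"
  shows "coeff (\<Sum>i\<le>degree p. monom (coeff p i) (degree p - i)) 0 = lead_coeff p"
proof -
  have "coeff (\<Sum>i\<le>degree p. monom (coeff p i) (degree p - i)) 0 =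
      (\<Sum>i\<le>degree p. if i = degree p then coeff p i else 0)"
    by (simp add: coeff_sum)
  then show ?thesis by simp
qed

lemma recip_nz: "p \<noteq> 0 \<Longrightarrow> poly_hom rconst (inverse rvar) p \<noteq> 0"
  using poly_hom_recip[of p] coeff_0_reflected[of p]
  by (metis coeff_0 leading_coeff_0_iff mult_zero_left to_fract_eq_0_iff)

lemma recip:
  shows unital_ring_hom_recip: "unital_ring_hom recip"
    and recip_rconst: "recip (rconst c) = rconst c"
    and recip_rvar: "recip rvar = inverse rvar"
  unfolding recip_def
  using ratfun_hom[OF unital_ring_hom_rconst mult.commute recip_nz] by blast+

lemmas recip_simps = unital_ring_homD[OF unital_ring_hom_recip]
  unital_ring_hom_field[OF unital_ring_hom_recip] unital_ring_hom_divide[OF unital_ring_hom_recip]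

lemma recip_dilate:
  assumes "Q \<noteq> 0"
  shows "recip (dilate Q f) = dilate (inverse Q) (recip f)"
proof (rule ratfun_hom_unique[where f = "\<lambda>f. recip (dilate Q f)"
      and g = "\<lambda>f. dilate (inverse Q) (recip f)"])
  show "unital_ring_hom (\<lambda>f. recip (dilate Q f))" "unital_ring_hom (\<lambda>f. dilate (inverse Q) (recip f))"
    using assms by (simp_all add: unital_ring_hom_dilate unital_ring_hom_recip unital_ring_hom_comp)
  show "recip (dilate Q rvar) = dilate (inverse Q) (recip rvar)"
    using assms unital_ring_hom_field[OF unital_ring_hom_dilate, of "inverse Q"]
    by (simp add: dilate_rvar recip_rconst recip_rvar recip_simps rconst_simps)
  show "recip (dilate Q (rconst c)) = dilate (inverse Q) (recip (rconst c))" for c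
    using assms by (simp add: dilate_rconst recip_rconst)
qed

definition has_value :: "'c::field poly fract \<Rightarrow> 'c \<Rightarrow> 'c \<Rightarrow> bool" where
  "has_value f c v \<longleftrightarrow> (\<exists>p r. poly r c \<noteq> 0 \<and> f = to_fract p / to_fract r \<and> v = poly p c / poly r c)"

definition regular :: "'c::field \<Rightarrow> 'c poly fract \<Rightarrow> bool" where
  "regular c f \<longleftrightarrow> (\<exists>v. has_value f c v)"

lemma has_value_unique:
  assumes "has_value f c v" "has_value f c w"
  shows "v = w"
proof -
  obtain p r p' r' where pr: "poly r c \<noteq> 0" "f = to_fract p / to_fract r" "v = poly p c / poly r c"
    "poly r' c \<noteq> 0" "f = to_fract p' / to_fract r'" "w = poly p' c / poly r' c"
    using assms unfolding has_value_def by blast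
  then have "r \<noteq> 0" "r' \<noteq> 0" by auto
  then have "p * r' = p' * r"
    using pr by (metis to_fract_divide_eq_iff)
  then have "poly (p * r') c = poly (p' * r) c" by simp
  then show ?thesis using pr by (simp add: frac_eq_eq)
qed

lemma has_value_to_fract: "has_value (to_fract p) c (poly p c)"
  unfolding has_value_def by (intro exI[of _ p] exI[of _ 1]) simp

lemma has_value_rconst: "has_value (rconst k) c k"
  using has_value_to_fract[of "[:k:]" c] by (simp add: rconst_def)

lemma has_value_rvar: "has_value rvar c c"
  using has_value_to_fract[of "[:0, 1:]" c] by (simp add: rvar_def)

lemma has_value_add:
  assumes "has_value f c v" "has_value g c w"
  shows "has_value (f + g) c (v + w)"
proof -
  obtain p r p' r' where pr: "poly r c \<noteq> 0" "f = to_fract p / to_fract r" "v = poly p c / poly r c"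
    "poly r' c \<noteq> 0" "g = to_fract p' / to_fract r'" "w = poly p' c / poly r' c"
    using assms unfolding has_value_def by blast
  then have "r \<noteq> 0" "r' \<noteq> 0" by auto
  with pr show ?thesis
    unfolding has_value_def
    by (intro exI[of _ "p * r' + p' * r"] exI[of _ "r * r'"]) (simp add: add_frac_eq)
qed

lemma has_value_mult:
  assumes "has_value f c v" "has_value g c w"
  shows "has_value (f * g) c (v * w)"
proof -
  obtain p r p' r' where pr: "poly r c \<noteq> 0" "f = to_fract p / to_fract r" "v = poly p c / poly r c"
    "poly r' c \<noteq> 0" "g = to_fract p' / to_fract r'" "w = poly p' c / poly r' c"
    using assms unfolding has_value_def by blast
  then show ?thesis
    unfolding has_value_def
    by (intro exI[of _ "p * p'"] exI[of _ "r * r'"]) auto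
qed

lemma has_value_inverse:
  assumes "has_value f c v" "v \<noteq> 0"
  shows "has_value (inverse f) c (inverse v)"
proof -
  obtain p r where pr: "poly r c \<noteq> 0" "f = to_fract p / to_fract r" "v = poly p c / poly r c"
    using assms unfolding has_value_def by blast
  with assms(2) show ?thesis
    unfolding has_value_def by (intro exI[of _ r] exI[of _ p]) auto
qed

lemma has_value_uminus: "has_value f c v \<Longrightarrow> has_value (- f) c (- v)"
  using has_value_mult[OF has_value_rconst[of "-1"], of f c v] by (simp add: rconst_simps)

lemma has_value_diff: "has_value f c v \<Longrightarrow> has_value g c w \<Longrightarrow> has_value (f - g) c (v - w)"
  using has_value_add[of f c v "- g" "- w"] by (simp add: has_value_uminus)

lemma has_value_power: "has_value f c v \<Longrightarrow> has_value (f ^ n) c (v ^ n)"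
  by (induction n) (use has_value_rconst[of 1] in \<open>auto simp: rconst_simps intro: has_value_mult\<close>)

lemma has_value_dilate:
  assumes "Q \<noteq> 0" "has_value f (Q * c) v"
  shows "has_value (dilate Q f) c v"
proof -
  obtain p r where pr: "poly r (Q * c) \<noteq> 0" "f = to_fract p / to_fract r" "v = poly p (Q * c) / poly r (Q * c)"
    using assms unfolding has_value_def by blast
  then show ?thesis
    unfolding has_value_def
    by (intro exI[of _ "pcompose p [:0, Q:]"] exI[of _ "pcompose r [:0, Q:]"])
      (simp add: assms(1) dilate_to_fract unital_ring_hom_divide[OF unital_ring_hom_dilate] poly_pcompose mult.commute)
qed

lemma regular_intros:
  "regular c (rconst k)" "regular c rvar" "regular c (to_fract p)"
  "regular c f \<Longrightarrow> regular c g \<Longrightarrow> regular c (f + g)"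
  "regular c f \<Longrightarrow> regular c g \<Longrightarrow> regular c (f - g)"
  "regular c f \<Longrightarrow> regular c g \<Longrightarrow> regular c (f * g)"
  "regular c f \<Longrightarrow> regular c (- f)"
  "regular c f \<Longrightarrow> regular c (f ^ n)"
  "Q \<noteq> 0 \<Longrightarrow> regular (Q * c) f \<Longrightarrow> regular c (dilate Q f)"
  unfolding regular_def
  by (blast intro: has_value_rconst has_value_rvar has_value_add has_value_diff has_value_mult
      has_value_uminus has_value_power has_value_dilate has_value_to_fract)+

lemma regular_numeral: "regular c (numeral k)"
  using regular_intros(1)[of c "numeral k"] by (simp add: rconst_simps)

text \<open>A zero at the origin cancels one factor of the variable.\<close>

lemma regular_cancel_rvar:
  assumes "has_value (rvar * f) 0 0"
  shows "regular 0 f"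
proof -
  obtain p r where pr: "poly r 0 \<noteq> 0" "rvar * f = to_fract p / to_fract r" "poly p 0 = 0"
    using assms unfolding has_value_def by auto
  then obtain p1 where p1: "p = [:0, 1:] * p1"
    by (metis dvdE minus_zero poly_eq_0_iff_dvd)
  have "rvar * f = rvar * (to_fract p1 / to_fract r)"
    using pr(2) by (simp add: p1 rvar_def flip: to_fract_mult)
  then have "f = to_fract p1 / to_fract r" by (metis mult_left_cancel rvar_nz)
  with pr(1) show ?thesis unfolding regular_def has_value_def by blast
qed

lemma ex_regular_power_rvar: "\<exists>N. regular 0 (rvar ^ N * f)"
proof (cases f)
  case (Fract p r)
  obtain r0 where r0: "r = [:0, 1:] ^ order 0 r * r0" "\<not> [:0, 1:] dvd r0"
    using order_decomp[OF Fract(2), of 0] by auto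
  then have "poly r0 0 \<noteq> 0"
    using poly_eq_0_iff_dvd[of r0 0] by simp
  moreover have "to_fract r = rvar ^ order 0 r * to_fract r0"
    by (subst r0(1)) (simp add: to_fract_power rvar_def)
  moreover from this have "rvar ^ order 0 r * f = to_fract p / to_fract r0"
    using Fract by (simp add: Fract_conv_to_fract)
  ultimately show ?thesis unfolding regular_def has_value_def by metis
qed

text \<open>A pole at 0 has a least order \<open>N\<close>, and multiplication by the \<open>N\<close>-th power of the variable exposes its
  leading coefficient. The statement is for two functions at once because a system will force both leading
  coefficients to vanish together.\<close>

lemma regular_0_if_values_vanish:
  assumes vanish: "\<And>N v w. N > 0 \<Longrightarrow> has_value (rvar ^ N * f) 0 v \<Longrightarrow> has_value (rvar ^ N * g) 0 w \<Longrightarrow>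
      v = 0 \<and> w = 0"
  shows "regular 0 f \<and> regular 0 g"
proof -
  define P where "P N \<longleftrightarrow> regular 0 (rvar ^ N * f) \<and> regular 0 (rvar ^ N * g)" for N
  obtain N1 N2 where "regular 0 (rvar ^ N1 * f)" "regular 0 (rvar ^ N2 * g)"
    using ex_regular_power_rvar by metis
  then have "regular 0 (rvar ^ N2 * (rvar ^ N1 * f))" "regular 0 (rvar ^ N1 * (rvar ^ N2 * g))"
    by (simp_all only: regular_intros)
  then have exP: "P (N1 + N2)"
    by (simp add: P_def power_add mult_ac)
  define N where "N = (LEAST N. P N)"
  have N: "P N" unfolding N_def using exP by (rule LeastI)
  have "N = 0"
  proof (rule ccontr)
    assume "N \<noteq> 0"
    then obtain N' where N': "N = Suc N'" by (cases N) auto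
    obtain v w where v: "has_value (rvar ^ N * f) 0 v" and w: "has_value (rvar ^ N * g) 0 w"
      using N by (auto simp: regular_def P_def)
    with vanish[OF _ v w] have "P N'"
      unfolding P_def N' by (auto intro!: regular_cancel_rvar simp: mult_ac)
    then have "N \<le> N'" unfolding N_def by (rule Least_le)
    then show False using N' by simp
  qed
  then show ?thesis using N by (simp add: P_def)
qed

lemma powi_inj_if_infinite_order:
  fixes q :: "'c::field"
  assumes q: "q \<noteq> 0" "\<And>n. n > 0 \<Longrightarrow> q ^ n \<noteq> 1"
  shows "q powi i = q powi j \<longleftrightarrow> i = j"
proof
  assume "q powi i = q powi j"
  then have eq: "q powi (i - j) = 1" "q powi (j - i) = 1"
    using q(1) by (simp_all add: power_int_diff)
  show "i = j"
  proof (rule ccontr)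
    assume "i \<noteq> j"
    then have "q ^ nat \<bar>i - j\<bar> = 1"
      using eq by (auto simp: power_int_def abs_if split: if_splits)
    with q(2)[of "nat \<bar>i - j\<bar>"] \<open>i \<noteq> j\<close> show False by simp
  qed
qed simp

text \<open>The orbit of \<open>c\<close> meets the finitely many poles of \<open>f\<close> finitely often.\<close>

lemma regular_cofinite:
  fixes q :: "'c::field"
  assumes q: "q \<noteq> 0" "\<And>n. n > 0 \<Longrightarrow> q ^ n \<noteq> 1" and c: "c \<noteq> 0"
  shows "finite {i :: int. \<not> regular c (dilate (q powi i) f)}"
proof (cases f)
  case (Fract p r)
  have inj: "inj (\<lambda>i. q powi i * c)"
    using c by (auto simp: inj_def powi_inj_if_infinite_order[OF q])
  have "{i. \<not> regular c (dilate (q powi i) f)} \<subseteq> (\<lambda>i. q powi i * c) -` {x. poly r x = 0}"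
  proof
    fix i assume "i \<in> {i. \<not> regular c (dilate (q powi i) f)}"
    then have "\<not> regular (q powi i * c) f"
      using regular_intros(9)[of "q powi i" c f] q(1) by auto
    then show "i \<in> (\<lambda>i. q powi i * c) -` {x. poly r x = 0}"
      using Fract by (auto simp: regular_def has_value_def Fract_conv_to_fract)
  qed
  moreover have "finite {x. poly r x = 0}"
    using Fract(2) by (rule poly_roots_finite)
  ultimately show ?thesis
    using finite_vimageI[OF _ inj] finite_subset by blast
qed

text \<open>Over an algebraically closed field a nonconstant denominator in lowest terms has a root, which is a pole.\<close>

lemma polynomial_if_regular:
  fixes f :: "'c::{alg_closed_field,field_gcd} poly fract"
  assumes "\<And>c. regular c f"
  shows "\<exists>p. f = to_fract p"
proof -
  define p r where "p = fst (quot_of_fract f)" and "r = snd (quot_of_fract f)"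
  have f: "f = to_fract p / to_fract r" and r: "r \<noteq> 0" and cop: "coprime p r"
    by (simp_all add: p_def r_def coprime_quot_of_fract flip: Fract_conv_to_fract)
  have "degree r = 0"
  proof (rule ccontr)
    assume "degree r \<noteq> 0"
    then obtain c where c: "poly r c = 0"
      using alg_closed_imp_poly_has_root[of r] by blast
    obtain p' r' where pr: "poly r' c \<noteq> 0" "f = to_fract p' / to_fract r'"
      using assms[of c] unfolding regular_def has_value_def by blast
    then have "r' \<noteq> 0" by auto
    then have "p * r' = p' * r"
      using pr r f by (metis to_fract_divide_eq_iff)
    then have "poly (p * r') c = poly (p' * r) c" by simp
    then have "poly p c = 0" using pr c by simp
    then have "[:-c, 1:] dvd p" "[:-c, 1:] dvd r" using c by (simp_all add: poly_eq_0_iff_dvd)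
    then have "is_unit [:-c, 1:]" using cop by (metis coprime_common_divisor)
    then show False by (simp add: is_unit_pCons_iff)
  qed
  then obtain k where "r = [:k:]" by (rule degree_eq_zeroE)
  with r have "to_fract r = rconst k" "k \<noteq> 0" by (auto simp: rconst_def)
  then have "f = to_fract (smult (inverse k) p)"
    using f by (simp add: to_fract_smult rconst_simps divide_inverse mult.commute)
  then show ?thesis ..
qed

text \<open>A polynomial without a pole at infinity.\<close>

lemma constant_if_regular:
  fixes f :: "'c::{alg_closed_field,field_gcd} poly fract"
  assumes "\<And>c. regular c f" and "regular 0 (recip f)"
  shows "\<exists>k. f = rconst k"
proof -
  obtain p where p: "f = to_fract p" using polynomial_if_regular[OF assms(1)] by blast
  have rp: "recip f = poly_hom rconst (inverse rvar) p"
    unfolding p poly_hom_rconst_rvar[of p, symmetric] poly_hom_def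
    by (simp add: recip_simps recip_rconst recip_rvar)
  obtain v where "has_value (recip f) 0 v" using assms(2) by (auto simp: regular_def)
  then have "has_value (recip f * rvar ^ degree p) 0 (v * 0 ^ degree p)"
    by (intro has_value_mult has_value_power has_value_rvar)
  moreover have "recip f * rvar ^ degree p = to_fract (\<Sum>i\<le>degree p. monom (coeff p i) (degree p - i))"
    by (simp only: rp poly_hom_recip)
  ultimately have "has_value (to_fract (\<Sum>i\<le>degree p. monom (coeff p i) (degree p - i))) 0 (v * 0 ^ degree p)"
    by simp
  from has_value_unique[OF this has_value_to_fract]
  have "v * 0 ^ degree p = lead_coeff p"
    by (simp only: poly_0_coeff_0 coeff_0_reflected)
  then have "degree p = 0" by (metis degree_0 leading_coeff_0_iff mult_zero_right power_eq_0_iff power_0_left)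
  then show ?thesis using p by (metis degree_eq_zeroE rconst_def)
qed

section \<open>Difference equations whose data have few poles\<close>

text \<open>Sixth roots of unity enter because \<open>1 + koebe = (1 - y + y\<^sup>2) / (1 - y)\<^sup>2\<close>, and \<open>1 - y\<close> and \<open>1 - y + y\<^sup>2\<close> both
  divide \<open>1 - y\<^sup>6\<close>. Invariance under \<open>y \<mapsto> y\<^sup>-\<^sup>1\<close> lets statements about 0 carry over to infinity.\<close>

definition symmetric_gap :: "'c::field poly fract \<Rightarrow> bool" where
  "symmetric_gap a \<longleftrightarrow> recip a = a \<and> (\<forall>c. c ^ 6 \<noteq> 1 \<longrightarrow> regular c a)"

text \<open>The Koebe function \<open>y (1 - y)\<^sup>-\<^sup>2\<close>.\<close>

definition koebe :: "'c::field poly fract" where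
  "koebe = rvar * inverse ((1 - rvar) ^ 2)"

lemma regular_symmetric_gap: "symmetric_gap a \<Longrightarrow> c ^ 6 \<noteq> 1 \<Longrightarrow> regular c a"
  by (simp add: symmetric_gap_def)

lemma symmetric_gap_intros:
  "symmetric_gap (rconst k)"
  "symmetric_gap a \<Longrightarrow> symmetric_gap b \<Longrightarrow> symmetric_gap (a + b)"
  "symmetric_gap a \<Longrightarrow> symmetric_gap b \<Longrightarrow> symmetric_gap (a - b)"
  "symmetric_gap a \<Longrightarrow> symmetric_gap b \<Longrightarrow> symmetric_gap (a * b)"
  "symmetric_gap a \<Longrightarrow> symmetric_gap (- a)"
  "symmetric_gap a \<Longrightarrow> symmetric_gap (a ^ n)"
  by (simp_all add: symmetric_gap_def recip_rconst recip_simps regular_intros)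

lemma symmetric_gap_numeral: "symmetric_gap 1" "symmetric_gap (numeral k)"
  using symmetric_gap_intros(1)[of 1] symmetric_gap_intros(1)[of "numeral k"] by (simp_all add: rconst_simps)

lemma symmetric_gap_sum: "(\<And>i. i \<in> S \<Longrightarrow> symmetric_gap (a i)) \<Longrightarrow> symmetric_gap (\<Sum>i\<in>S. a i)"
  by (induction S rule: infinite_finite_induct)
    (use symmetric_gap_intros(1)[of 0] in \<open>auto simp: rconst_simps symmetric_gap_intros\<close>)

lemma has_value_1: "has_value 1 c 1"
  using has_value_rconst[of 1] by (simp add: rconst_simps)

lemma has_value_nz: "has_value f c v \<Longrightarrow> v \<noteq> 0 \<Longrightarrow> f \<noteq> 0"
  using has_value_unique[of 0 c 0 v] has_value_rconst[of 0 c] by (auto simp: rconst_simps)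

lemma one_minus_rvar_nz [simp]: "1 - (rvar :: 'c::field poly fract) \<noteq> 0" "(rvar :: 'c::field poly fract) \<noteq> 1"
proof -
  have "has_value (1 - rvar :: 'c poly fract) 0 (1 - 0)"
    by (intro has_value_diff has_value_1 has_value_rvar)
  then show "1 - (rvar :: 'c::field poly fract) \<noteq> 0" by (rule has_value_nz) simp
  then show "(rvar :: 'c::field poly fract) \<noteq> 1" by auto
qed

lemma recip_koebe: "recip koebe = koebe"
proof -
  have "recip (koebe :: 'a poly fract) = inverse rvar * inverse ((1 - inverse rvar) ^ 2)"
    by (simp add: koebe_def recip_simps recip_rvar)
  also have "(1 - inverse rvar) ^ 2 = (1 - rvar) ^ 2 * inverse (rvar ^ 2 :: 'a poly fract)"
    by (simp add: field_simps power2_eq_square)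
  also have "inverse rvar * inverse \<dots> = (koebe :: 'a poly fract)"
    by (simp add: koebe_def power2_eq_square field_simps)
  finally show ?thesis .
qed

lemma has_value_koebe: "c \<noteq> 1 \<Longrightarrow> has_value koebe c (c * inverse ((1 - c) ^ 2))"
  unfolding koebe_def
  by (intro has_value_mult has_value_inverse has_value_power has_value_diff has_value_1 has_value_rvar) simp

lemma inverse_one_plus_koebe:
  "inverse (1 + koebe) = (1 - rvar) ^ 2 * inverse (1 - rvar + rvar ^ 2 :: 'c::field poly fract)"
proof -
  have "1 + koebe = ((1 - rvar :: 'c poly fract) ^ 2 + rvar) * inverse ((1 - rvar) ^ 2)"
    by (simp add: koebe_def distrib_right)
  also have "(1 - rvar :: 'c poly fract) ^ 2 + rvar = 1 - rvar + rvar ^ 2"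
    by (simp add: power2_eq_square algebra_simps)
  finally show ?thesis by (simp add: inverse_mult_distrib mult.commute)
qed

lemma has_value_inverse_one_plus_koebe:
  "1 - c + c ^ 2 \<noteq> 0 \<Longrightarrow> has_value (inverse (1 + koebe)) c ((1 - c) ^ 2 * inverse (1 - c + c ^ 2))"
  unfolding inverse_one_plus_koebe
  by (intro has_value_mult has_value_inverse has_value_power has_value_diff has_value_add has_value_1 has_value_rvar)

lemma one_plus_koebe_nz [simp]: "1 + (koebe :: 'c::field poly fract) \<noteq> 0"
proof -
  have "inverse (1 + koebe :: 'c poly fract) \<noteq> 0"
    by (rule has_value_nz[OF has_value_inverse_one_plus_koebe[of 0]]) simp_all
  then show ?thesis by auto
qed

lemma symmetric_gap_koebe: "symmetric_gap koebe"
  unfolding symmetric_gap_def regular_def using recip_koebe has_value_koebe by (metis power_one)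

lemma symmetric_gap_u_powi: "symmetric_gap ((1 + koebe :: 'c::field poly fract) powi n)"
proof -
  have "1 - c + c ^ 2 \<noteq> 0" if "c ^ 6 \<noteq> 1" for c :: 'c
  proof
    assume "1 - c + c ^ 2 = 0"
    moreover have "1 - c ^ 6 = (1 - c + c ^ 2) * ((1 - c) * (1 + c) * (1 + c + c ^ 2))"
      by (simp add: algebra_simps eval_nat_numeral)
    ultimately show False using that by simp
  qed
  then have "symmetric_gap (inverse (1 + koebe :: 'c poly fract))"
    unfolding symmetric_gap_def regular_def
    using has_value_inverse_one_plus_koebe by (auto simp: recip_simps recip_koebe)
  moreover have "symmetric_gap (1 + koebe :: 'c poly fract)"
    by (intro symmetric_gap_intros symmetric_gap_numeral symmetric_gap_koebe)
  ultimately show ?thesis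
    by (auto simp: power_int_def symmetric_gap_intros(6) simp del: power_inverse)
qed

text \<open>Induction from both ends of the integers towards the exceptional index \<open>i0\<close>: a step is available
  everywhere except across \<open>i0\<close>.\<close>

lemma two_sided_int_induct:
  fixes P :: "int \<Rightarrow> bool"
  assumes far: "\<And>i. \<bar>i\<bar> \<ge> M \<Longrightarrow> P i"
    and up: "\<And>i. i < i0 \<Longrightarrow> P i \<Longrightarrow> P (i + 1)" and down: "\<And>i. i > i0 \<Longrightarrow> P (i + 1) \<Longrightarrow> P i"
  shows "P i"
proof (cases "i \<le> i0")
  case True
  have "min i (- \<bar>M\<bar>) \<le> i" by simp
  then have "i \<le> i0 \<longrightarrow> P i"
    by (induction i rule: int_ge_induct) (use far up in auto)
  with True show ?thesis by simp
next
  case False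
  have "i \<le> max i \<bar>M\<bar>" by simp
  then have "i > i0 \<longrightarrow> P i"
  proof (induction i rule: int_le_induct)
    case (step i)
    then show ?case using down[of "i - 1"] by auto
  qed (use far in auto)
  with False show ?thesis by simp
qed

locale q_field =
  fixes q :: "'c::{alg_closed_field,field_gcd}"
  assumes q_nz: "q \<noteq> 0" and q_free: "n > 0 \<Longrightarrow> q ^ n \<noteq> 1"
begin

abbreviation \<sigma> where "\<sigma> \<equiv> dilate q"
abbreviation \<tau> where "\<tau> \<equiv> dilate (inverse q)"
abbreviation s where "s \<equiv> (koebe :: 'c poly fract) ^ 2"
abbreviation m where "m \<equiv> 2 - s"
abbreviation shift :: "'c poly fract \<Rightarrow> int \<Rightarrow> 'c poly fract" where "shift f i \<equiv> dilate (q powi i) f"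

lemma q_powi_nz [simp]: "q powi i \<noteq> 0"
  using q_nz by simp

lemma q_powi_eq_1: "q powi i = 1 \<longleftrightarrow> i = 0"
  using powi_inj_if_infinite_order[OF q_nz q_free, of i 0] by simp

lemma unital_ring_hom_shift: "unital_ring_hom (\<lambda>f. shift f i)"
  by (rule unital_ring_hom_dilate[OF q_powi_nz])

lemmas shift_simps = unital_ring_homD[OF unital_ring_hom_shift] unital_ring_hom_field[OF unital_ring_hom_shift]

lemmas \<sigma>_simps = unital_ring_homD[OF unital_ring_hom_dilate[OF q_nz]]
  unital_ring_hom_field[OF unital_ring_hom_dilate[OF q_nz]]

lemma inverse_q_nz: "inverse q \<noteq> 0" using q_nz by simp

lemmas \<tau>_simps = unital_ring_homD[OF unital_ring_hom_dilate[OF inverse_q_nz]]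
  unital_ring_hom_field[OF unital_ring_hom_dilate[OF inverse_q_nz]]

lemma shift_\<sigma>: "shift (\<sigma> f) i = shift f (i + 1)"
  by (simp add: dilate_dilate q_nz power_int_add)

lemma shift_\<tau>: "shift (\<tau> f) i = shift f (i - 1)"
  by (simp add: dilate_dilate q_nz power_int_diff divide_inverse)

lemma \<sigma>\<tau> [simp]: "\<sigma> (\<tau> f) = f" "\<tau> (\<sigma> f) = f"
  using q_nz by (simp_all add: dilate_dilate)

lemma recip_\<sigma>: "recip (\<sigma> f) = \<tau> (recip f)" and recip_\<tau>: "recip (\<tau> f) = \<sigma> (recip f)"
  using q_nz by (simp_all add: recip_dilate)

lemma regular_far:
  assumes "c \<noteq> 0"
  shows "\<exists>M. \<forall>i. \<bar>i\<bar> \<ge> M \<longrightarrow> regular c (shift f i)"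
proof -
  let ?S = "{i. \<not> regular c (shift f i)}"
  have fin: "finite (abs ` ?S)"
    using regular_cofinite[OF q_nz q_free assms] by simp
  have "\<bar>i\<bar> < Max (insert 0 (abs ` ?S)) + 1" if "\<not> regular c (shift f i)" for i
  proof -
    have "\<bar>i\<bar> \<in> insert 0 (abs ` ?S)" using that by auto
    then have "\<bar>i\<bar> \<le> Max (insert 0 (abs ` ?S))" using fin by (intro Max_ge) auto
    then show ?thesis by simp
  qed
  then show ?thesis by (metis linorder_not_le)
qed

text \<open>Two points \<open>q\<^sup>i c\<close> and \<open>q\<^sup>j c\<close> of an orbit cannot both be sixth roots of unity, for then \<open>q\<close> would have finite
  order.\<close>

lemma exceptional_index:
  assumes "c \<noteq> 0"
  shows "\<exists>i0. \<forall>i a. i \<noteq> i0 \<longrightarrow> symmetric_gap a \<longrightarrow> regular c (shift a i)"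
proof -
  have reg: "regular c (shift a i)" if "symmetric_gap a" "(q powi i * c) ^ 6 \<noteq> 1" for a i
    by (intro regular_intros regular_symmetric_gap that q_powi_nz)
  have uniq: "i = j" if "(q powi i * c) ^ 6 = 1" "(q powi j * c) ^ 6 = 1" for i j
  proof -
    have "(q powi i) ^ 6 * c ^ 6 = (q powi j) ^ 6 * c ^ 6"
      using that by (simp add: power_mult_distrib)
    then have "q powi (i * 6) = q powi (j * 6)"
      using assms by (simp add: power_int_power')
    then have "q powi (i * 6 - j * 6) = 1"
      using q_nz by (simp add: power_int_diff)
    then show "i = j" by (simp add: q_powi_eq_1)
  qed
  show ?thesis
  proof (cases "\<exists>i0. (q powi i0 * c) ^ 6 = 1")
    case True
    then show ?thesis using reg uniq by blast
  qed (use reg in blast)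
qed

text \<open>\<open>\<sigma>\<close> fixes the point 0 and multiplies the variable by \<open>q\<close>, so it multiplies the leading coefficient of a pole
  of order \<open>N\<close> by \<open>q\<^sup>-\<^sup>N\<close>.\<close>

lemma value_shift_\<sigma>:
  assumes "has_value (rvar ^ N * f) 0 v"
  shows "has_value (rvar ^ N * \<sigma> f) 0 (inverse q ^ N * v)"
proof -
  have "has_value (\<sigma> (rvar ^ N * f)) 0 v"
    using has_value_dilate[OF q_nz, of _ 0] assms by simp
  then have "has_value (rconst q ^ N * (rvar ^ N * \<sigma> f)) 0 v"
    by (simp add: \<sigma>_simps dilate_rvar q_nz power_mult_distrib mult_ac)
  then have "has_value (rconst (inverse q ^ N) * (rconst q ^ N * (rvar ^ N * \<sigma> f))) 0 (inverse q ^ N * v)"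
    by (intro has_value_mult has_value_rconst)
  moreover have "rconst (inverse q ^ N) * (rconst q ^ N * (rvar ^ N * \<sigma> f)) = rvar ^ N * \<sigma> f"
    using q_nz by (simp add: rconst_simps field_simps)
  ultimately show ?thesis by simp
qed

lemma value_shift_\<tau>:
  assumes "has_value (rvar ^ N * f) 0 v"
  shows "has_value (rvar ^ N * \<tau> f) 0 (q ^ N * v)"
proof -
  have "has_value (\<tau> (rvar ^ N * f)) 0 v"
    using has_value_dilate[OF inverse_q_nz, of _ 0] assms by simp
  then have "has_value (rconst (inverse q) ^ N * (rvar ^ N * \<tau> f)) 0 v"
    by (simp add: \<tau>_simps dilate_rvar q_nz power_mult_distrib mult_ac)
  then have "has_value (rconst (q ^ N) * (rconst (inverse q) ^ N * (rvar ^ N * \<tau> f))) 0 (q ^ N * v)"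
    by (intro has_value_mult has_value_rconst)
  moreover have "rconst (q ^ N) * (rconst (inverse q) ^ N * (rvar ^ N * \<tau> f)) = rvar ^ N * \<tau> f"
    using q_nz by (simp add: rconst_simps field_simps)
  ultimately show ?thesis by simp
qed

lemma value_gap:
  assumes "regular 0 a" "N > 0"
  shows "has_value (rvar ^ N * a) 0 0"
proof -
  obtain v where "has_value a 0 v" using assms(1) by (auto simp: regular_def)
  from has_value_mult[OF has_value_power[OF has_value_rvar, of N] this] assms(2) show ?thesis
    by (simp add: power_0_left)
qed

lemma regular_0_gap: "symmetric_gap a \<Longrightarrow> regular 0 a"
  by (rule regular_symmetric_gap) auto

lemma symmetric_gap_m: "symmetric_gap m"
  by (intro symmetric_gap_intros symmetric_gap_numeral symmetric_gap_koebe)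

lemma has_value_s: "has_value s 0 0"
  using has_value_power[OF has_value_koebe[of 0], of 2] by simp

lemma has_value_m: "has_value m 0 2"
  using has_value_diff[OF has_value_rconst[of 2] has_value_s] by (simp add: rconst_simps)

lemma s_nz: "s \<noteq> 0"
  by (simp add: koebe_def)

lemma const_combination_s:
  assumes "rconst k + rconst l * s = 0"
  shows "k = 0" "l = 0"
proof -
  have "has_value (rconst k + rconst l * s) 0 (k + l * 0)"
    by (intro has_value_add has_value_mult has_value_rconst has_value_s)
  moreover have "has_value (rconst k + rconst l * s) 0 0"
    unfolding assms using has_value_rconst[of 0] by (simp add: rconst_simps)
  ultimately show "k = 0" using has_value_unique by fastforce
  with assms show "l = 0" using s_nz by (simp add: rconst_simps)
qed

text \<open>Along an orbit the equation determines \<open>f\<close> at \<open>i + 1\<close> from \<open>f\<close> at \<open>i\<close> and conversely, and \<open>f\<close> is regular far out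
  on both sides. The only step that may create a pole is the one at the exceptional index, which separates the
  two halves.\<close>

lemma first_order_regular:
  assumes eq: "f - \<sigma> f = a" and a: "symmetric_gap a" and c: "c \<noteq> 0"
  shows "regular c f"
proof -
  obtain i0 where i0: "\<And>i. i \<noteq> i0 \<Longrightarrow> regular c (shift a i)"
    using exceptional_index[OF c] a by blast
  obtain M where M: "\<And>i. \<bar>i\<bar> \<ge> M \<Longrightarrow> regular c (shift f i)"
    using regular_far[OF c] by blast
  have eq': "shift f i - shift f (i + 1) = shift a i" for i
    by (simp only: eq[symmetric] shift_simps shift_\<sigma>)
  have "regular c (shift f 0)"
  proof (rule two_sided_int_induct[of M "\<lambda>i. regular c (shift f i)" i0, OF M])
    fix i
    have up: "shift f (i + 1) = shift f i - shift a i" and down: "shift f i = shift f (i + 1) + shift a i"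
      using eq'[of i] by (simp_all add: algebra_simps)
    show "regular c (shift f (i + 1))" if "i < i0" "regular c (shift f i)"
      unfolding up using that i0[of i] by (intro regular_intros(4-6)) auto
    show "regular c (shift f i)" if "i > i0" "regular c (shift f (i + 1))"
      unfolding down using that i0[of i] by (intro regular_intros(4-6)) auto
  qed
  then show ?thesis by simp
qed

lemma first_order_regular_0:
  assumes eq: "f - \<sigma> f = a" and a: "symmetric_gap a"
  shows "regular 0 f"
proof -
  have "v = 0" if N: "N > 0" and v: "has_value (rvar ^ N * f) 0 v" for N v
  proof -
    have "has_value (rvar ^ N * f - rvar ^ N * \<sigma> f) 0 (v - inverse q ^ N * v)"
      by (intro has_value_diff value_shift_\<sigma> v)
    moreover have "rvar ^ N * f - rvar ^ N * \<sigma> f = rvar ^ N * a"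
      by (simp add: eq[symmetric] algebra_simps)
    ultimately have "v - inverse q ^ N * v = 0"
      using value_gap[OF regular_0_gap[OF a] N] has_value_unique by fastforce
    then have "v * (q ^ N - 1) = 0" using q_nz by (simp add: field_simps)
    then show "v = 0" using q_free[OF N] by simp
  qed
  then show ?thesis using regular_0_if_values_vanish[of f f] by blast
qed

text \<open>The equation holds for \<open>f' = - \<tau> (recip f)\<close> too, so regularity of \<open>f'\<close> at 0 is regularity of \<open>f\<close> at
  infinity.\<close>

theorem first_order_gap:
  assumes eq: "f - \<sigma> f = a" and a: "symmetric_gap a"
  shows "a = 0" "\<exists>k. f = rconst k"
proof -
  define f' where "f' = - \<tau> (recip f)"
  have ra: "recip a = a" using a by (simp add: symmetric_gap_def)
  have "recip f - \<tau> (recip f) = a"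
    using arg_cong[OF eq, of recip] by (simp add: recip_simps recip_\<sigma> ra)
  then have "f' - \<sigma> f' = a"
    by (simp add: f'_def \<sigma>_simps algebra_simps)
  then have "regular 0 f'" by (rule first_order_regular_0[OF _ a])
  then have "regular 0 (- \<sigma> f')" by (intro regular_intros q_nz) simp
  then have "regular 0 (recip f)" by (simp add: f'_def \<sigma>_simps)
  moreover have "regular c f" for c
    using first_order_regular[OF eq a, of c] first_order_regular_0[OF eq a] by (cases "c = 0") auto
  ultimately show k: "\<exists>k. f = rconst k" by (intro constant_if_regular)
  then show "a = 0" using eq q_nz by (auto simp: dilate_rconst)
qed

lemma second_order_regular:
  assumes eq: "\<sigma> f + \<tau> f - m * f = a" and a: "symmetric_gap a" and c: "c \<noteq> 0"
  shows "regular c f"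
proof -
  obtain i0 where i0: "\<And>i a. i \<noteq> i0 \<Longrightarrow> symmetric_gap a \<Longrightarrow> regular c (shift a i)"
    using exceptional_index[OF c] by blast
  note i0 = i0[OF _ a] i0[OF _ symmetric_gap_m]
  obtain M where M: "\<And>i. \<bar>i\<bar> \<ge> M \<Longrightarrow> regular c (shift f i)"
    using regular_far[OF c] by blast
  have eq': "shift f (i + 1) + shift f (i - 1) - shift m i * shift f i = shift a i" for i
    using arg_cong[OF eq, of "\<lambda>f. shift f i"] by (simp only: shift_simps shift_\<sigma> shift_\<tau>)
  define P where "P i \<longleftrightarrow> regular c (shift f i) \<and> regular c (shift f (i - 1))" for i
  have "P 0"
  proof (rule two_sided_int_induct[of "\<bar>M\<bar> + 1" P i0])
    fix i
    have up: "shift f (i + 1) = shift a i - shift f (i - 1) + shift m i * shift f i"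
      and down: "shift f (i - 1) = shift a i - shift f (i + 1) + shift m i * shift f i"
      using eq'[of i] by (simp_all only: algebra_simps)
    show "P (i + 1)" if i: "i < i0" "P i"
    proof -
      have "regular c (shift f (i + 1))"
        unfolding up using i i0 by (intro regular_intros(4-6)) (auto simp: P_def)
      then show ?thesis using i by (simp add: P_def)
    qed
    show "P i" if i: "i > i0" "P (i + 1)"
    proof -
      have "regular c (shift f (i - 1))"
        unfolding down using i i0 by (intro regular_intros(4-6)) (auto simp: P_def)
      then show ?thesis using i by (simp add: P_def)
    qed
  qed (use M in \<open>auto simp: P_def\<close>)
  then show ?thesis by (simp add: P_def)
qed

text \<open>The equation multiplies the leading coefficient of a pole of order \<open>N\<close> by \<open>(q\<^sup>N - 1)\<^sup>2\<close> up to a unit, since \<open>m\<close> has the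
  value 2 at 0.\<close>

lemma second_order_regular_0:
  assumes eq: "\<sigma> f + \<tau> f - m * f = a" and a: "symmetric_gap a"
  shows "regular 0 f"
proof -
  have "v = 0" if N: "N > 0" and v: "has_value (rvar ^ N * f) 0 v" for N v
  proof -
    have "has_value (rvar ^ N * \<sigma> f + rvar ^ N * \<tau> f - m * (rvar ^ N * f)) 0
        (inverse q ^ N * v + q ^ N * v - 2 * v)"
      by (intro has_value_diff has_value_add has_value_mult value_shift_\<sigma> value_shift_\<tau> has_value_m v)
    moreover have "rvar ^ N * \<sigma> f + rvar ^ N * \<tau> f - m * (rvar ^ N * f) = rvar ^ N * a"
      by (simp add: eq[symmetric] algebra_simps)
    ultimately have "inverse q ^ N * v + q ^ N * v - 2 * v = 0"
      using value_gap[OF regular_0_gap[OF a] N] has_value_unique by fastforce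
    then have "q ^ N * (inverse q ^ N * v + q ^ N * v - 2 * v) = 0" by simp
    then have "v * ((q ^ N - 1) * (q ^ N - 1)) = 0" using q_nz by (simp add: field_simps)
    then show "v = 0" using q_free[OF N] by simp
  qed
  then show ?thesis using regular_0_if_values_vanish[of f f] by blast
qed

theorem second_order_gap:
  assumes eq: "\<sigma> f + \<tau> f - m * f = a" and a: "symmetric_gap a"
  shows "\<exists>k. f = rconst k"
proof -
  have "recip a = a" "recip m = m" using a symmetric_gap_m by (simp_all only: symmetric_gap_def)
  then have "\<sigma> (recip f) + \<tau> (recip f) - m * recip f = a"
    using arg_cong[OF eq, of recip] by (simp only: recip_simps recip_\<sigma> recip_\<tau> add.commute)
  then have "regular 0 (recip f)" by (rule second_order_regular_0[OF _ a])
  moreover have "regular c f" for c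
    using second_order_regular[OF eq a, of c] second_order_regular_0[OF eq a] by (cases "c = 0") auto
  ultimately show ?thesis by (intro constant_if_regular)
qed

corollary second_order_kernel:
  assumes "\<sigma> f + \<tau> f - m * f = 0"
  shows "f = 0"
proof -
  obtain k where k: "f = rconst k"
    using second_order_gap[OF assms] symmetric_gap_intros(1)[of 0] by (auto simp: rconst_simps)
  with assms have "rconst k * s = 0"
    using q_nz by (simp add: dilate_rconst algebra_simps)
  then show ?thesis using k s_nz by simp
qed

end

lemma to_fract_numeral: "to_fract (numeral k) = numeral k"
  by (rule unital_ring_homD) (simp add: unital_ring_hom_def)

context q_field
begin

text \<open>The two equations are a recursion for the triple of \<open>e\<close>, \<open>h\<close> and the previous \<open>h\<close>, with coefficients that are
  regular except at one index.\<close>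

lemma self_extension_regular:
  assumes F1: "e + \<sigma> e = 2 * m * h" and F2: "\<sigma> h = \<tau> h + a - m * (e - m * h)"
    and a: "symmetric_gap a" and c: "c \<noteq> 0"
  shows "regular c e" "regular c h"
proof -
  obtain i0 where "\<And>i a. i \<noteq> i0 \<Longrightarrow> symmetric_gap a \<Longrightarrow> regular c (shift a i)"
    using exceptional_index[OF c] by blast
  note i0 = this[OF _ a] this[OF _ symmetric_gap_m]
  obtain M1 M2 where "\<And>i. \<bar>i\<bar> \<ge> M1 \<Longrightarrow> regular c (shift e i)" "\<And>i. \<bar>i\<bar> \<ge> M2 \<Longrightarrow> regular c (shift h i)"
    using regular_far[OF c] by metis
  then obtain M where M: "\<And>i. \<bar>i\<bar> \<ge> M \<Longrightarrow> regular c (shift e i) \<and> regular c (shift h i)"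
    by (metis max.bounded_iff)
  have F1': "shift e i + shift e (i + 1) = 2 * shift m i * shift h i" for i
    using arg_cong[OF F1, of "\<lambda>f. shift f i"] by (simp only: shift_simps shift_\<sigma>)
  have F2': "shift h (i + 1) = shift h (i - 1) + shift a i - shift m i * (shift e i - shift m i * shift h i)" for i
    using arg_cong[OF F2, of "\<lambda>f. shift f i"] by (simp only: shift_simps shift_\<sigma> shift_\<tau>)
  define P where "P i \<longleftrightarrow> regular c (shift e i) \<and> regular c (shift h i) \<and> regular c (shift h (i - 1))" for i
  have "P 0"
  proof (rule two_sided_int_induct[of "\<bar>M\<bar> + 1" P i0])
    fix i
    have up: "shift e (i + 1) = 2 * shift m i * shift h i - shift e i"
      and down: "shift e i = 2 * shift m i * shift h i - shift e (i + 1)"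
        "shift h (i - 1) = shift h (i + 1) - shift a i + shift m i * (shift e i - shift m i * shift h i)"
      using F1'[of i] F2'[of i] by (simp_all only: algebra_simps)
    show "P (i + 1)" if i: "i < i0" "P i"
    proof -
      have "regular c (shift e (i + 1))"
        unfolding up using i i0 by (intro regular_intros(4-6) regular_numeral) (auto simp: P_def)
      moreover have "regular c (shift h (i + 1))"
        unfolding F2' using i i0 by (intro regular_intros(4-6)) (auto simp: P_def)
      ultimately show ?thesis using i by (simp add: P_def)
    qed
    show "P i" if i: "i > i0" "P (i + 1)"
    proof -
      have h: "regular c (shift h i)" "regular c (shift h (i + 1))" "regular c (shift e (i + 1))"
        using i by (simp_all add: P_def)
      then have e: "regular c (shift e i)"
        unfolding down(1) using i i0 by (intro regular_intros(4-6) regular_numeral) auto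
      have "regular c (shift h (i - 1))"
        unfolding down(2) using i i0 h e by (intro regular_intros(4-6)) auto
      then show ?thesis using e h by (simp add: P_def)
    qed
  qed (use M in \<open>auto simp: P_def\<close>)
  then show "regular c e" "regular c h" by (simp_all add: P_def)
qed

text \<open>Writing \<open>v\<close> and \<open>w\<close> for the leading coefficients of poles of order \<open>N\<close> and \<open>Q\<close> for the \<open>N\<close>-th power of
  \<open>q\<close>, the two equations become a linear system in \<open>v\<close> and \<open>w\<close>, from which elimination of \<open>v\<close> leaves
  \<open>(Q - 1)\<^sup>3 w = 0\<close>. The elimination never divides by 2, so it is valid in every characteristic.\<close>

lemma self_extension_regular_0:
  assumes F1: "e + \<sigma> e = 2 * m * h" and F2: "\<sigma> h = \<tau> h + a - m * (e - m * h)"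
    and a: "symmetric_gap a"
  shows "regular 0 e" "regular 0 h"
proof -
  have "v = 0 \<and> w = 0" if N: "N > 0"
    and v: "has_value (rvar ^ N * e) 0 v" and w: "has_value (rvar ^ N * h) 0 w" for N v w
  proof -
    let ?Q = "q ^ N"
    have Qinv: "?Q * inverse q ^ N = 1"
      using q_nz by (simp add: power_inverse)
    have "has_value (rvar ^ N * e + rvar ^ N * \<sigma> e) 0 (v + inverse q ^ N * v)"
      by (intro has_value_add value_shift_\<sigma> v)
    moreover have "has_value (rconst 2 * m * (rvar ^ N * h)) 0 (2 * 2 * w)"
      by (intro has_value_mult has_value_rconst has_value_m w)
    moreover have "rvar ^ N * e + rvar ^ N * \<sigma> e = rconst 2 * m * (rvar ^ N * h)"
      using F1 by (simp add: rconst_simps flip: distrib_left)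
    ultimately have "v + inverse q ^ N * v = 2 * 2 * w"
      using has_value_unique by metis
    moreover have "(Q + 1) * v = 4 * Q * w" if "v + I * v = 2 * 2 * w" "Q * I = 1" for Q I
    proof -
      have "(Q + 1) * v = Q * (v + I * v)" using that(2) by (simp add: distrib_left distrib_right flip: mult.assoc)
      then show ?thesis by (simp add: that(1) mult_ac)
    qed
    ultimately have 1: "(?Q + 1) * v = 4 * ?Q * w" using Qinv by blast
    have "has_value (rvar ^ N * \<tau> h + rvar ^ N * a - m * (rvar ^ N * e - m * (rvar ^ N * h))) 0
        (q ^ N * w + 0 - 2 * (v - 2 * w))"
      by (intro has_value_add has_value_mult has_value_diff value_shift_\<tau> has_value_m v w
          value_gap regular_0_gap a N)
    moreover have "rvar ^ N * \<tau> h + rvar ^ N * a - m * (rvar ^ N * e - m * (rvar ^ N * h)) = rvar ^ N * \<sigma> h"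
      unfolding F2 by (simp add: algebra_simps)
    ultimately have "q ^ N * w + 0 - 2 * (v - 2 * w) = inverse q ^ N * w"
      using has_value_unique value_shift_\<sigma>[OF w] by metis
    moreover have "(Q * Q + 4 * Q - 1) * w = 2 * Q * v" if "Q * w + 0 - 2 * (v - 2 * w) = I * w" "Q * I = 1" for Q I
    proof -
      have "Q * (Q * w + 0 - 2 * (v - 2 * w)) = w" using that by (simp flip: mult.assoc)
      then show ?thesis by (simp add: algebra_simps)
    qed
    ultimately have 2: "(?Q * ?Q + 4 * ?Q - 1) * w = 2 * ?Q * v"
      using Qinv by blast
    have "(Q - 1) * (Q - 1) * (Q - 1) * w = 0"
      if "(Q + 1) * v = 4 * Q * w" "(Q * Q + 4 * Q - 1) * w = 2 * Q * v" for Q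
    proof -
      have "(Q + 1) * ((Q * Q + 4 * Q - 1) * w) = 2 * Q * ((Q + 1) * v)"
        unfolding that(2) by (simp only: mult_ac)
      then have "(Q + 1) * ((Q * Q + 4 * Q - 1) * w) - 2 * Q * (4 * Q * w) = 0"
        unfolding that(1) by simp
      then show ?thesis by (simp add: algebra_simps)
    qed
    from this[OF 1 2] have w0: "w = 0" using q_free[OF N] by simp
    have "?Q + 1 \<noteq> 0"
    proof
      assume "?Q + 1 = 0"
      then have "?Q = -1" by (simp add: eq_neg_iff_add_eq_0)
      then have "q ^ (2 * N) = 1" by (simp add: power_mult mult.commute[of 2])
      then show False using q_free[of "2 * N"] N by simp
    qed
    then show ?thesis using 1 w0 by simp
  qed
  then show "regular 0 e" "regular 0 h" using regular_0_if_values_vanish[of e h] by blast+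
qed

text \<open>These are the equations saying that \<open>P (g + h x) + a\<close> is a left multiple of \<open>P\<close>. The
  substitution \<open>e = g - \<tau> g + m h\<close> makes the system recursive in both directions along an orbit, and
  \<open>(e, h) \<mapsto> (- \<tau> (recip e), - recip h)\<close> preserves it. So \<open>e\<close> and \<open>h\<close> are constant; then \<open>g - \<tau> g\<close> is a combination of 1 and
  \<open>s\<close>, and the first-order theorem applies to it.\<close>

theorem self_extension_gap:
  assumes E1: "a - m * (g - \<tau> g) + \<tau> h - \<sigma> h = 0"
    and E2: "\<sigma> g - \<tau> g - m * h + \<sigma> m * \<sigma> h = 0"
    and a: "symmetric_gap a"
  shows "a = 0" "h = 0" "\<sigma> g = g"
proof -
  define d where "d = g - \<tau> g"
  define e where "e = d + m * h"
  have \<sigma>e: "\<sigma> e = \<sigma> g - g + \<sigma> m * \<sigma> h"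
    by (simp only: e_def d_def \<sigma>_simps \<sigma>\<tau>)
  have F1: "e + \<sigma> e = 2 * m * h"
  proof -
    have "(g - tg + M * h) + (sg - g + SM * sh) = 2 * M * h" if "sg - tg - M * h + SM * sh = 0"
      for sg tg M SM sh :: "'c poly fract"
    proof -
      have "sg = tg + M * h - SM * sh" using that by (simp add: algebra_simps)
      then show ?thesis by (simp add: algebra_simps)
    qed
    from this[OF E2] show ?thesis by (simp only: \<sigma>e) (simp only: e_def d_def)
  qed
  have F2: "\<sigma> h = \<tau> h + a - m * (e - m * h)"
    using E1 by (simp add: e_def d_def algebra_simps)
  define e' h' where "e' = - \<tau> (recip e)" and "h' = - recip h"
  have r: "recip m = m" "recip a = a"
    using a symmetric_gap_m by (simp_all only: symmetric_gap_def)
  have F1r: "recip e + \<tau> (recip e) = 2 * m * recip h"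
    using arg_cong[OF F1, of recip] by (simp only: recip_simps recip_\<sigma> recip_koebe r)
  have F2r: "\<tau> (recip h) = \<sigma> (recip h) + a - m * (recip e - m * recip h)"
    using arg_cong[OF F2, of recip] by (simp only: recip_simps recip_\<sigma> recip_\<tau> recip_koebe r)
  have "e' + \<sigma> e' = 2 * m * h'"
    using F1r by (simp add: e'_def h'_def \<sigma>_simps algebra_simps)
  moreover have "\<sigma> h' = \<tau> h' + a - m * (e' - m * h')"
  proof -
    have "- te - M * (- rh) = re - M * rh" if "re + te = 2 * M * rh" for te re rh M :: "'c poly fract"
    proof -
      have "te = 2 * M * rh - re" using that by (simp add: algebra_simps)
      then show ?thesis by (simp add: algebra_simps)
    qed
    from this[OF F1r] have "e' - m * h' = recip e - m * recip h"
      by (simp only: e'_def h'_def)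
    moreover have "- (\<sigma> (recip h)) = - (\<tau> (recip h)) + a - m * (recip e - m * recip h)"
      unfolding F2r by simp
    ultimately show ?thesis by (simp only: h'_def \<sigma>_simps \<tau>_simps)
  qed
  ultimately have reg': "regular 0 e'" "regular 0 h'"
    using self_extension_regular_0 a by blast+
  have "recip e = - \<sigma> e'" "recip h = - h'" by (simp_all add: e'_def h'_def \<sigma>_simps)
  then have rec: "regular 0 (recip e)" "regular 0 (recip h)"
    using reg' regular_intros(7) regular_intros(9)[OF q_nz, of 0 e'] by auto
  have reg: "regular c e" "regular c h" for c
    using self_extension_regular[OF F1 F2 a, of c] self_extension_regular_0[OF F1 F2 a] by (cases "c = 0"; simp)+
  obtain k l where k: "e = rconst k" and l: "h = rconst l"
    using constant_if_regular[OF reg(1) rec(1)] constant_if_regular[OF reg(2) rec(2)] by blast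
  have "rconst (2 * k - 4 * l) + rconst (2 * l) * s = 0"
    using F1 q_nz unfolding k l by (simp add: dilate_rconst rconst_simps algebra_simps)
  from const_combination_s[OF this] have l2: "2 * l = 0" by simp
  have "d = e - m * h" by (simp add: e_def)
  also have "\<dots> = rconst k + rconst l * s - rconst (2 * l)"
    by (simp add: k l rconst_simps algebra_simps)
  finally have d: "d = rconst k + rconst l * s" by (simp add: l2 rconst_simps)
  then have "symmetric_gap (- d)"
    by (simp only:) (intro symmetric_gap_intros symmetric_gap_koebe)
  moreover have "\<tau> g - \<sigma> (\<tau> g) = - d" by (simp add: d_def)
  ultimately have d0: "d = 0" using first_order_gap(1) by fastforce
  then have "k = 0" "l = 0" using d const_combination_s[of k l] by simp_all
  then show h: "h = 0" by (simp add: l rconst_simps)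
  show "a = 0" using E1 d0 by (simp add: h d_def \<sigma>_simps \<tau>_simps)
  show "\<sigma> g = g" using d0 by (metis d_def eq_iff_diff_eq_0 \<sigma>\<tau>(1))
qed

lemma \<tau>_to_fract: "\<tau> (to_fract p) = to_fract (pcompose p [:0, inverse q:])"
  by (simp add: dilate_to_fract q_nz)

text \<open>Numerator and denominator of a solution \<open>b = n/r\<close> in lowest terms: by coprimality the dilated numerator
  \<open>n'\<close> and \<open>r\<close> divide each other up to factors of \<open>\<psi>\<close>. These factors are powers of \<open>1 - y\<close>, coprime to each other,
  and of equal degree because \<open>n\<close> and \<open>r\<close> have equal degree; hence they are constants.\<close>

lemma riccati_polynomial:
  fixes n r :: "'c poly"
  defines "\<psi> \<equiv> (1 - [:0, 1:]) ^ 4"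
  defines "n' \<equiv> pcompose n [:0, inverse q:]" and "r' \<equiv> pcompose r [:0, inverse q:]"
  assumes eq: "n' * ((2 * \<psi> - [:0, 1:] ^ 2) * r - \<psi> * n) = \<psi> * r * r'"
    and cop: "coprime n r" and r: "r \<noteq> 0"
  shows "\<exists>k. k \<noteq> 0 \<and> n' = smult k r"
proof -
  have deg': "degree n' = degree n" "degree r' = degree r"
    by (simp_all add: n'_def r'_def degree_pcompose q_nz)
  have nz: "r' \<noteq> 0" "\<psi> \<noteq> 0"
    using r by (auto simp: r'_def pcompose_eq_0_iff q_nz \<psi>_def one_pCons)
  have nn: "n' \<noteq> 0"
  proof
    assume "n' = 0"
    then show False using eq nz r by simp
  qed
  then have nn: "n' \<noteq> 0" "n \<noteq> 0" by (auto simp: n'_def)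
  have \<psi>deg: "degree \<psi> = 4" by (simp add: \<psi>_def one_pCons degree_power_eq)
  have dM: "degree (2 * \<psi> - [:0, 1:] ^ 2) \<le> 4"
  proof (rule degree_diff_le)
    show "degree (2 * \<psi>) \<le> 4"
      using degree_mult_le[of 2 \<psi>] \<psi>deg by (simp add: numeral_poly)
    show "degree ([:0, 1:] ^ 2 :: 'c poly) \<le> 4" by (simp add: degree_power_eq)
  qed
  have eq2: "n' * (2 * \<psi> - [:0, 1:] ^ 2) * r = \<psi> * (n * n' + r * r')"
    using eq by (simp add: algebra_simps)
  have deg: "degree n = degree r"
  proof (rule ccontr)
    assume ne: "degree n \<noteq> degree r"
    have d1: "degree (n * n') = 2 * degree n" "degree (r * r') = 2 * degree r"
      using nn r nz by (simp_all add: degree_mult_eq deg')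
    have d: "degree (n * n' + r * r') = 2 * max (degree n) (degree r)"
      using ne d1 by (cases "degree n < degree r") (simp_all add: degree_add_eq_left degree_add_eq_right)
    then have "n * n' + r * r' \<noteq> 0" using ne by auto
    then have "degree (\<psi> * (n * n' + r * r')) = 4 + 2 * max (degree n) (degree r)"
      using nz by (simp add: degree_mult_eq \<psi>deg d)
    moreover have "degree (n' * (2 * \<psi> - [:0, 1:] ^ 2) * r) \<le> degree n + 4 + degree r"
      using degree_mult_le[of "n' * (2 * \<psi> - [:0, 1:] ^ 2)" r]
        degree_mult_le[of n' "2 * \<psi> - [:0, 1:] ^ 2"] dM deg' by linarith
    ultimately show False using eq2 ne by (auto simp: max_def split: if_splits)
  qed
  have cop': "coprime n' r'"
  proof (rule coprimeI)
    fix d assume d: "d dvd n'" "d dvd r'"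
    have inv: "pcompose (pcompose p [:0, inverse q:]) [:0, q:] = p" for p
      using q_nz by (simp add: pcompose_pCons flip: pcompose_assoc)
    have "pcompose d [:0, q:] dvd p" if dvd: "d dvd pcompose p [:0, inverse q:]" for p
    proof -
      obtain t where "pcompose p [:0, inverse q:] = d * t" using dvd by (auto simp: dvd_def)
      then have "p = pcompose d [:0, q:] * pcompose t [:0, q:]"
        using inv[of p] by (simp add: pcompose_mult)
      then show ?thesis by simp
    qed
    then have "is_unit (pcompose d [:0, q:])"
      using d cop unfolding n'_def r'_def by (meson coprime_common_divisor)
    then have "degree (pcompose d [:0, q:]) = 0" by (auto simp: is_unit_poly_iff) 
    then have "degree d = 0" by (simp add: degree_pcompose q_nz)
    moreover have "d \<noteq> 0" using d nn by auto
    ultimately show "is_unit d" by (simp add: is_unit_iff_degree)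
  qed
  have "r dvd n' * \<psi> * n"
  proof -
    have "n' * \<psi> * n = r * (n' * (2 * \<psi> - [:0, 1:] ^ 2) - \<psi> * r')"
      using eq2 by (simp add: algebra_simps)
    then show ?thesis by simp
  qed
  then have r_dvd: "r dvd n' * \<psi>"
    using cop by (simp add: coprime_dvd_mult_left_iff coprime_commute)
  have "n' dvd \<psi> * r * r'" by (simp flip: eq)
  then have n_dvd: "n' dvd \<psi> * r"
    using cop' by (simp add: coprime_dvd_mult_left_iff)
  define g where "g = gcd r n'"
  obtain r1 n1 where g: "r = r1 * g" "n' = n1 * g" "coprime r1 n1"
    using gcd_coprime_exists[of r n'] r unfolding g_def by auto
  then have gz: "g \<noteq> 0" using r by auto
  have "r1 dvd n1 * \<psi>" using r_dvd gz unfolding g(1,2) by (simp add: mult_ac)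
  then have r1: "r1 dvd \<psi>" using g(3) by (simp add: coprime_dvd_mult_right_iff)
  have "n1 dvd \<psi> * r1" using n_dvd gz unfolding g(1,2) by (simp add: mult_ac)
  then have n1: "n1 dvd \<psi>" using g(3) by (simp add: coprime_dvd_mult_left_iff coprime_commute)
  have dg: "degree r1 = degree n1"
    using deg deg' g gz nn r by (auto simp: degree_mult_eq)
  have root1: "poly p 1 = 0" if dvd: "p dvd \<psi>" and dp: "degree p \<noteq> 0" for p
  proof -
    obtain c where c: "poly p c = 0" using alg_closed_imp_poly_has_root[of p] dp by blast
    then have "poly \<psi> c = 0" using dvd by (metis dvdE mult_zero_left poly_mult)
    then show ?thesis using c by (simp add: \<psi>_def)
  qed
  have "degree r1 = 0"
  proof (rule ccontr)
    assume "degree r1 \<noteq> 0"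
    then have "[:-1, 1:] dvd r1" "[:-1, 1:] dvd n1"
      using root1[OF r1] root1[OF n1] dg by (simp_all add: poly_eq_0_iff_dvd)
    then have "is_unit ([:-1, 1:] :: 'c poly)" using g(3) by (meson coprime_common_divisor)
    then show False by (simp add: is_unit_pCons_iff)
  qed
  then obtain k l where kl: "r1 = [:k:]" "n1 = [:l:]" using dg by (metis degree_eq_zeroE)
  then have "k \<noteq> 0" "l \<noteq> 0" using g r nn by auto
  then have "n' = smult (l / k) r" "l / k \<noteq> 0" using g kl by simp_all
  then show ?thesis by blast
qed

text \<open>A solution would give \<open>P\<close> a right factor of order one. By the preceding lemma it has the form
  \<open>b = k \<sigma> F / F\<close> with a polynomial \<open>F\<close> that does not vanish at 0. The values at 0 force \<open>k = 1\<close>, so that \<open>F\<close> would be a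
  nonzero solution of the second-order equation.\<close>

theorem riccati: "\<tau> b * (m - b) \<noteq> 1"
proof
  assume eq: "\<tau> b * (m - b) = 1"
  let ?X = "[:0, 1:] :: 'c poly"
  define n r where "n = fst (quot_of_fract b)" and "r = snd (quot_of_fract b)"
  have b: "b = to_fract n / to_fract r" and r: "r \<noteq> 0" and cop: "coprime n r"
    by (simp_all add: n_def r_def coprime_quot_of_fract flip: Fract_conv_to_fract)
  define n' r' where "n' = pcompose n [:0, inverse q:]" and "r' = pcompose r [:0, inverse q:]"
  have r': "r' \<noteq> 0" using r by (simp add: r'_def pcompose_eq_0_iff q_nz)
  have \<tau>b: "\<tau> b = to_fract n' / to_fract r'"
    unfolding b unital_ring_hom_divide[OF unital_ring_hom_dilate[OF inverse_q_nz]] \<tau>_to_fract n'_def r'_def ..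
  let ?\<psi> = "(1 - ?X) ^ 4"
  have \<psi>: "to_fract ?\<psi> = (1 - rvar) ^ 4" by (simp only: to_fract_power to_fract_diff to_fract_1 rvar_def)
  have X: "to_fract (?X ^ 2) = rvar ^ 2" by (simp only: to_fract_power rvar_def)
  have \<psi>m: "(1 - rvar) ^ 4 * m = 2 * (1 - rvar) ^ 4 - rvar ^ 2"
  proof -
    have "(1 - rvar) ^ 4 * s = rvar ^ 2 * (inverse ((1 - rvar) ^ 4) * (1 - rvar :: 'c poly fract) ^ 4)"
      by (simp add: koebe_def power_mult_distrib power_inverse mult_ac flip: power_mult)
    also have "\<dots> = rvar ^ 2" by simp
    finally show ?thesis by (simp add: algebra_simps)
  qed
  have "to_fract n' * ((2 * (1 - rvar) ^ 4 - rvar ^ 2) * to_fract r - (1 - rvar) ^ 4 * to_fract n) =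
      (1 - rvar) ^ 4 * to_fract r * to_fract r' * (\<tau> b * (m - b))"
  proof -
    have "N' * (M * R - \<psi> * N) = \<psi> * R * R' * (N' / R' * (k - N / R))"
      if "\<psi> * k = M" "R \<noteq> 0" "R' \<noteq> 0" for N N' R R' \<psi> M k :: "'c poly fract"
      using that(2,3) unfolding that(1)[symmetric] by (simp add: field_simps)
    note * = this[OF \<psi>m, of "to_fract r" "to_fract r'" "to_fract n'" "to_fract n"]
    have "to_fract r \<noteq> 0" "to_fract r' \<noteq> 0" using r r' by simp_all
    from *[OF this] show ?thesis by (simp only: \<tau>b b[symmetric])
  qed
  then have "to_fract (n' * ((2 * ?\<psi> - ?X ^ 2) * r - ?\<psi> * n)) = to_fract (?\<psi> * r * r')"
    unfolding eq by (simp only: to_fract_mult to_fract_diff \<psi> X mult_1_right)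
      (simp add: to_fract_numeral)
  then have "n' * ((2 * ?\<psi> - ?X ^ 2) * r - ?\<psi> * n) = ?\<psi> * r * r'"
    by (simp only: to_fract_eq_iff)
  from riccati_polynomial[OF this[unfolded n'_def r'_def] cop r]
  obtain k where k: "k \<noteq> 0" "n' = smult k r" by (auto simp: n'_def)
  let ?F = "to_fract r"
  have F: "?F \<noteq> 0" "\<tau> ?F \<noteq> 0" using r by (simp_all add: \<tau>_simps)
  have tb: "\<tau> b = rconst k * ?F / \<tau> ?F"
    by (simp add: \<tau>b k(2) to_fract_smult \<tau>_to_fract r'_def)
  have "b = \<sigma> (\<tau> b)" by simp
  also have "\<dots> = rconst k * \<sigma> ?F / ?F"
    unfolding tb using q_nz
    by (simp add: unital_ring_hom_divide[OF unital_ring_hom_dilate[OF q_nz]] \<sigma>_simps dilate_rconst)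
  finally have sb: "b = rconst k * \<sigma> ?F / ?F" .
  have eq3: "rconst k * m * ?F - rconst k * rconst k * \<sigma> ?F = \<tau> ?F"
    using eq[unfolded tb] sb F by (simp add: field_simps)
  have r0: "poly r 0 \<noteq> 0"
  proof
    assume 0: "poly r 0 = 0"
    have "poly n 0 = poly n' 0" by (simp add: n'_def poly_pcompose)
    then have "poly n 0 = 0" using k 0 by simp
    then have "[:0, 1:] dvd n" "[:0, 1:] dvd r" using 0 by (simp_all add: poly_eq_0_iff_dvd)
    then have "is_unit ([:0, 1:] :: 'c poly)" using cop by (meson coprime_common_divisor)
    then show False by (simp add: is_unit_pCons_iff)
  qed
  have F0: "has_value ?F 0 (poly r 0)" by (rule has_value_to_fract)
  have "has_value (\<tau> ?F) 0 (poly r 0)" "has_value (\<sigma> ?F) 0 (poly r 0)"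
    using has_value_dilate[OF inverse_q_nz, of ?F 0] has_value_dilate[OF q_nz, of ?F 0] F0 by simp_all
  moreover from this have "has_value (rconst k * m * ?F - rconst k * rconst k * \<sigma> ?F) 0
      (k * 2 * poly r 0 - k * k * poly r 0)"
    by (intro has_value_diff has_value_mult has_value_rconst has_value_m F0)
  ultimately have "k * 2 * poly r 0 - k * k * poly r 0 = poly r 0"
    unfolding eq3 using has_value_unique by blast
  then have "(k - 1) * (k - 1) * poly r 0 = 0" by (simp add: algebra_simps)
  then have "k = 1" using r0 by simp
  then have "\<sigma> ?F + \<tau> ?F - m * ?F = 0"
    using eq3 by (simp add: rconst_simps algebra_simps)
  then show False using second_order_kernel F by blast
qed

text \<open>The inverse of \<open>1 + koebe\<close> vanishes at 1. Dividing by the highest power and evaluating there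
  isolates its coefficient.\<close>

theorem independent_u_powers:
  fixes c :: "int \<Rightarrow> 'c"
  assumes "finite S" and eq: "(\<Sum>n\<in>S. rconst (c n) * (1 + koebe) powi n) = 0" and "n \<in> S"
  shows "c n = 0"
proof (rule ccontr)
  let ?u = "1 + koebe :: 'c poly fract"
  assume "c n \<noteq> 0"
  define T where "T = {n \<in> S. c n \<noteq> 0}"
  have T: "finite T" "T \<noteq> {}" using assms \<open>c n \<noteq> 0\<close> by (auto simp: T_def)
  define n0 where "n0 = Max T"
  have n0: "n0 \<in> T" "\<And>n. n \<in> T \<Longrightarrow> n \<le> n0" using T by (auto simp: n0_def)
  have val: "has_value (inverse ?u) 1 0"
    using has_value_inverse_one_plus_koebe[of 1] by simp
  have "(\<Sum>n\<in>T. rconst (c n) * ?u powi n) = 0"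
  proof -
    have "(\<Sum>n\<in>T. rconst (c n) * ?u powi n) = (\<Sum>n\<in>S. rconst (c n) * ?u powi n)"
      using assms(1) by (intro sum.mono_neutral_left) (auto simp: T_def rconst_simps)
    then show ?thesis by (simp add: eq)
  qed
  then have "0 = (\<Sum>n\<in>T. rconst (c n) * ?u powi n) * ?u powi (- n0)" by simp
  also have "\<dots> = (\<Sum>n\<in>T. rconst (c n) * inverse ?u ^ nat (n0 - n))"
  proof -
    have "?u powi n * ?u powi (- n0) = inverse ?u ^ nat (n0 - n)" if "n \<in> T" for n
    proof -
      have "inverse ?u ^ nat (n0 - n) = inverse ?u powi (n0 - n)"
        using n0(2)[OF that] by (simp add: power_int_nonneg_exp)
      also have "\<dots> = ?u powi (n - n0)"
        by (simp add: power_int_inverse flip: power_int_minus)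
      finally show ?thesis by (simp flip: power_int_add)
    qed
    then show ?thesis unfolding sum_distrib_right by (intro sum.cong) (auto simp: mult.assoc)
  qed
  finally have z: "(\<Sum>n\<in>T. rconst (c n) * inverse ?u ^ nat (n0 - n)) = 0" by simp
  have "has_value (\<Sum>n\<in>T. rconst (c n) * inverse ?u ^ nat (n0 - n)) 1 (\<Sum>n\<in>T. c n * 0 ^ nat (n0 - n))"
    using T(1)
  proof (induction T rule: finite_induct)
    case empty
    show ?case using has_value_rconst[of 0] by (simp add: rconst_simps)
  next
    case (insert n T)
    show ?case
      unfolding sum.insert[OF insert.hyps]
      by (intro has_value_add has_value_mult has_value_rconst has_value_power val insert.IH)
  qed
  moreover have "(\<Sum>n\<in>T. c n * 0 ^ nat (n0 - n)) = (\<Sum>n\<in>T. if n = n0 then c n else 0)"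
    by (intro sum.cong) (use n0(2) in \<open>fastforce simp: power_0_left\<close>)+
  ultimately have "has_value 0 1 (c n0)" using z T(1) n0(1) by simp
  moreover have "has_value (0 :: 'c poly fract) 1 0" using has_value_rconst[of 0] by (simp add: rconst_simps)
  ultimately have "c n0 = 0" by (rule has_value_unique)
  then show False using n0(1) by (simp add: T_def)
qed

end

section \<open>Descent from the algebraic closure of the constants\<close>

text \<open>The pole arguments need all roots of denominators to be present, but the division ring contains only
  rational functions over \<open>k(q)\<close>. So the theorems are transferred along the inclusion of constants into their algebraic
  closure.\<close>

definition to_acf :: "'c::field poly fract \<Rightarrow> 'c alg_closure poly fract" where
  "to_acf = ratfun_hom (\<lambda>c. rconst (to_ac c)) rvar"

lemma unital_ring_hom_rconst_to_ac: "unital_ring_hom (\<lambda>c. rconst (to_ac c))"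
  by (rule unital_ring_hom_comp[OF unital_ring_hom_rconst]) (simp add: unital_ring_hom_def)

lemma to_acf_nz:
  fixes p :: "'c::field poly"
  assumes "p \<noteq> 0"
  shows "poly_hom (\<lambda>c. rconst (to_ac c)) rvar p \<noteq> 0"
proof -
  have "poly_hom (\<lambda>c. rconst (to_ac c)) rvar p = poly_hom rconst rvar (map_poly to_ac p)" for p :: "'c poly"
    by (simp add: poly_hom_def coeff_map_poly degree_map_poly)
  moreover have "map_poly to_ac p \<noteq> 0"
    using assms by (metis coeff_0 coeff_map_poly leading_coeff_0_iff to_ac_0 to_ac_eq_0_iff)
  ultimately show ?thesis by (simp add: poly_hom_rconst_rvar)
qed

lemma to_acf:
  shows unital_ring_hom_to_acf: "unital_ring_hom to_acf"
    and to_acf_rconst: "to_acf (rconst c) = rconst (to_ac c)"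
    and to_acf_rvar: "to_acf rvar = rvar"
  unfolding to_acf_def
  using ratfun_hom[OF unital_ring_hom_rconst_to_ac mult.commute to_acf_nz] by blast+

lemmas to_acf_simps = unital_ring_homD[OF unital_ring_hom_to_acf]
  unital_ring_hom_field[OF unital_ring_hom_to_acf] unital_ring_hom_divide[OF unital_ring_hom_to_acf]

lemma to_acf_dilate:
  assumes "Q \<noteq> 0"
  shows "to_acf (dilate Q f) = dilate (to_ac Q) (to_acf f)"
proof (rule ratfun_hom_unique[where f = "\<lambda>f. to_acf (dilate Q f)" and g = "\<lambda>f. dilate (to_ac Q) (to_acf f)"])
  show "unital_ring_hom (\<lambda>f. to_acf (dilate Q f))" "unital_ring_hom (\<lambda>f. dilate (to_ac Q) (to_acf f))"
    using assms by (simp_all add: unital_ring_hom_dilate unital_ring_hom_to_acf unital_ring_hom_comp)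
  show "to_acf (dilate Q rvar) = dilate (to_ac Q) (to_acf rvar)"
    using assms by (simp add: dilate_rvar to_acf_rvar to_acf_rconst to_acf_simps)
  show "to_acf (dilate Q (rconst c)) = dilate (to_ac Q) (to_acf (rconst c))" for c
    using assms by (simp add: dilate_rconst to_acf_rconst)
qed

lemma to_acf_koebe: "to_acf koebe = koebe"
  by (simp add: koebe_def to_acf_simps to_acf_rvar)

instance alg_closure :: (field) field_gcd ..

locale generic_parameter =
  fixes q :: "'c::field"
  assumes q_nz: "q \<noteq> 0" and q_free: "n > 0 \<Longrightarrow> q ^ n \<noteq> 1"

sublocale generic_parameter \<subseteq> ac: q_field "to_ac q"
proof
  show "to_ac q \<noteq> 0" using q_nz by simp
  show "to_ac q ^ n \<noteq> 1" if "n > 0" for n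
    using q_free[OF that] by (metis to_ac_1 to_ac_eq_iff to_ac_power)
qed

context generic_parameter
begin

abbreviation \<sigma> where "\<sigma> \<equiv> dilate q"
abbreviation \<tau> where "\<tau> \<equiv> dilate (inverse q)"
abbreviation u where "u \<equiv> 1 + (koebe :: 'c poly fract)"
abbreviation s where "s \<equiv> (koebe :: 'c poly fract) ^ 2"
abbreviation m where "m \<equiv> 2 - s"

definition gap :: "'c poly fract \<Rightarrow> bool" where
  "gap a \<longleftrightarrow> symmetric_gap (to_acf a)"

lemma inverse_q_nz: "inverse q \<noteq> 0" using q_nz by simp

lemmas \<sigma>_simps = unital_ring_homD[OF unital_ring_hom_dilate[OF q_nz]]
  unital_ring_hom_field[OF unital_ring_hom_dilate[OF q_nz]]
lemmas \<tau>_simps = unital_ring_homD[OF unital_ring_hom_dilate[OF inverse_q_nz]]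
  unital_ring_hom_field[OF unital_ring_hom_dilate[OF inverse_q_nz]]

lemma \<sigma>\<tau> [simp]: "\<sigma> (\<tau> f) = f" "\<tau> (\<sigma> f) = f"
  using q_nz by (simp_all add: dilate_dilate)

lemma to_acf_\<sigma>: "to_acf (\<sigma> f) = ac.\<sigma> (to_acf f)" and to_acf_\<tau>: "to_acf (\<tau> f) = ac.\<tau> (to_acf f)"
  using q_nz by (simp_all add: to_acf_dilate)

text \<open>Fixed functions are constants, by the first-order equation with \<open>a = 0\<close>, at least after passage to the algebraic closure.\<close>

lemma fixed_const:
  assumes "\<sigma> c = c"
  shows "\<exists>k. to_acf c = rconst k"
proof (rule ac.first_order_gap(2))
  show "to_acf c - ac.\<sigma> (to_acf c) = rconst 0"
    using assms by (simp flip: to_acf_\<sigma> add: rconst_simps)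
qed (rule symmetric_gap_intros)

lemma gap_fixed: "\<sigma> c = c \<Longrightarrow> gap c"
  using fixed_const unfolding gap_def by (metis symmetric_gap_intros(1))

lemma gap_s_fixed_combination:
  assumes "\<And>n. n \<in> S \<Longrightarrow> \<sigma> (c n) = c n"
  shows "gap (\<Sum>n\<in>S. c n * (s * u powi n))"
  unfolding gap_def to_acf_simps to_acf_koebe
  by (intro symmetric_gap_sum symmetric_gap_intros(4,6) symmetric_gap_koebe
      symmetric_gap_u_powi gap_fixed[unfolded gap_def] assms)

theorem first_order_gap:
  assumes "f - \<sigma> f = a" "gap a"
  shows "a = 0"
proof -
  have "to_acf f - ac.\<sigma> (to_acf f) = to_acf a"
    by (simp add: assms(1)[symmetric] to_acf_simps to_acf_\<sigma>)
  then have "to_acf a = 0" using assms(2) ac.first_order_gap(1) unfolding gap_def by blast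
  then show ?thesis by (simp add: to_acf_simps)
qed

theorem second_order_gap:
  assumes "\<sigma> f + \<tau> f - m * f = a" "gap a"
  shows "\<sigma> f = f"
proof -
  have "ac.\<sigma> (to_acf f) + ac.\<tau> (to_acf f) - ac.m * to_acf f = to_acf a"
    by (simp only: assms(1)[symmetric] to_acf_simps to_acf_\<sigma> to_acf_\<tau> to_acf_koebe)
  then obtain k where "to_acf f = rconst k"
    using ac.second_order_gap assms(2) unfolding gap_def by blast
  then have "to_acf (\<sigma> f) = to_acf f" using ac.q_nz by (simp add: to_acf_\<sigma> dilate_rconst)
  then show ?thesis by (simp add: to_acf_simps)
qed

theorem self_extension_gap:
  assumes "a - m * (g - \<tau> g) + \<tau> h - \<sigma> h = 0"
    and "\<sigma> g - \<tau> g - m * h + \<sigma> m * \<sigma> h = 0" and "gap a"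
  shows "a = 0" "h = 0" "\<sigma> g = g"
proof -
  have m: "to_acf m = ac.m" by (simp only: to_acf_simps to_acf_koebe)
  have "to_acf a - ac.m * (to_acf g - ac.\<tau> (to_acf g)) + ac.\<tau> (to_acf h) - ac.\<sigma> (to_acf h) = 0"
    using arg_cong[OF assms(1), of to_acf] by (simp only: to_acf_simps to_acf_\<sigma> to_acf_\<tau> to_acf_koebe)
  moreover have "ac.\<sigma> (to_acf g) - ac.\<tau> (to_acf g) - ac.m * to_acf h + ac.\<sigma> ac.m * ac.\<sigma> (to_acf h) = 0"
    using arg_cong[OF assms(2), of to_acf] unfolding m[symmetric] to_acf_\<sigma>[symmetric] to_acf_\<tau>[symmetric]
    by (simp only: to_acf_simps)
  ultimately have "to_acf a = 0" "to_acf h = 0" "ac.\<sigma> (to_acf g) = to_acf g"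
    using ac.self_extension_gap assms(3) unfolding gap_def by blast+
  then show "a = 0" "h = 0" "\<sigma> g = g" by (simp_all add: to_acf_simps flip: to_acf_\<sigma>)
qed

theorem riccati: "\<tau> b * (m - b) \<noteq> 1"
proof
  assume "\<tau> b * (m - b) = 1"
  from arg_cong[OF this, of to_acf] have "ac.\<tau> (to_acf b) * (ac.m - to_acf b) = 1"
    by (simp only: to_acf_simps to_acf_\<tau> to_acf_koebe)
  then show False using ac.riccati by blast
qed

theorem independent_u_powers:
  assumes "finite S" "(\<Sum>n\<in>S. c n * u powi n) = 0" "\<And>n. n \<in> S \<Longrightarrow> \<sigma> (c n) = c n" "n \<in> S"
  shows "c n = 0"
proof -
  have "\<forall>n\<in>S. \<exists>k. to_acf (c n) = rconst k"
    using fixed_const assms(3) by blast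
  then obtain k where k: "\<And>n. n \<in> S \<Longrightarrow> to_acf (c n) = rconst (k n)"
    by (auto simp: bchoice_iff)
  have "(\<Sum>n\<in>S. to_acf (c n) * (1 + koebe) powi n) = 0"
    using arg_cong[OF assms(2), of to_acf] by (simp only: to_acf_simps to_acf_koebe)
  then have "(\<Sum>n\<in>S. rconst (k n) * (1 + koebe) powi n) = 0" using k by simp
  then have "k n = 0" by (rule ac.independent_u_powers[OF assms(1) _ assms(4)])
  then have "to_acf (c n) = 0" using k[OF assms(4)] by (simp add: rconst_simps)
  then show ?thesis by (simp add: to_acf_simps)
qed

end

section \<open>Independence of paths of extensions between simple modules\<close>

definition left_multiples :: "'d::ring_1 set \<Rightarrow> 'd \<Rightarrow> 'd set" where
  "left_multiples R p = (\<lambda>\<chi>. \<chi> * p) ` R"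

text \<open>The elements \<open>pol t\<close> present the simple modules \<open>R / R (pol t)\<close>. The assumptions \<open>simple\<close>, \<open>endo\<close> and
  \<open>hom\<close> describe these modules and their homomorphisms: right multiplication by \<open>\<rho>\<close> is well defined from the module of
  \<open>t\<close> to that of \<open>t'\<close> iff \<open>pol t * \<rho>\<close> is a multiple of \<open>pol t'\<close>. In \<open>ext\<close>, the element
  \<open>inverse (pol t) * a * inverse (pol t')\<close> generates an extension of the two modules, which splits iff
  \<open>pol t * \<rho> + a\<close> is a multiple of \<open>pol t'\<close> for some \<open>\<rho>\<close>; no nontrivial combination of the admitted gaps \<open>a\<close>
  splits. The assumption \<open>ext_end\<close> is the same for a path that ends, with \<open>R\<close> in place of the second module.\<close>

locale ext_quiver =
  fixes R F :: "'d::division_ring set" and pol :: "'t \<Rightarrow> 'd" and ty :: "'l \<Rightarrow> 't" and coef :: "'l \<Rightarrow> 'd"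
    and ok :: "'l \<Rightarrow> 'l \<Rightarrow> bool" and okend :: "'l \<Rightarrow> bool"
  assumes R_0: "0 \<in> R" and R_1: "1 \<in> R" and R_add: "a \<in> R \<Longrightarrow> b \<in> R \<Longrightarrow> a + b \<in> R"
    and R_uminus: "a \<in> R \<Longrightarrow> - a \<in> R" and R_mult: "a \<in> R \<Longrightarrow> b \<in> R \<Longrightarrow> a * b \<in> R"
    and pol_R: "pol t \<in> R" and pol_nz: "pol t \<noteq> 0" and coef_R: "coef l \<in> R"
    and F_R: "F \<subseteq> R" and F_0: "0 \<in> F" and F_central: "e \<in> F \<Longrightarrow> a \<in> R \<Longrightarrow> e * a = a * e"
    and simple: "\<rho> \<in> R \<Longrightarrow> \<rho> \<notin> left_multiples R (pol t) \<Longrightarrow>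
      \<exists>\<kappa>\<in>R. \<kappa> * \<rho> - 1 \<in> left_multiples R (pol t)"
    and endo: "\<rho> \<in> R \<Longrightarrow> pol t * \<rho> \<in> left_multiples R (pol t) \<Longrightarrow>
      \<exists>k\<in>F. \<rho> - k \<in> left_multiples R (pol t)"
    and hom: "t \<noteq> t' \<Longrightarrow> \<rho> \<in> R \<Longrightarrow> pol t * \<rho> \<in> left_multiples R (pol t') \<Longrightarrow>
      \<rho> \<in> left_multiples R (pol t')"
    and ext: "finite S \<Longrightarrow> (\<And>l. l \<in> S \<Longrightarrow> ty l = t \<and> ok l l' \<and> c l \<in> F) \<Longrightarrow> \<rho> \<in> R \<Longrightarrow>
      pol t * \<rho> + (\<Sum>l\<in>S. c l * coef l) \<in> left_multiples R (pol (ty l')) \<Longrightarrow> l \<in> S \<Longrightarrow> c l = 0"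
    and ext_end: "finite S \<Longrightarrow> (\<And>l. l \<in> S \<Longrightarrow> ty l = t \<and> okend l \<and> c l \<in> F) \<Longrightarrow> \<rho> \<in> R \<Longrightarrow>
      pol t * \<rho> + (\<Sum>l\<in>S. c l * coef l) = 0 \<Longrightarrow> l \<in> S \<Longrightarrow> c l = 0"
begin

fun val :: "'l list \<Rightarrow> 'd" where
  "val [] = 1"
| "val (l # w) = inverse (pol (ty l)) * coef l * val w"

fun path :: "'l list \<Rightarrow> bool" where
  "path [] \<longleftrightarrow> True"
| "path [l] \<longleftrightarrow> okend l"
| "path (l # l' # w) \<longleftrightarrow> ok l l' \<and> path (l' # w)"

definition negligible :: "'d \<Rightarrow> 'l list \<Rightarrow> bool" where
  "negligible \<rho> w \<longleftrightarrow> (case w of [] \<Rightarrow> \<rho> = 0 | l # _ \<Rightarrow> \<rho> \<in> left_multiples R (pol (ty l)))"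

lemma path_Cons: "path (l # w) \<Longrightarrow> path w"
  by (cases w) auto

lemma R_sum: "(\<And>i. i \<in> S \<Longrightarrow> f i \<in> R) \<Longrightarrow> sum f S \<in> R"
  by (induction S rule: infinite_finite_induct) (auto intro: R_0 R_add)

lemma left_multiples_mult: "a \<in> R \<Longrightarrow> \<rho> \<in> left_multiples R p \<Longrightarrow> a * \<rho> \<in> left_multiples R p"
  by (auto simp: left_multiples_def R_mult simp flip: mult.assoc intro!: imageI)

lemma left_multiples_add:
  "\<rho> \<in> left_multiples R p \<Longrightarrow> \<rho>' \<in> left_multiples R p \<Longrightarrow> \<rho> + \<rho>' \<in> left_multiples R p"
  unfolding left_multiples_def by (auto simp flip: distrib_right intro!: imageI R_add)

lemma left_multiples_uminus: "\<rho> \<in> left_multiples R p \<Longrightarrow> - \<rho> \<in> left_multiples R p"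
  unfolding left_multiples_def by (auto simp flip: mult_minus_left intro!: imageI R_uminus)

lemma left_multiples_diff:
  "\<rho> \<in> left_multiples R p \<Longrightarrow> \<rho>' \<in> left_multiples R p \<Longrightarrow> \<rho> - \<rho>' \<in> left_multiples R p"
  using left_multiples_add[of \<rho> p "- \<rho>'"] left_multiples_uminus[of \<rho>' p] by simp

text \<open>Consider the direct sum of the modules \<open>R / R (pol t)\<close> over the paths of maximal length, \<open>t\<close> being the type of
  the first pole. The leading coefficients of relations form a submodule. If it is not zero, it contains a
  copy of a simple module, on which all coordinates are homomorphisms between simple modules, and so it contains an element with scalar
  coordinates. Cancelling the first pole of the corresponding relation turns these scalars into the coefficients of a split
  combination of gaps. The induction on the number of bad coefficients stands for the choice of a simple
  submodule.\<close>

theorem leading_coefficients_negligible: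
  assumes "finite W" "\<And>w. w \<in> W \<Longrightarrow> path w \<and> length w \<le> r \<and> \<rho> w \<in> R"
    and "(\<Sum>w\<in>W. \<rho> w * val w) = 0"
    and "w \<in> W" "length w = r"
  shows "negligible (\<rho> w) w"
  using assms
proof (induction r arbitrary: W \<rho> w)
  case 0
  then have "W = {[]}" by auto
  with 0 show ?case by (simp add: negligible_def)
next
  case (Suc r)
  note IH = Suc.IH
  define bad where "bad W \<rho> = {w \<in> W. length w = Suc r \<and> \<not> negligible (\<rho> w) w}" for W and \<rho> :: "'l list \<Rightarrow> 'd"
  have "bad W \<rho> = {}" if "finite W" "\<And>w. w \<in> W \<Longrightarrow> path w \<and> length w \<le> Suc r \<and> \<rho> w \<in> R"
    "(\<Sum>w\<in>W. \<rho> w * val w) = 0" for W \<rho>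
    using that
  proof (induction "card (bad W \<rho>)" arbitrary: \<rho> rule: less_induct)
    case less
    show ?case
    proof (rule ccontr)
      assume "bad W \<rho> \<noteq> {}"
      then obtain w0 where w0: "w0 \<in> W" "length w0 = Suc r" "\<not> negligible (\<rho> w0) w0"
        by (auto simp: bad_def)
      obtain l0 w0' where l0: "w0 = l0 # w0'" using w0(2) by (cases w0) auto
      define t where "t = ty l0"
      let ?P = "left_multiples R (pol t)"
      have \<rho>R: "\<And>w. w \<in> W \<Longrightarrow> \<rho> w \<in> R" using less.prems(2) by blast
      have "\<rho> w0 \<notin> ?P" using w0(3) by (simp add: negligible_def l0 t_def)
      then obtain \<kappa> where \<kappa>: "\<kappa> \<in> R" "\<kappa> * \<rho> w0 - 1 \<in> ?P"
        using simple[OF \<rho>R[OF w0(1)]] by blast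
      have one: "1 \<notin> ?P"
        using left_multiples_mult[of "\<rho> w0" 1 "pol t"] \<rho>R[OF w0(1)] \<open>\<rho> w0 \<notin> ?P\<close> by auto
      \<comment> \<open>Multiplication by \<open>pol t * \<kappa>\<close> makes the coefficient of \<open>w0\<close> a multiple of \<open>pol t\<close>, so there are
        fewer bad coefficients.\<close>
      define \<rho>' where "\<rho>' w = pol t * (\<kappa> * \<rho> w)" for w
      have "(\<Sum>w\<in>W. \<rho>' w * val w) = pol t * \<kappa> * (\<Sum>w\<in>W. \<rho> w * val w)"
        unfolding sum_distrib_left \<rho>'_def by (simp add: mult.assoc)
      then have rel': "(\<Sum>w\<in>W. \<rho>' w * val w) = 0" using less.prems(3) by simp
      have neg': "negligible (\<rho>' w) w" if "w \<in> W" "length w = Suc r" "negligible (\<rho> w) w" for w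
        using that \<kappa>(1) by (cases w) (auto simp: negligible_def \<rho>'_def intro!: left_multiples_mult pol_R)
      have "\<rho>' w0 \<in> ?P"
      proof -
        have "pol t \<in> ?P" unfolding left_multiples_def using R_1 by force
        then have "pol t * (\<kappa> * \<rho> w0 - 1) + pol t \<in> ?P"
          by (intro left_multiples_add left_multiples_mult pol_R \<kappa>)
        then show ?thesis by (simp add: \<rho>'_def right_diff_distrib)
      qed
      then have "negligible (\<rho>' w0) w0" by (simp add: negligible_def l0 t_def)
      then have "bad W \<rho>' \<subset> bad W \<rho>"
        using neg' w0 unfolding bad_def by blast
      moreover have "finite (bad W \<rho>)" using less.prems(1) by (simp add: bad_def)
      ultimately have "card (bad W \<rho>') < card (bad W \<rho>)" by (rule psubset_card_mono[rotated])
      then have "bad W \<rho>' = {}"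
        using less.prems rel' \<kappa>(1) by (intro less.hyps) (auto simp: \<rho>'_def intro!: R_mult pol_R)
      then have all: "negligible (\<rho>' w) w" if "w \<in> W" "length w = Suc r" for w
        using that by (auto simp: bad_def)
      have "\<exists>k\<in>F. \<exists>\<chi>\<in>R. (ty (hd w) \<noteq> t \<longrightarrow> k = 0) \<and> \<kappa> * \<rho> w = k + \<chi> * pol (ty (hd w))"
        if w: "w \<in> W" "length w = Suc r" for w
      proof -
        obtain l w' where lw: "w = l # w'" using w(2) by (cases w) auto
        have pr: "pol t * (\<kappa> * \<rho> w) \<in> left_multiples R (pol (ty l))"
          using all[OF w] by (simp add: negligible_def lw \<rho>'_def)
        have \<kappa>\<rho>: "\<kappa> * \<rho> w \<in> R" by (intro R_mult \<kappa> \<rho>R w)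
        show ?thesis
        proof (cases "ty l = t")
          case True
          then obtain k where "k \<in> F" "\<kappa> * \<rho> w - k \<in> ?P"
            using endo[OF \<kappa>\<rho>] pr by auto
          then obtain \<chi> where "\<chi> \<in> R" "\<kappa> * \<rho> w - k = \<chi> * pol t" by (auto simp: left_multiples_def)
          then show ?thesis using \<open>k \<in> F\<close> True by (auto simp: lw algebra_simps)
        next
          case False
          then have "\<kappa> * \<rho> w \<in> left_multiples R (pol (ty l))"
            using hom[OF _ \<kappa>\<rho> pr] by auto
          then show ?thesis using F_0 False by (auto simp: lw left_multiples_def)
        qed
      qed
      then obtain k \<chi> where k: "\<And>w. w \<in> W \<Longrightarrow> length w = Suc r \<Longrightarrow> k w \<in> F \<and> \<chi> w \<in> R \<and>
          (ty (hd w) \<noteq> t \<longrightarrow> k w = 0) \<and> \<kappa> * \<rho> w = k w + \<chi> w * pol (ty (hd w))"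
        by metis
      define Top Low where "Top = {w \<in> W. length w = Suc r}" and "Low = {w \<in> W. length w \<le> r}"
      have WTL: "W = Top \<union> Low" "Top \<inter> Low = {}" "finite Top" "finite Low"
      proof -
        have "length w = Suc r \<or> length w \<le> r" if "w \<in> W" for w
          using less.prems(2)[OF that] by auto
        then show "W = Top \<union> Low" by (auto simp: Top_def Low_def)
      qed (use less.prems(1) in \<open>auto simp: Top_def Low_def\<close>)
      \<comment> \<open>Multiplying the relation once more by \<open>pol t\<close> cancels the first pole of the paths of maximal length.
        The coefficients of equal tails are collected.\<close>
      define fibre where "fibre w' = {w \<in> Top. tl w = w'}" for w'
      define W' where "W' = tl ` Top \<union> Low"
      define Xi where "Xi w' = (\<Sum>w\<in>fibre w'. \<chi> w * coef (hd w)) + (if w' \<in> Low then \<kappa> * \<rho> w' else 0)" for w'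
      define \<rho>'' where "\<rho>'' w' = pol t * Xi w' + (\<Sum>w\<in>fibre w'. k w * coef (hd w))" for w'
      have fin: "finite W'" "finite (fibre w')" for w' using WTL by (auto simp: W'_def fibre_def)
      have XiR: "Xi w' \<in> R" for w'
      proof -
        have "(if w' \<in> Low then \<kappa> * \<rho> w' else 0) \<in> R"
          using \<kappa>(1) \<rho>R by (auto simp: Low_def intro: R_mult R_0)
        moreover have "(\<Sum>w\<in>fibre w'. \<chi> w * coef (hd w)) \<in> R"
          using k by (intro R_sum R_mult coef_R) (auto simp: fibre_def Top_def)
        ultimately show ?thesis unfolding Xi_def by (rule R_add[rotated])
      qed
      have step: "pol t * (\<kappa> * \<rho> w * val w) = (pol t * (\<chi> w * coef (hd w)) + k w * coef (hd w)) * val (tl w)"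
        if "w \<in> Top" for w
      proof -
        obtain l w' where lw: "w = l # w'" using \<open>w \<in> Top\<close> by (cases w) (auto simp: Top_def)
        have kw: "k w \<in> F" "\<kappa> * \<rho> w = k w + \<chi> w * pol (ty l)" "ty l \<noteq> t \<longrightarrow> k w = 0"
          using k[of w] that by (auto simp: Top_def lw)
        have "pol t * (k w * val w) = k w * coef l * val w'"
        proof (cases "ty l = t")
          case True
          have "pol t * (k w * val w) = k w * pol t * (inverse (pol t) * coef l * val w')"
            using F_central[OF kw(1) pol_R[of t]] by (simp add: lw True mult.assoc flip: mult.assoc[of "pol t" "k w"])
          also have "\<dots> = k w * (pol t * inverse (pol t)) * coef l * val w'" by (simp only: mult.assoc)
          finally show ?thesis using pol_nz by simp
        qed (use kw(3) in simp)
        moreover have "\<chi> w * pol (ty l) * val w = \<chi> w * coef l * val w'"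
        proof -
          have "\<chi> w * pol (ty l) * val w = \<chi> w * (pol (ty l) * inverse (pol (ty l))) * coef l * val w'"
            by (simp only: lw val.simps mult.assoc)
          then show ?thesis using pol_nz by simp
        qed
        moreover have "pol t * (\<kappa> * \<rho> w * val w) = pol t * (k w * val w) + pol t * (\<chi> w * pol (ty l) * val w)"
          by (simp only: kw(2) distrib_left distrib_right)
        ultimately show ?thesis
          by (simp only: lw list.sel distrib_left distrib_right mult.assoc add.commute)
      qed
      have "(\<Sum>w'\<in>W'. \<rho>'' w' * val w') =
          (\<Sum>w'\<in>W'. (\<Sum>w\<in>fibre w'. (pol t * (\<chi> w * coef (hd w)) + k w * coef (hd w)) * val (tl w))) +
          (\<Sum>w'\<in>W'. if w' \<in> Low then pol t * (\<kappa> * \<rho> w' * val w') else 0)"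
      proof -
        have "\<rho>'' w' * val w' = (\<Sum>w\<in>fibre w'. (pol t * (\<chi> w * coef (hd w)) + k w * coef (hd w)) * val (tl w))
            + (if w' \<in> Low then pol t * (\<kappa> * \<rho> w' * val w') else 0)" for w'
        proof -
          have "(\<Sum>w\<in>fibre w'. (pol t * (\<chi> w * coef (hd w)) + k w * coef (hd w)) * val (tl w)) =
              (\<Sum>w\<in>fibre w'. (pol t * (\<chi> w * coef (hd w)) + k w * coef (hd w)) * val w')"
            by (intro sum.cong) (auto simp: fibre_def)
          also have "\<dots> = (pol t * (\<Sum>w\<in>fibre w'. \<chi> w * coef (hd w)) + (\<Sum>w\<in>fibre w'. k w * coef (hd w))) * val w'"
            by (simp add: sum_distrib_right sum_distrib_left sum.distrib distrib_right)
          finally show ?thesis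
            by (simp add: \<rho>''_def Xi_def distrib_left distrib_right mult.assoc)
        qed
        then show ?thesis by (simp add: sum.distrib)
      qed
      also have "(\<Sum>w'\<in>W'. (\<Sum>w\<in>fibre w'. (pol t * (\<chi> w * coef (hd w)) + k w * coef (hd w)) * val (tl w))) =
          (\<Sum>w\<in>Top. (pol t * (\<chi> w * coef (hd w)) + k w * coef (hd w)) * val (tl w))"
        unfolding fibre_def using fin(1) WTL(3) by (intro sum.group) (auto simp: W'_def)
      also have "\<dots> = (\<Sum>w\<in>Top. pol t * (\<kappa> * \<rho> w * val w))"
        by (intro sum.cong) (simp_all only: step)
      also have "(\<Sum>w'\<in>W'. if w' \<in> Low then pol t * (\<kappa> * \<rho> w' * val w') else 0) =
          (\<Sum>w'\<in>Low. pol t * (\<kappa> * \<rho> w' * val w'))"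
        using fin(1) by (intro sum.mono_neutral_cong_right) (auto simp: W'_def)
      also have "(\<Sum>w\<in>Top. pol t * (\<kappa> * \<rho> w * val w)) + (\<Sum>w'\<in>Low. pol t * (\<kappa> * \<rho> w' * val w')) =
          (\<Sum>w\<in>W. pol t * (\<kappa> * \<rho> w * val w))"
        using WTL by (simp add: sum.union_disjoint)
      also have "\<dots> = pol t * \<kappa> * (\<Sum>w\<in>W. \<rho> w * val w)"
        by (simp add: sum_distrib_left mult.assoc)
      finally have rel'': "(\<Sum>w'\<in>W'. \<rho>'' w' * val w') = 0" using less.prems(3) by simp
      have path': "path w' \<and> length w' \<le> r \<and> \<rho>'' w' \<in> R" if "w' \<in> W'" for w'
      proof -
        have "path (tl w)" "length (tl w) \<le> r" if "w \<in> Top" for w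
          using that less.prems(2) by (cases w; auto simp: Top_def dest: path_Cons)+
        moreover have "\<rho>'' w' \<in> R"
          unfolding \<rho>''_def using k F_R
          by (intro R_add R_mult XiR pol_R R_sum coef_R) (auto simp: fibre_def Top_def)
        ultimately show ?thesis using that less.prems(2) by (auto simp: W'_def Low_def)
      qed
      have w0Top: "w0 \<in> Top" using w0 by (simp add: Top_def)
      have "w0' \<in> W'" "length w0' = r" using w0Top w0(2) by (force simp: W'_def l0)+
      then have neg'': "negligible (\<rho>'' w0') w0'"
        using IH[OF fin(1) path' rel''] by blast
      define S where "S = {l. l # w0' \<in> Top \<and> ty l = t}"
      have finS: "finite S"
        using finite_vimageI[OF WTL(3), of "\<lambda>l. l # w0'"] unfolding S_def
        by (rule finite_subset[rotated]) (auto simp: inj_def)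
      have sumS: "(\<Sum>w\<in>fibre w0'. k w * coef (hd w)) = (\<Sum>l\<in>S. k (l # w0') * coef l)"
      proof -
        have "(\<Sum>w\<in>fibre w0'. k w * coef (hd w)) = (\<Sum>w\<in>(\<lambda>l. l # w0') ` S. k w * coef (hd w))"
        proof (rule sum.mono_neutral_right)
          show "\<forall>w\<in>fibre w0' - (\<lambda>l. l # w0') ` S. k w * coef (hd w) = 0"
          proof
            fix w assume w: "w \<in> fibre w0' - (\<lambda>l. l # w0') ` S"
            then obtain l where l: "w = l # w0'" by (cases w) (auto simp: fibre_def Top_def)
            then have "ty l \<noteq> t" using w by (auto simp: S_def fibre_def)
            then show "k w * coef (hd w) = 0" using k[of w] w l by (auto simp: fibre_def Top_def)
          qed
        qed (auto simp: fin, auto simp: S_def fibre_def)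
        also have "\<dots> = (\<Sum>l\<in>S. k (l # w0') * coef l)"
          by (subst sum.reindex) (auto simp: inj_on_def)
        finally show ?thesis .
      qed
      have l0S: "l0 \<in> S" using w0Top by (simp add: S_def l0 t_def)
      have kl: "k (l # w0') \<in> F \<and> ty l = t \<and> path (l # w0')" if "l \<in> S" for l
        using that k[of "l # w0'"] less.prems(2)[of "l # w0'"] by (auto simp: S_def Top_def)
      have "k w0 = 0"
      proof (cases w0')
        case Nil
        have "pol t * Xi w0' + (\<Sum>l\<in>S. k (l # w0') * coef l) = 0"
          using neg'' by (simp add: negligible_def Nil \<rho>''_def sumS[unfolded Nil])
        from ext_end[OF finS _ XiR this l0S] kl show ?thesis by (auto simp: l0 Nil)
      next
        case (Cons l' v)
        have "pol t * Xi w0' + (\<Sum>l\<in>S. k (l # w0') * coef l) \<in> left_multiples R (pol (ty l'))"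
          using neg'' by (simp add: negligible_def \<rho>''_def sumS) (simp add: Cons)
        from ext[OF finS _ XiR this l0S] kl show ?thesis by (auto simp: l0 Cons)
      qed
      then have "\<kappa> * \<rho> w0 \<in> ?P"
        using k[of w0] w0 by (auto simp: l0 t_def left_multiples_def)
      from left_multiples_diff[OF this \<kappa>(2)] have "1 \<in> ?P" by simp
      then show False using one by simp
    qed
  qed
  from this[OF Suc.prems(1,2,3)] Suc.prems(4,5) show ?case
    by (auto simp: bad_def)
qed

text \<open>Coefficients that are reduced, in the sense that a nonzero one is never a multiple of the first operator of
  its path, can be recovered from the leading ones.\<close>

corollary paths_independent:
  assumes "finite W" "\<And>w. w \<in> W \<Longrightarrow> path w \<and> \<rho> w \<in> R"
    and "(\<Sum>w\<in>W. \<rho> w * val w) = 0"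
    and reduced: "\<And>l w. l # w \<in> W \<Longrightarrow> \<rho> (l # w) \<in> left_multiples R (pol (ty l)) \<Longrightarrow> \<rho> (l # w) = 0"
    and "w \<in> W"
  shows "\<rho> w = 0"
proof (rule ccontr)
  assume "\<rho> w \<noteq> 0"
  define V where "V = {w \<in> W. \<rho> w \<noteq> 0}"
  have V: "finite V" "V \<noteq> {}" using assms \<open>\<rho> w \<noteq> 0\<close> by (auto simp: V_def)
  define r where "r = Max (length ` V)"
  have "r \<in> length ` V" unfolding r_def using V by (intro Max_in) auto
  then obtain v where v: "v \<in> V" "length v = r" by auto
  have "(\<Sum>w\<in>V. \<rho> w * val w) = (\<Sum>w\<in>W. \<rho> w * val w)"
    using assms(1) by (intro sum.mono_neutral_left) (auto simp: V_def)
  then have "(\<Sum>w\<in>V. \<rho> w * val w) = 0" using assms(3) by simp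
  moreover have "path w \<and> length w \<le> r \<and> \<rho> w \<in> R" if "w \<in> V" for w
    using that assms(2) V by (auto simp: V_def r_def)
  ultimately have "negligible (\<rho> v) v"
    using leading_coefficients_negligible[OF V(1)] v by blast
  then have "\<rho> v = 0"
    using reduced v(1) by (cases v) (auto simp: negligible_def V_def)
  then show False using v(1) by (simp add: V_def)
qed

end

section \<open>Skew Laurent polynomials in a division ring\<close>

text \<open>A skew field with the elements of a quantum torus: \<open>emb\<close> embeds the field \<open>K(y)\<close>, on which conjugation by \<open>x\<close> is
  the dilation by \<open>q\<close>.\<close>

locale quantum_extension = generic_parameter q
  for q :: "'c::field" +
  fixes emb :: "'c poly fract \<Rightarrow> 'd::division_ring" and x :: 'd
  assumes emb_hom: "unital_ring_hom emb" and x_nz: "x \<noteq> 0" and x_emb: "x * emb f = emb (\<sigma> f) * x"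
begin

lemmas emb_simps = unital_ring_homD[OF emb_hom] unital_ring_hom_field[OF emb_hom]

lemma inverse_x_emb: "inverse x * emb f = emb (\<tau> f) * inverse x"
proof -
  have "inverse x * emb f = inverse x * (emb f * x) * inverse x"
    using x_nz by (simp add: mult.assoc)
  also have "emb f * x = x * emb (\<tau> f)"
    by (simp add: x_emb)
  also have "inverse x * (x * emb (\<tau> f)) * inverse x = emb (\<tau> f) * inverse x"
    using x_nz by (simp flip: mult.assoc)
  finally show ?thesis .
qed

lemma x_powi_emb: "x powi i * emb f = emb (dilate (q powi i) f) * x powi i"
proof -
  have nat: "x ^ n * emb f = emb (dilate (q ^ n) f) * x ^ n" for n f
  proof (induction n arbitrary: f)
    case (Suc n)
    have "x ^ Suc n * emb f = x ^ n * (x * emb f)" by (simp add: mult.assoc power_Suc2 del: power_Suc)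
    also have "\<dots> = x ^ n * emb (\<sigma> f) * x" by (simp add: x_emb mult.assoc)
    also have "\<dots> = emb (dilate (q ^ n) (\<sigma> f)) * (x ^ n * x)" by (simp add: Suc mult.assoc)
    finally show ?case using q_nz by (simp add: dilate_dilate power_Suc2 mult.commute del: power_Suc)
  qed simp
  have neg: "inverse x ^ n * emb f = emb (dilate (inverse q ^ n) f) * inverse x ^ n" for n f
  proof (induction n arbitrary: f)
    case (Suc n)
    have "inverse x ^ Suc n * emb f = inverse x ^ n * (inverse x * emb f)"
      by (simp add: mult.assoc power_Suc2 del: power_Suc)
    also have "\<dots> = inverse x ^ n * emb (\<tau> f) * inverse x" by (simp add: inverse_x_emb mult.assoc)
    also have "\<dots> = emb (dilate (inverse q ^ n) (\<tau> f)) * (inverse x ^ n * inverse x)" by (simp add: Suc mult.assoc)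
    finally show ?case using q_nz by (simp add: dilate_dilate power_Suc2 mult.commute del: power_Suc)
  qed simp
  show ?thesis using nat[of "nat i" f] neg[of "nat (- i)" f] by (simp add: power_int_def)
qed

text \<open>The powers of \<open>x\<close> are eigenvectors for conjugation by \<open>y\<close>, with the eigenvalues \<open>q\<^sup>i\<close>.\<close>

lemma x_powers_independent:
  assumes "finite S" "(\<Sum>i\<in>S. emb (c i) * x powi i) = 0" "i \<in> S"
  shows "c i = 0"
proof (rule dedekind_independence[OF emb_hom, of "\<lambda>i. x powi i" "\<lambda>i. rconst (q powi i)"
      "\<lambda>a. a * emb rvar" "\<lambda>a. emb rvar * a", OF _ _ _ _ _ _ assms])
  show "inj (\<lambda>i. rconst (q powi i))"
    using powi_inj_if_infinite_order[OF q_nz q_free] by (intro injI) (simp only: rconst_simps(12))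
  show "emb a * x powi i * emb rvar = emb rvar * (emb (a * rconst (q powi i)) * x powi i)" for a i
  proof -
    have "emb a * x powi i * emb rvar = emb (a * (rconst (q powi i) * rvar)) * x powi i"
      using q_nz by (simp add: mult.assoc x_powi_emb dilate_rvar emb_simps(3))
    also have "a * (rconst (q powi i) * rvar) = rvar * (a * rconst (q powi i))"
      by (simp only: mult_ac)
    finally show ?thesis by (simp only: emb_simps(3) mult.assoc)
  qed
qed (use x_nz in \<open>simp_all add: emb_simps distrib_left distrib_right\<close>)

text \<open>The coefficients of a skew Laurent polynomial. Zeros outside a finite set are part of the data, so that the
  effect of a multiplication is a formula valid for all indices.\<close>

definition has_coeffs :: "'d \<Rightarrow> (int \<Rightarrow> 'c poly fract) \<Rightarrow> bool" where
  "has_coeffs \<rho> c \<longleftrightarrow> finite {i. c i \<noteq> 0} \<and> \<rho> = (\<Sum>i | c i \<noteq> 0. emb (c i) * x powi i)"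

definition R :: "'d set" where
  "R = {\<rho>. \<exists>c. has_coeffs \<rho> c}"

lemma has_coeffsI:
  assumes "finite S" "{i. c i \<noteq> 0} \<subseteq> S" "\<rho> = (\<Sum>i\<in>S. emb (c i) * x powi i)"
  shows "has_coeffs \<rho> c"
  unfolding has_coeffs_def assms(3)
  by (intro conjI finite_subset[OF assms(2,1)] sum.mono_neutral_right) (use assms in \<open>auto simp: emb_simps\<close>)

lemma has_coeffs_eq:
  assumes "has_coeffs \<rho> c" "finite S" "{i. c i \<noteq> 0} \<subseteq> S"
  shows "\<rho> = (\<Sum>i\<in>S. emb (c i) * x powi i)"
  using assms unfolding has_coeffs_def
  by (auto intro!: sum.mono_neutral_left simp: emb_simps)

lemma has_coeffs_finite: "has_coeffs \<rho> c \<Longrightarrow> finite {i. c i \<noteq> 0}"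
  by (simp add: has_coeffs_def)

lemma has_coeffs_add:
  assumes "has_coeffs \<rho> c" "has_coeffs \<rho>' c'"
  shows "has_coeffs (\<rho> + \<rho>') (\<lambda>i. c i + c' i)"
proof -
  let ?S = "{i. c i \<noteq> 0} \<union> {i. c' i \<noteq> 0}"
  have fin: "finite ?S" using assms by (auto simp: has_coeffs_def)
  show ?thesis
    by (rule has_coeffsI[OF fin])
      (auto simp: has_coeffs_eq[OF assms(1) fin] has_coeffs_eq[OF assms(2) fin] emb_simps(2) distrib_right sum.distrib)
qed

lemma has_coeffs_emb_left:
  assumes "has_coeffs \<rho> c"
  shows "has_coeffs (emb f * \<rho>) (\<lambda>i. f * c i)"
  by (rule has_coeffsI[OF has_coeffs_finite[OF assms]])
    (auto simp: has_coeffs_def[of \<rho>, THEN iffD1, OF assms] sum_distrib_left emb_simps(3) mult.assoc)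

lemma has_coeffs_uminus: "has_coeffs \<rho> c \<Longrightarrow> has_coeffs (- \<rho>) (\<lambda>i. - c i)"
  using has_coeffs_emb_left[of \<rho> c "-1"] by (simp add: emb_simps)

lemma has_coeffs_diff: "has_coeffs \<rho> c \<Longrightarrow> has_coeffs \<rho>' c' \<Longrightarrow> has_coeffs (\<rho> - \<rho>') (\<lambda>i. c i - c' i)"
  using has_coeffs_add[OF _ has_coeffs_uminus, of \<rho> c \<rho>' c'] by simp

lemma has_coeffs_emb: "has_coeffs (emb f) (\<lambda>i. if i = 0 then f else 0)"
  by (rule has_coeffsI[of "{0}"]) auto

lemma has_coeffs_x_right:
  assumes "has_coeffs \<rho> c"
  shows "has_coeffs (\<rho> * x powi k) (\<lambda>i. c (i - k))"
proof (rule has_coeffsI[of "(\<lambda>i. i + k) ` {i. c i \<noteq> 0}"])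
  show "{i. c (i - k) \<noteq> 0} \<subseteq> (\<lambda>i. i + k) ` {i. c i \<noteq> 0}" by force
  have "\<rho> * x powi k = (\<Sum>i | c i \<noteq> 0. emb (c i) * x powi (i + k))"
    using assms x_nz by (simp add: has_coeffs_def sum_distrib_right power_int_add mult.assoc)
  then show "\<rho> * x powi k = (\<Sum>i\<in>(\<lambda>i. i + k) ` {i. c i \<noteq> 0}. emb (c (i - k)) * x powi i)"
    by (subst sum.reindex) (auto simp: inj_on_def)
qed (use has_coeffs_finite[OF assms] in simp)

lemma has_coeffs_x_left:
  assumes "has_coeffs \<rho> c"
  shows "has_coeffs (x powi k * \<rho>) (\<lambda>i. dilate (q powi k) (c (i - k)))"
proof (rule has_coeffsI[of "(\<lambda>i. i + k) ` {i. c i \<noteq> 0}"])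
  have d0: "dilate (q powi k) 0 = 0"
    using q_nz by (simp add: unital_ring_homD unital_ring_hom_dilate)
  show "{i. dilate (q powi k) (c (i - k)) \<noteq> 0} \<subseteq> (\<lambda>i. i + k) ` {i. c i \<noteq> 0}"
  proof
    fix i assume "i \<in> {i. dilate (q powi k) (c (i - k)) \<noteq> 0}"
    then have "c (i - k) \<noteq> 0" using d0 by auto
    then show "i \<in> (\<lambda>i. i + k) ` {i. c i \<noteq> 0}" by force
  qed
  have "x powi k * \<rho> = (\<Sum>i | c i \<noteq> 0. x powi k * emb (c i) * x powi i)"
    using assms by (simp add: has_coeffs_def sum_distrib_left mult.assoc)
  also have "\<dots> = (\<Sum>i | c i \<noteq> 0. emb (dilate (q powi k) (c i)) * x powi (i + k))"
    using x_nz by (simp add: x_powi_emb mult.assoc power_int_add add.commute[of _ k])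
  finally show "x powi k * \<rho> = (\<Sum>i\<in>(\<lambda>i. i + k) ` {i. c i \<noteq> 0}. emb (dilate (q powi k) (c (i - k))) * x powi i)"
    by (subst sum.reindex) (auto simp: inj_on_def)
qed (use has_coeffs_finite[OF assms] in simp)

lemma has_coeffs_emb_right:
  assumes "has_coeffs \<rho> c"
  shows "has_coeffs (\<rho> * emb f) (\<lambda>i. c i * dilate (q powi i) f)"
proof (rule has_coeffsI[OF has_coeffs_finite[OF assms]])
  have "\<rho> * emb f = (\<Sum>i | c i \<noteq> 0. emb (c i) * (x powi i * emb f))"
    using assms by (simp add: has_coeffs_def sum_distrib_right mult.assoc)
  then show "\<rho> * emb f = (\<Sum>i | c i \<noteq> 0. emb (c i * dilate (q powi i) f) * x powi i)"
    by (simp add: x_powi_emb emb_simps(3) mult.assoc)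
qed auto

lemma has_coeffs_unique:
  assumes "has_coeffs \<rho> c" "has_coeffs \<rho> c'"
  shows "c = c'"
proof
  fix i
  have d: "has_coeffs 0 (\<lambda>i. c i - c' i)" using has_coeffs_diff[OF assms] by simp
  then have "(\<Sum>j | c j - c' j \<noteq> 0. emb (c j - c' j) * x powi j) = 0" by (simp add: has_coeffs_def)
  from x_powers_independent[OF has_coeffs_finite[OF d] this, of i] show "c i = c' i" by auto
qed

lemma R_add: "\<rho> \<in> R \<Longrightarrow> \<rho>' \<in> R \<Longrightarrow> \<rho> + \<rho>' \<in> R"
  and R_uminus: "\<rho> \<in> R \<Longrightarrow> - \<rho> \<in> R"
  and R_emb: "emb f \<in> R"
  and R_emb_left: "\<rho> \<in> R \<Longrightarrow> emb f * \<rho> \<in> R"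
  and R_x_left: "\<rho> \<in> R \<Longrightarrow> x powi k * \<rho> \<in> R"
  unfolding R_def
  by (blast intro: has_coeffs_add has_coeffs_uminus has_coeffs_emb has_coeffs_emb_left has_coeffs_x_left)+

lemma R_0: "0 \<in> R" and R_1: "1 \<in> R" and R_x: "x \<in> R" and R_inverse_x: "inverse x \<in> R"
  using R_emb[of 0] R_emb[of 1] R_x_left[of 1 1] R_x_left[of 1 "-1"]
  by (simp_all add: emb_simps power_int_minus)

text \<open>Stability under the generators suffices; the set \<open>N\<close> is typically defined by the existence of a remainder.\<close>

lemma R_induct:
  assumes "\<rho> \<in> R" and add: "\<And>a b. a \<in> N \<Longrightarrow> b \<in> N \<Longrightarrow> a + b \<in> N"
    and mult: "\<And>f a. a \<in> N \<Longrightarrow> emb f * a \<in> N"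
    and x: "\<And>a. a \<in> N \<Longrightarrow> x * a \<in> N" and inverse_x: "\<And>a. a \<in> N \<Longrightarrow> inverse x * a \<in> N"
    and "n \<in> N"
  shows "\<rho> * n \<in> N"
proof -
  obtain c where c: "has_coeffs \<rho> c" using assms(1) by (auto simp: R_def)
  have zero: "0 \<in> N" using mult[OF \<open>n \<in> N\<close>, of 0] by (simp add: emb_simps)
  have "x ^ k * n \<in> N" "inverse x ^ k * n \<in> N" for k
    by (induction k) (simp_all add: \<open>n \<in> N\<close> x inverse_x mult.assoc)
  then have pow: "x powi i * n \<in> N" for i by (simp add: power_int_def)
  have "(\<Sum>i\<in>S. emb (c i) * (x powi i * n)) \<in> N" for S
    by (induction S rule: infinite_finite_induct) (simp_all add: zero add mult pow)
  then show ?thesis using c by (simp add: has_coeffs_def sum_distrib_right mult.assoc)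
qed

lemma R_mult: "\<rho> \<in> R \<Longrightarrow> \<rho>' \<in> R \<Longrightarrow> \<rho> * \<rho>' \<in> R"
  by (rule R_induct[where N = R]) (use R_x_left[of _ 1] R_x_left[of _ "-1"] in \<open>auto simp: R_add R_emb_left power_int_minus\<close>)

lemma R_diff: "\<rho> \<in> R \<Longrightarrow> \<rho>' \<in> R \<Longrightarrow> \<rho> - \<rho>' \<in> R"
  using R_add[of \<rho> "- \<rho>'"] by (simp add: R_uminus)

end

section \<open>Two simple modules and their extensions\<close>

datatype pole = Lin | Quad

text \<open>\<open>Inner\<close> is the gap \<open>x\<close> between the two poles of \<open>B\<close>. \<open>GapC n\<close> and \<open>GapE n\<close> are the gap \<open>A\<^sup>2 u\<^sup>n\<close> after
  the last pole of \<open>C\<close> and of \<open>E\<close>, respectively.\<close>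

datatype letter = Inner | GapC int | GapE int

fun letter_pole :: "letter \<Rightarrow> pole" where
  "letter_pole Inner = Lin"
| "letter_pole (GapC n) = Lin"
| "letter_pole (GapE n) = Quad"

text \<open>The successions that occur in normal forms. At a change between \<open>C\<close> and \<open>E\<close> the exponent must not vanish, because
  \<open>A\<^sup>2\<close> alone is a split extension of the two modules: \<open>A\<^sup>2 = P - (1 - x)\<^sup>2 x\<^sup>-\<^sup>1\<close>.\<close>

fun letter_ok :: "letter \<Rightarrow> letter \<Rightarrow> bool" where
  "letter_ok Inner l \<longleftrightarrow> (\<exists>n. l = GapC n)"
| "letter_ok (GapC n) l \<longleftrightarrow> l = Inner \<or> n \<noteq> 0 \<and> (\<exists>k. l = GapE k)"
| "letter_ok (GapE n) l \<longleftrightarrow> (\<exists>k. l = GapE k) \<or> n \<noteq> 0 \<and> l = Inner"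

context quantum_extension
begin

fun pol :: "pole \<Rightarrow> 'd" where
  "pol Lin = 1 - x"
| "pol Quad = x - emb m + inverse x"

fun coef :: "letter \<Rightarrow> 'd" where
  "coef Inner = x"
| "coef (GapC n) = emb (s * u powi n)"
| "coef (GapE n) = emb (s * u powi n)"

abbreviation LM :: "pole \<Rightarrow> 'd set" where "LM t \<equiv> left_multiples R (pol t)"

definition F :: "'d set" where "F = emb ` {c. \<sigma> c = c}"

lemma s_nz: "s \<noteq> 0" by (simp add: koebe_def)

lemma u_nz: "u \<noteq> 0" by simp

lemma pol_R: "pol t \<in> R"
  by (cases t) (auto intro!: R_diff R_add R_1 R_x R_inverse_x R_emb)

lemma has_coeffs_pol:
  shows "has_coeffs \<rho> c \<Longrightarrow> has_coeffs (\<rho> * pol Lin) (\<lambda>i. c i - c (i - 1))"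
    and "has_coeffs \<rho> c \<Longrightarrow> has_coeffs (pol Lin * \<rho>) (\<lambda>i. c i - \<sigma> (c (i - 1)))"
    and "has_coeffs \<rho> c \<Longrightarrow>
      has_coeffs (\<rho> * pol Quad) (\<lambda>i. c (i - 1) - c i * dilate (q powi i) m + c (i + 1))"
    and "has_coeffs \<rho> c \<Longrightarrow>
      has_coeffs (pol Quad * \<rho>) (\<lambda>i. \<sigma> (c (i - 1)) - m * c i + \<tau> (c (i + 1)))"
proof -
  assume c: "has_coeffs \<rho> c"
  note r = has_coeffs_x_right[OF c, of 1] has_coeffs_x_right[OF c, of "-1"]
  note l = has_coeffs_x_left[OF c, of 1] has_coeffs_x_left[OF c, of "-1"]
  show "has_coeffs (\<rho> * pol Lin) (\<lambda>i. c i - c (i - 1))"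
    using has_coeffs_diff[OF c r(1)] by (simp add: right_diff_distrib)
  show "has_coeffs (pol Lin * \<rho>) (\<lambda>i. c i - \<sigma> (c (i - 1)))"
    using has_coeffs_diff[OF c l(1)] by (simp add: left_diff_distrib)
  show "has_coeffs (\<rho> * pol Quad) (\<lambda>i. c (i - 1) - c i * dilate (q powi i) m + c (i + 1))"
    using has_coeffs_add[OF has_coeffs_diff[OF r(1) has_coeffs_emb_right[OF c, of m]] r(2)]
    by (simp add: right_diff_distrib distrib_left power_int_minus)
  show "has_coeffs (pol Quad * \<rho>) (\<lambda>i. \<sigma> (c (i - 1)) - m * c i + \<tau> (c (i + 1)))"
    using has_coeffs_add[OF has_coeffs_diff[OF l(1) has_coeffs_emb_left[OF c, of m]] l(2)]
    by (simp add: left_diff_distrib distrib_right power_int_minus)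
qed

lemma finite_support_zero:
  assumes fin: "finite {i :: int. c i \<noteq> 0}"
    and down: "\<And>i. i > i0 \<Longrightarrow> c (i + 1) = 0 \<Longrightarrow> c (i + 2) = 0 \<Longrightarrow> c i = 0"
    and up: "\<And>i. i < i0 \<Longrightarrow> c i = 0 \<Longrightarrow> c (i - 1) = 0 \<Longrightarrow> c (i + 1) = 0"
  shows "c i = 0"
proof -
  define M where "M = Max (insert 0 (abs ` {i. c i \<noteq> 0}))"
  have M: "c i = 0" if "\<bar>i\<bar> > M" for i
  proof (rule ccontr)
    assume "c i \<noteq> 0"
    then have "\<bar>i\<bar> \<le> M" unfolding M_def using fin by (intro Max_ge) auto
    then show False using that by simp
  qed
  define P where "P i \<longleftrightarrow> (if i \<le> i0 then c i = 0 \<and> c (i - 1) = 0 else c i = 0 \<and> c (i + 1) = 0)" for i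
  have "P i"
  proof (rule two_sided_int_induct[of "\<bar>M\<bar> + 2" P i0])
    show "P (i + 1)" if "i < i0" "P i" for i
      using that up[of i] by (simp add: P_def)
    show "P i" if "i > i0" "P (i + 1)" for i
      using that down[of i] by (simp add: P_def add.assoc)
  qed (auto simp: P_def intro!: M)
  then show ?thesis by (simp add: P_def split: if_splits)
qed

text \<open>A nonzero multiple of \<open>1 - x\<close> involves at least two powers of \<open>x\<close>.\<close>

lemma LM_Lin_emb:
  assumes "emb f \<in> LM Lin"
  shows "f = 0"
proof -
  obtain \<chi> c where \<chi>: "emb f = \<chi> * pol Lin" "has_coeffs \<chi> c"
    using assms by (auto simp: left_multiples_def R_def)
  have eq: "c i - c (i - 1) = (if i = 0 then f else 0)" for i
    using has_coeffs_unique[OF has_coeffs_pol(1)[OF \<chi>(2)] has_coeffs_emb[of f, unfolded \<chi>(1)]]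
    by (rule fun_cong)
  have c0: "c i = 0" for i
  proof (rule finite_support_zero[of c "-1"])
    show "c i = 0" if "i > -1" "c (i + 1) = 0" "c (i + 2) = 0" for i
      using eq[of "i + 1"] that by simp
    show "c (i + 1) = 0" if "i < -1" "c i = 0" "c (i - 1) = 0" for i
      using eq[of "i + 1"] that by simp
  qed (rule has_coeffs_finite[OF \<chi>(2)])
  then show ?thesis using eq[of 0] by simp
qed

text \<open>A nonzero multiple of \<open>P\<close> involves powers of \<open>x\<close> whose exponents differ by at least 2. So 1 and \<open>x\<close> are
  independent modulo these multiples.\<close>

lemma LM_Quad_emb:
  assumes "emb g + emb h * x \<in> LM Quad"
  shows "g = 0" "h = 0"
proof -
  obtain \<chi> c where \<chi>: "emb g + emb h * x = \<chi> * pol Quad" "has_coeffs \<chi> c"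
    using assms by (auto simp: left_multiples_def R_def)
  have "has_coeffs (emb g + emb h * x) (\<lambda>i. (if i = 0 then g else 0) + (if i - 1 = 0 then h else 0))"
    using has_coeffs_add[OF has_coeffs_emb has_coeffs_x_right[OF has_coeffs_emb, of _ 1]] by simp
  from has_coeffs_unique[OF has_coeffs_pol(3)[OF \<chi>(2)] this[unfolded \<chi>(1)]]
  have eq: "c (i - 1) - c i * dilate (q powi i) m + c (i + 1) =
      (if i = 0 then g else 0) + (if i - 1 = 0 then h else 0)" for i
    by (rule fun_cong)
  have c0: "c i = 0" for i
  proof (rule finite_support_zero[of c 0])
    show "c i = 0" if "i > 0" "c (i + 1) = 0" "c (i + 2) = 0" for i
      using eq[of "i + 1"] that by (simp add: add.assoc)
    show "c (i + 1) = 0" if "i < 0" "c i = 0" "c (i - 1) = 0" for i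
      using eq[of i] that by simp
  qed (rule has_coeffs_finite[OF \<chi>(2)])
  show "g = 0" using eq[of 0] by (simp add: c0)
  show "h = 0" using eq[of 1] by (simp add: c0)
qed

lemma pol_left_emb:
  assumes "\<rho> \<in> R" "pol t * \<rho> = emb a"
  shows "a = 0"
proof -
  obtain c where c: "has_coeffs \<rho> c" using assms(1) by (auto simp: R_def)
  show ?thesis
  proof (cases t)
    case Lin
    have eq: "c i - \<sigma> (c (i - 1)) = (if i = 0 then a else 0)" for i
      using has_coeffs_unique[OF has_coeffs_pol(2)[OF c] has_coeffs_emb[of a, folded assms(2), unfolded Lin]]
      by (rule fun_cong)
    have c0: "c i = 0" for i
    proof (rule finite_support_zero[of c "-1"])
      show "c i = 0" if "i > -1" "c (i + 1) = 0" "c (i + 2) = 0" for i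
        using eq[of "i + 1"] that by (simp add: \<sigma>_simps)
      show "c (i + 1) = 0" if "i < -1" "c i = 0" "c (i - 1) = 0" for i
        using eq[of "i + 1"] that by (simp add: \<sigma>_simps)
    qed (rule has_coeffs_finite[OF c])
    then show ?thesis using eq[of 0] by (simp add: \<sigma>_simps)
  next
    case Quad
    have eq: "\<sigma> (c (i - 1)) - m * c i + \<tau> (c (i + 1)) = (if i = 0 then a else 0)" for i
      using has_coeffs_unique[OF has_coeffs_pol(4)[OF c] has_coeffs_emb[of a, folded assms(2), unfolded Quad]]
      by (rule fun_cong)
    have c0: "c i = 0" for i
    proof (rule finite_support_zero[of c 0])
      show "c i = 0" if "i > 0" "c (i + 1) = 0" "c (i + 2) = 0" for i
        using eq[of "i + 1"] that by (simp add: \<sigma>_simps \<tau>_simps add.assoc)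
      show "c (i + 1) = 0" if "i < 0" "c i = 0" "c (i - 1) = 0" for i
        using eq[of i] that by (simp add: \<sigma>_simps \<tau>_simps)
    qed (rule has_coeffs_finite[OF c])
    then show ?thesis using eq[of 0] by (simp add: \<sigma>_simps \<tau>_simps)
  qed
qed

lemma pol_nz: "pol t \<noteq> 0"
proof
  assume 0: "pol t = 0"
  have one: "has_coeffs 1 (\<lambda>i. if i = 0 then 1 else 0)"
    using has_coeffs_emb[of 1] by (simp add: emb_simps)
  have zero: "has_coeffs 0 (\<lambda>i. 0)"
    using has_coeffs_emb[of 0] by (simp add: emb_simps)
  show False
  proof (cases t)
    case Lin
    have "has_coeffs 0 (\<lambda>i. (if i = 0 then 1 else 0) - (if i - 1 = 0 then 1 else 0))"
      using has_coeffs_pol(1)[OF one] 0 Lin by simp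
    from fun_cong[OF has_coeffs_unique[OF this zero], of 0] show False by simp
  next
    case Quad
    have "has_coeffs 0 (\<lambda>i. (if i - 1 = 0 then 1 else 0) - (if i = 0 then 1 else 0) * dilate (q powi i) m
        + (if i + 1 = 0 then 1 else 0))"
      using has_coeffs_pol(3)[OF one] 0 Quad by simp
    from fun_cong[OF has_coeffs_unique[OF this zero], of 1] show False by simp
  qed
qed

declare pol.simps [simp del]

end

context quantum_extension
begin

lemma LM_mult: "\<rho> \<in> R \<Longrightarrow> \<rho> * pol t \<in> LM t"
  unfolding left_multiples_def by (rule imageI)

lemma emb_inverse_left: "f \<noteq> 0 \<Longrightarrow> emb (inverse f) * emb f = 1"
  by (simp add: emb_simps(1) flip: emb_simps(3))

lemma LM_left: "a \<in> R \<Longrightarrow> \<rho> \<in> LM t \<Longrightarrow> a * \<rho> \<in> LM t"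
  by (auto simp: left_multiples_def R_mult simp flip: mult.assoc intro!: imageI)

lemma LM_add: "\<rho> \<in> LM t \<Longrightarrow> \<rho>' \<in> LM t \<Longrightarrow> \<rho> + \<rho>' \<in> LM t"
  unfolding left_multiples_def by (auto simp flip: distrib_right intro!: imageI R_add)

lemma LM_diff: "\<rho> \<in> LM t \<Longrightarrow> \<rho>' \<in> LM t \<Longrightarrow> \<rho> - \<rho>' \<in> LM t"
  unfolding left_multiples_def by (auto simp flip: left_diff_distrib intro!: imageI R_diff)

lemma LM_Lin_x: "emb f * x - emb f \<in> LM Lin"
  using LM_mult[OF R_emb[of "- f"], of Lin] by (simp add: pol.simps emb_simps algebra_simps)

lemma LM_Lin_inverse_x: "emb f * inverse x - emb f \<in> LM Lin"
  using LM_mult[OF R_emb_left[OF R_inverse_x], of f Lin] x_nz by (simp add: pol.simps right_diff_distrib mult.assoc)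

lemma LM_Quad_xx: "emb f * x * x - (emb (f * \<sigma> m) * x - emb f) \<in> LM Quad"
proof -
  have "emb f * x * pol Quad = emb f * x * x - emb f * (x * emb m) + emb f * (x * inverse x)"
    by (simp only: pol.simps distrib_left right_diff_distrib mult.assoc)
  also have "\<dots> = emb f * x * x - (emb (f * \<sigma> m) * x - emb f)"
    using x_nz by (simp add: x_emb emb_simps(3) mult.assoc)
  finally show ?thesis using LM_mult[OF R_emb_left[OF R_x], of f Quad] by simp
qed

lemma LM_Quad_inverse_x: "emb f * inverse x - (emb (f * m) - emb f * x) \<in> LM Quad"
proof -
  have "emb f * pol Quad = emb f * inverse x - (emb (f * m) - emb f * x)"
  proof -
    have "a * (x - M + inverse x) = a * inverse x - (a * M - a * x)" for a M
      by (simp add: algebra_simps)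
    then show ?thesis by (simp only: pol.simps emb_simps(3))
  qed
  then show ?thesis using LM_mult[OF R_emb, of f Quad] by simp
qed

text \<open>The action of the two operators on representatives: \<open>f\<close> for the first module, \<open>g + h x\<close> for the second, where
  \<open>x\<^sup>2\<close> is replaced by \<open>\<sigma> m x - 1\<close>.\<close>

lemma Lin_emb_mod_Lin: "pol Lin * emb f - emb (f - \<sigma> f) \<in> LM Lin"
proof -
  have "pol Lin * emb f - emb (f - \<sigma> f) = 0 - (emb (\<sigma> f) * x - emb (\<sigma> f))"
    by (simp add: pol.simps left_diff_distrib x_emb emb_simps(6))
  moreover have "0 \<in> LM Lin" using LM_mult[OF R_0, of Lin] by simp
  ultimately show ?thesis using LM_diff[OF _ LM_Lin_x[of "\<sigma> f"]] by metis
qed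

lemma Quad_emb_mod_Lin: "pol Quad * emb f - emb (\<sigma> f + \<tau> f - m * f) \<in> LM Lin"
proof -
  have "pol Quad * emb f - emb (\<sigma> f + \<tau> f - m * f) =
      (emb (\<sigma> f) * x - emb (\<sigma> f)) + (emb (\<tau> f) * inverse x - emb (\<tau> f))"
    by (simp only: pol.simps left_diff_distrib distrib_right x_emb inverse_x_emb emb_simps(2,3,6))
      (simp add: algebra_simps)
  then show ?thesis using LM_add[OF LM_Lin_x[of "\<sigma> f"] LM_Lin_inverse_x[of "\<tau> f"]] by metis
qed

lemma Lin_emb_mod_Quad:
  "pol Lin * (emb g + emb h * x) - (emb (g + \<sigma> h) + emb (h - \<sigma> g - \<sigma> h * \<sigma> m) * x) \<in> LM Quad"
proof -
  have "x * (emb h * x) = emb (\<sigma> h) * x * x" by (simp add: x_emb flip: mult.assoc)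
  then have "pol Lin * (emb g + emb h * x) - (emb (g + \<sigma> h) + emb (h - \<sigma> g - \<sigma> h * \<sigma> m) * x) =
      0 - (emb (\<sigma> h) * x * x - (emb (\<sigma> h * \<sigma> m) * x - emb (\<sigma> h)))"
    by (simp add: pol.simps left_diff_distrib distrib_left x_emb emb_simps(2,6))
  moreover have "0 \<in> LM Quad" using LM_mult[OF R_0, of Quad] by simp
  ultimately show ?thesis using LM_diff[OF _ LM_Quad_xx[of "\<sigma> h"]] by metis
qed

lemma Quad_emb_mod_Quad:
  "pol Quad * (emb g + emb h * x) - (emb (\<tau> h - \<sigma> h - m * (g - \<tau> g)) +
    emb (\<sigma> g - \<tau> g - m * h + \<sigma> h * \<sigma> m) * x) \<in> LM Quad"
proof -
  have "pol Quad * (emb g + emb h * x) = emb (\<sigma> g) * x + emb (\<sigma> h) * x * x - emb (m * g) - emb (m * h) * x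
      + emb (\<tau> g) * inverse x + emb (\<tau> h)"
  proof -
    have "(x - M + inverse x) * (G + H) = x * G + x * H - M * G - M * H + inverse x * G + inverse x * H" for M G H
      by (simp add: algebra_simps)
    moreover have "a * inverse x * x = a" for a
      using x_nz by (simp add: mult.assoc)
    ultimately show ?thesis
      by (simp only: pol.simps x_emb inverse_x_emb emb_simps(3) mult.assoc[symmetric])
  qed
  then have "pol Quad * (emb g + emb h * x) - (emb (\<tau> h - \<sigma> h - m * (g - \<tau> g)) +
      emb (\<sigma> g - \<tau> g - m * h + \<sigma> h * \<sigma> m) * x) =
      (emb (\<sigma> h) * x * x - (emb (\<sigma> h * \<sigma> m) * x - emb (\<sigma> h))) +
      (emb (\<tau> g) * inverse x - (emb (\<tau> g * m) - emb (\<tau> g) * x))"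
    by (simp only: right_diff_distrib left_diff_distrib distrib_right emb_simps(2,6) mult.commute[of m])
      (simp add: algebra_simps)
  then show ?thesis using LM_add[OF LM_Quad_xx[of "\<sigma> h"] LM_Quad_inverse_x[of "\<tau> g"]] by metis
qed

text \<open>Division with remainder, the remainder being \<open>f\<close> here and \<open>g + h x\<close> below.\<close>

lemma division_Lin:
  assumes "\<rho> \<in> R"
  shows "\<exists>f. \<rho> - emb f \<in> LM Lin"
proof -
  define N where "N = {\<rho>. \<exists>f. \<rho> - emb f \<in> LM Lin}"
  have "\<rho> * 1 \<in> N"
  proof (rule R_induct[OF assms])
    show "a + b \<in> N" if ab: "a \<in> N" "b \<in> N" for a b
    proof -
      obtain f g where "a - emb f \<in> LM Lin" "b - emb g \<in> LM Lin" using ab by (auto simp: N_def)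
      from LM_add[OF this] have "a + b - emb (f + g) \<in> LM Lin" by (simp add: emb_simps(2) algebra_simps)
      then show ?thesis by (auto simp: N_def)
    qed
    show "emb g * a \<in> N" if aN: "a \<in> N" for g a
    proof -
      obtain f where "a - emb f \<in> LM Lin" using aN by (auto simp: N_def)
      from LM_left[OF R_emb this] have "emb g * a - emb (g * f) \<in> LM Lin"
        by (simp add: emb_simps(3) right_diff_distrib)
      then show ?thesis by (auto simp: N_def)
    qed
    show "x * a \<in> N" if aN: "a \<in> N" for a
    proof -
      obtain f where "a - emb f \<in> LM Lin" using aN by (auto simp: N_def)
      from LM_add[OF LM_left[OF R_x this] LM_Lin_x[of "\<sigma> f"]] have "x * a - emb (\<sigma> f) \<in> LM Lin"
        by (simp add: x_emb right_diff_distrib)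
      then show ?thesis by (auto simp: N_def)
    qed
    show "inverse x * a \<in> N" if aN: "a \<in> N" for a
    proof -
      obtain f where "a - emb f \<in> LM Lin" using aN by (auto simp: N_def)
      from LM_add[OF LM_left[OF R_inverse_x this] LM_Lin_inverse_x[of "\<tau> f"]]
      have "inverse x * a - emb (\<tau> f) \<in> LM Lin"
        by (simp add: inverse_x_emb right_diff_distrib)
      then show ?thesis by (auto simp: N_def)
    qed
    show "1 \<in> N"
      unfolding N_def using LM_mult[OF R_0, of Lin] by (auto simp: emb_simps intro!: exI[of _ 1])
  qed
  then show ?thesis by (simp add: N_def)
qed

lemma division_Quad:
  assumes "\<rho> \<in> R"
  shows "\<exists>g h. \<rho> - (emb g + emb h * x) \<in> LM Quad"
proof -
  define N where "N = {\<rho>. \<exists>g h. \<rho> - (emb g + emb h * x) \<in> LM Quad}"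
  have "\<rho> * 1 \<in> N"
  proof (rule R_induct[OF assms])
    show "a + b \<in> N" if ab: "a \<in> N" "b \<in> N" for a b
    proof -
      obtain f g f' g' where "a - (emb f + emb g * x) \<in> LM Quad" "b - (emb f' + emb g' * x) \<in> LM Quad"
        using ab by (auto simp: N_def)
      from LM_add[OF this] have "a + b - (emb (f + f') + emb (g + g') * x) \<in> LM Quad"
        by (simp add: emb_simps(2) algebra_simps)
      then show ?thesis by (auto simp: N_def)
    qed
    show "emb k * a \<in> N" if aN: "a \<in> N" for k a
    proof -
      obtain f g where "a - (emb f + emb g * x) \<in> LM Quad" using aN by (auto simp: N_def)
      from LM_left[OF R_emb this, of k] have "emb k * a - (emb (k * f) + emb (k * g) * x) \<in> LM Quad"
        by (simp add: emb_simps(3) right_diff_distrib distrib_left mult.assoc)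
      then show ?thesis by (auto simp: N_def)
    qed
    show "x * a \<in> N" if aN: "a \<in> N" for a
    proof -
      obtain f g where "a - (emb f + emb g * x) \<in> LM Quad" using aN by (auto simp: N_def)
      from LM_add[OF LM_left[OF R_x this] LM_Quad_xx[of "\<sigma> g"]]
      have "x * a - (emb (- \<sigma> g) + emb (\<sigma> f + \<sigma> g * \<sigma> m) * x) \<in> LM Quad"
        by (simp add: x_emb emb_simps(2,5) right_diff_distrib distrib_left distrib_right algebra_simps
            flip: mult.assoc[of x "emb g"])
      then show ?thesis by (auto simp: N_def)
    qed
    show "inverse x * a \<in> N" if aN: "a \<in> N" for a
    proof -
      obtain f g where "a - (emb f + emb g * x) \<in> LM Quad" using aN by (auto simp: N_def)
      from LM_add[OF LM_left[OF R_inverse_x this] LM_Quad_inverse_x[of "\<tau> f"]]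
      have "inverse x * (a - (emb f + emb g * x)) + (emb (\<tau> f) * inverse x - (emb (\<tau> f * m) - emb (\<tau> f) * x)) \<in> LM Quad" .
      moreover have "y * (a - (b + c)) + (y * b - (d - e)) = y * a - ((y * c + d) + - e)" for y b c d e
        by (simp add: algebra_simps)
      moreover have "inverse x * (emb g * x) = emb (\<tau> g)"
        using x_nz by (simp add: inverse_x_emb mult.assoc flip: mult.assoc[of "inverse x"])
      ultimately have "inverse x * a - (emb (\<tau> g + \<tau> f * m) + emb (- \<tau> f) * x) \<in> LM Quad"
        by (simp only: emb_simps(2,5) inverse_x_emb[of f, symmetric] mult_minus_left)
      then show ?thesis by (auto simp: N_def)
    qed
    have "1 - (emb 1 + emb 0 * x) \<in> LM Quad"
      using LM_mult[OF R_0, of Quad] by (simp add: emb_simps)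
    then show "1 \<in> N" unfolding N_def by blast
  qed
  then show ?thesis by (simp add: N_def)
qed

lemma LM_cong:
  assumes "pol t * \<rho> + a \<in> LM t'" "\<rho> - n \<in> LM t'" "pol t * n - b \<in> LM t'"
  shows "b + a \<in> LM t'"
proof -
  have "b + a = pol t * \<rho> + a - pol t * (\<rho> - n) - (pol t * n - b)"
    by (simp add: right_diff_distrib)
  also have "\<dots> \<in> LM t'"
    by (intro LM_diff LM_left pol_R assms)
  finally show ?thesis .
qed

lemma gap_uminus: "gap a \<Longrightarrow> gap (- a)"
  by (simp add: gap_def to_acf_simps symmetric_gap_intros)

lemma \<tau>_fixed: "\<sigma> f = f \<Longrightarrow> \<tau> f = f"
  by (metis \<sigma>\<tau>(2))

text \<open>The following four lemmas give at once the homomorphisms between the modules (for \<open>a = 0\<close>) and the triviality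
  of split extensions. Passing to remainders turns the hypothesis into a difference equation. In the two mixed cases
  constant multiples of \<open>s\<close> do split.\<close>

lemma Lin_mod_Lin:
  assumes "\<rho> \<in> R" "pol Lin * \<rho> + emb a \<in> LM Lin" "gap a"
  shows "a = 0" "\<exists>k. \<sigma> k = k \<and> \<rho> - emb k \<in> LM Lin"
proof -
  obtain f where f: "\<rho> - emb f \<in> LM Lin" using division_Lin[OF assms(1)] by blast
  have "emb (f - \<sigma> f + a) \<in> LM Lin"
    using LM_cong[OF assms(2) f Lin_emb_mod_Lin] by (simp add: emb_simps(2))
  then have eq: "f - \<sigma> f + a = 0" by (rule LM_Lin_emb)
  then have "f - \<sigma> f = - a" by (simp add: eq_neg_iff_add_eq_0)
  then have "- a = 0" using first_order_gap gap_uminus[OF assms(3)] by blast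
  then show "a = 0" by simp
  then show "\<exists>k. \<sigma> k = k \<and> \<rho> - emb k \<in> LM Lin" using f eq by (auto intro!: exI[of _ f])
qed

lemma Quad_mod_Lin:
  assumes "\<rho> \<in> R" "pol Quad * \<rho> + emb a \<in> LM Lin" "gap a"
  shows "\<exists>k. \<sigma> k = k \<and> a + s * k = 0 \<and> \<rho> - emb k \<in> LM Lin"
proof -
  obtain f where f: "\<rho> - emb f \<in> LM Lin" using division_Lin[OF assms(1)] by blast
  have "emb (\<sigma> f + \<tau> f - m * f + a) \<in> LM Lin"
    using LM_cong[OF assms(2) f Quad_emb_mod_Lin] by (simp only: emb_simps(2))
  then have eq: "\<sigma> f + \<tau> f - m * f + a = 0" by (rule LM_Lin_emb)
  then have "\<sigma> f + \<tau> f - m * f = - a" by (simp only: eq_neg_iff_add_eq_0)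
  then have fx: "\<sigma> f = f" using second_order_gap gap_uminus[OF assms(3)] by blast
  then have "a + s * f = 0"
    using eq \<tau>_fixed[OF fx] by (simp add: algebra_simps)
  then show ?thesis using f fx by blast
qed

lemma Lin_mod_Quad:
  assumes "\<rho> \<in> R" "pol Lin * \<rho> + emb a \<in> LM Quad" "gap a"
  shows "\<exists>k. \<sigma> k = k \<and> a + s * k = 0 \<and> (a = 0 \<longrightarrow> \<rho> \<in> LM Quad)"
proof -
  obtain g h where gh: "\<rho> - (emb g + emb h * x) \<in> LM Quad" using division_Quad[OF assms(1)] by blast
  have "emb (g + \<sigma> h + a) + emb (h - \<sigma> g - \<sigma> h * \<sigma> m) * x \<in> LM Quad"
    using LM_cong[OF assms(2) gh Lin_emb_mod_Quad] by (simp add: emb_simps(2) add_ac)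
  from LM_Quad_emb[OF this] have eq: "g + \<sigma> h + a = 0" "h - \<sigma> g - \<sigma> h * \<sigma> m = 0" .
  have "\<tau> (h - \<sigma> g - \<sigma> h * \<sigma> m) = 0" using eq(2) by (simp add: \<tau>_simps)
  then have "g = \<tau> h - m * h" by (simp only: \<tau>_simps \<sigma>\<tau>) (simp add: algebra_simps)
  then have eq': "\<sigma> h + \<tau> h - m * h = - a" using eq(1) by (simp only: eq_neg_iff_add_eq_0 add_ac diff_conv_add_uminus)
  then have fx: "\<sigma> h = h" using second_order_gap gap_uminus[OF assms(3)] by blast
  then have ash: "a + s * h = 0"
    using eq' \<tau>_fixed[OF fx] by (simp add: algebra_simps eq_neg_iff_add_eq_0)
  have "\<rho> \<in> LM Quad" if "a = 0"
  proof -
    have "h = 0" using ash that s_nz by simp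
    then have "g = 0" using eq(1) that by (simp add: \<sigma>_simps)
    then show ?thesis using gh \<open>h = 0\<close> by (simp add: emb_simps)
  qed
  then show ?thesis using fx ash by blast
qed

lemma Quad_mod_Quad:
  assumes "\<rho> \<in> R" "pol Quad * \<rho> + emb a \<in> LM Quad" "gap a"
  shows "a = 0" "\<exists>k. \<sigma> k = k \<and> \<rho> - emb k \<in> LM Quad"
proof -
  obtain g h where gh: "\<rho> - (emb g + emb h * x) \<in> LM Quad" using division_Quad[OF assms(1)] by blast
  have "emb (\<tau> h - \<sigma> h - m * (g - \<tau> g) + a) + emb (\<sigma> g - \<tau> g - m * h + \<sigma> h * \<sigma> m) * x \<in> LM Quad"
    using LM_cong[OF assms(2) gh Quad_emb_mod_Quad] by (simp only: emb_simps(2) add_ac)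
  from LM_Quad_emb[OF this] have "a - m * (g - \<tau> g) + \<tau> h - \<sigma> h = 0" "\<sigma> g - \<tau> g - m * h + \<sigma> m * \<sigma> h = 0"
    by (simp_all only: add_ac diff_conv_add_uminus mult.commute[of "\<sigma> h"])
  from self_extension_gap[OF this assms(3)] have "a = 0" "h = 0" "\<sigma> g = g" .
  then show "a = 0" "\<exists>k. \<sigma> k = k \<and> \<rho> - emb k \<in> LM Quad"
    using gh by (auto simp: emb_simps)
qed

lemma simple_Lin:
  assumes "\<rho> \<in> R" "\<rho> \<notin> LM Lin"
  shows "\<exists>\<kappa>\<in>R. \<kappa> * \<rho> - 1 \<in> LM Lin"
proof -
  obtain f where f: "\<rho> - emb f \<in> LM Lin" using division_Lin[OF assms(1)] by blast
  then have "f \<noteq> 0" using assms(2) by (auto simp: emb_simps)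
  then have "emb (inverse f) * (\<rho> - emb f) = emb (inverse f) * \<rho> - 1"
    by (simp add: right_diff_distrib emb_inverse_left)
  then show ?thesis using LM_left[OF R_emb f, of "inverse f"] R_emb by metis
qed

text \<open>For a remainder proportional to \<open>x - b\<close>, the remainder of \<open>x\<^sup>-\<^sup>1 - \<tau> b\<close> times \<open>x - b\<close> is the function
  \<open>\<tau> b (b - m) + 1\<close>, which is not zero as the Riccati equation has no solution.\<close>

lemma simple_Quad:
  assumes "\<rho> \<in> R" "\<rho> \<notin> LM Quad"
  shows "\<exists>\<kappa>\<in>R. \<kappa> * \<rho> - 1 \<in> LM Quad"
proof -
  obtain g h where gh: "\<rho> - (emb g + emb h * x) \<in> LM Quad" using division_Quad[OF assms(1)] by blast
  show ?thesis
  proof (cases "h = 0")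
    case True
    then have g: "\<rho> - emb g \<in> LM Quad" using gh by (simp add: emb_simps)
    then have "g \<noteq> 0" using assms(2) by (auto simp: emb_simps)
    then have "emb (inverse g) * (\<rho> - emb g) = emb (inverse g) * \<rho> - 1"
      by (simp add: right_diff_distrib emb_inverse_left)
    then show ?thesis using LM_left[OF R_emb g, of "inverse g"] R_emb by metis
  next
    case False
    define b where "b = - g / h"
    define \<rho>' where "\<rho>' = emb (inverse h) * \<rho>"
    have "emb (inverse h) * (\<rho> - (emb g + emb h * x)) = \<rho>' - (x - emb b)"
    proof -
      have "emb (inverse h) * emb g = - emb b"
        by (simp add: b_def divide_inverse mult.commute flip: emb_simps(3,5))
      moreover have "emb (inverse h) * (emb h * x) = x"
        using False by (simp add: emb_simps flip: mult.assoc)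
      ultimately show ?thesis by (simp add: \<rho>'_def right_diff_distrib distrib_left)
    qed
    then have \<rho>': "\<rho>' - (x - emb b) \<in> LM Quad" using LM_left[OF R_emb gh, of "inverse h"] by simp
    define k where "k = \<tau> b * (b - m) + 1"
    have k: "k \<noteq> 0"
    proof
      assume "k = 0"
      then have "\<tau> b * (m - b) = 1" by (simp add: k_def algebra_simps)
      then show False using riccati by blast
    qed
    have idn: "(inverse x - emb (\<tau> b)) * (x - emb b) = emb k - emb (\<tau> b) * pol Quad"
    proof -
      have "(inverse x - emb (\<tau> b)) * (x - emb b) = inverse x * x - inverse x * emb b - emb (\<tau> b) * x + emb (\<tau> b) * emb b"
        by (simp add: algebra_simps)
      also have "\<dots> = 1 - emb (\<tau> b) * inverse x - emb (\<tau> b) * x + emb (\<tau> b * b)"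
        using x_nz by (simp add: inverse_x_emb emb_simps(3))
      also have "\<dots> = emb k - emb (\<tau> b) * pol Quad"
        by (simp only: k_def pol.simps emb_simps(1,2,3,6) right_diff_distrib distrib_left) (simp add: algebra_simps)
      finally show ?thesis .
    qed
    define \<kappa> where "\<kappa> = emb (inverse k) * (inverse x - emb (\<tau> b))"
    have \<kappa>: "\<kappa> \<in> R" unfolding \<kappa>_def by (intro R_mult R_emb R_diff R_inverse_x)
    have "\<kappa> * (x - emb b) = 1 - emb (inverse k * \<tau> b) * pol Quad"
      using k unfolding \<kappa>_def mult.assoc idn by (simp add: right_diff_distrib emb_inverse_left emb_simps(3) mult.assoc)
    then have "\<kappa> * \<rho>' - 1 = \<kappa> * (\<rho>' - (x - emb b)) - emb (inverse k * \<tau> b) * pol Quad"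
      by (simp add: right_diff_distrib)
    also have "\<dots> \<in> LM Quad"
      by (intro LM_diff LM_left \<kappa> \<rho>' LM_mult R_emb)
    finally have "\<kappa> * emb (inverse h) * \<rho> - 1 \<in> LM Quad" by (simp add: \<rho>'_def mult.assoc)
    then show ?thesis using R_mult[OF \<kappa> R_emb] by blast
  qed
qed

lemma F_central:
  assumes "e \<in> F" "\<rho> \<in> R"
  shows "e * \<rho> = \<rho> * e"
proof -
  obtain k where k: "e = emb k" "\<sigma> k = k" using assms(1) by (auto simp: F_def)
  have kf: "emb k * emb f = emb f * emb k" for f by (rule emb_simps)
  define N where "N = {\<rho>. emb k * \<rho> = \<rho> * emb k}"
  have "\<rho> * 1 \<in> N"
  proof (rule R_induct[OF assms(2)])
    show "x * a \<in> N" if aN: "a \<in> N" for a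
      using aN x_emb[of k] k(2) by (simp add: N_def) (metis mult.assoc)
    show "inverse x * a \<in> N" if aN: "a \<in> N" for a
      using aN inverse_x_emb[of k] \<tau>_fixed[OF k(2)] by (simp add: N_def) (metis mult.assoc)
    show "emb f * a \<in> N" if aN: "a \<in> N" for f a
      using aN kf[of f] by (simp add: N_def) (metis mult.assoc)
  qed (simp_all add: N_def distrib_left distrib_right)
  then show ?thesis by (simp add: N_def k)
qed

end

section \<open>Independence of the normal forms\<close>

fun letter_okend :: "letter \<Rightarrow> bool" where
  "letter_okend Inner \<longleftrightarrow> False"
| "letter_okend _ \<longleftrightarrow> True"

context quantum_extension
begin

lemma gap_letters:
  assumes "finite S" "\<And>l. l \<in> S \<Longrightarrow> \<exists>n. l = K n" "\<And>l. l \<in> S \<Longrightarrow> c l \<in> F"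
    and K: "inj K" "\<And>n. coef (K n) = emb (s * u powi n)"
  shows "\<exists>N d. finite N \<and> S = K ` N \<and> (\<forall>n\<in>N. \<sigma> (d n) = d n \<and> c (K n) = emb (d n)) \<and>
    (\<Sum>l\<in>S. c l * coef l) = emb (\<Sum>n\<in>N. d n * (s * u powi n)) \<and> gap (\<Sum>n\<in>N. d n * (s * u powi n))"
proof -
  define N where "N = K -` S"
  have N: "finite N" "S = K ` N"
    unfolding N_def using assms(1,2) K(1) by (auto intro: finite_vimageI)
  have "\<exists>e. \<sigma> e = e \<and> c (K n) = emb e" if "n \<in> N" for n
    using assms(3)[of "K n"] that by (auto simp: N_def F_def)
  then obtain d where d: "\<And>n. n \<in> N \<Longrightarrow> \<sigma> (d n) = d n \<and> c (K n) = emb (d n)" by metis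
  have "(\<Sum>l\<in>S. c l * coef l) = (\<Sum>n\<in>N. c (K n) * coef (K n))"
    unfolding N(2) using K(1) by (subst sum.reindex) (auto intro: inj_on_subset)
  also have "\<dots> = emb (\<Sum>n\<in>N. d n * (s * u powi n))"
    unfolding emb_simps(8) by (intro sum.cong) (simp_all only: d K(2) emb_simps(3))
  finally show ?thesis
    using N d gap_s_fixed_combination[of N d] by blast
qed

lemma s_combination_independent:
  assumes "finite N" "\<And>n. n \<in> N \<Longrightarrow> \<sigma> (d n) = d n" "(\<Sum>n\<in>N. d n * (s * u powi n)) = 0" "n \<in> N"
  shows "d n = 0"
proof -
  have "(\<Sum>n\<in>N. d n * (s * u powi n)) = s * (\<Sum>n\<in>N. d n * u powi n)"
    by (simp add: sum_distrib_left mult_ac)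
  then have "(\<Sum>n\<in>N. d n * u powi n) = 0" using assms(3) s_nz by simp
  from independent_u_powers[OF assms(1) this assms(2,4)] show ?thesis by simp
qed

text \<open>At a change between \<open>C\<close> and \<open>E\<close> the constant multiples of \<open>s\<close> take the place of the missing exponent 0.\<close>

lemma s_combination_independent_0:
  assumes "finite N" "\<And>n. n \<in> N \<Longrightarrow> \<sigma> (d n) = d n" "\<sigma> k = k" "0 \<notin> N"
    and "(\<Sum>n\<in>N. d n * (s * u powi n)) + s * k = 0" "n \<in> N"
  shows "d n = 0"
proof -
  let ?d = "d(0 := k)"
  have "(\<Sum>n\<in>insert 0 N. ?d n * (s * u powi n)) = s * k + (\<Sum>n\<in>N. ?d n * (s * u powi n))"
    using assms(1,4) by (simp add: mult.commute)
  also have "(\<Sum>n\<in>N. ?d n * (s * u powi n)) = (\<Sum>n\<in>N. d n * (s * u powi n))"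
    using assms(4) by (intro sum.cong) auto
  finally have "(\<Sum>n\<in>insert 0 N. ?d n * (s * u powi n)) = 0" using assms(5) by (simp only: add.commute)
  then have "?d n = 0"
    by (rule s_combination_independent[rotated 2]) (use assms in \<open>auto split: if_splits\<close>)
  then show ?thesis using assms(4,6) by (auto split: if_splits)
qed

text \<open>One of the four lemmas on difference equations applies, depending on the two poles. Before \<open>GapC n\<close> only the gap \<open>x\<close>
  is admitted, which is congruent to 1 modulo the multiples of \<open>1 - x\<close>.\<close>

lemma ext_letters:
  assumes "finite S" "\<And>l. l \<in> S \<Longrightarrow> letter_pole l = t \<and> letter_ok l l' \<and> c l \<in> F" "\<rho> \<in> R"
    and rel: "pol t * \<rho> + (\<Sum>l\<in>S. c l * coef l) \<in> LM (letter_pole l')" and "l \<in> S"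
  shows "c l = 0"
proof (cases "l' = Inner \<or> (\<exists>k. l' = GapE k)")
  case True
  show ?thesis
  proof (cases t)
    case Lin
    have "\<exists>n. l = GapC n" if "l \<in> S" for l
      using assms(2)[OF that] True Lin by (cases l) auto
    then obtain N d where N: "finite N" "S = GapC ` N" "\<forall>n\<in>N. \<sigma> (d n) = d n \<and> c (GapC n) = emb (d n)"
      "(\<Sum>l\<in>S. c l * coef l) = emb (\<Sum>n\<in>N. d n * (s * u powi n))" "gap (\<Sum>n\<in>N. d n * (s * u powi n))"
      using gap_letters[of S GapC c] assms(1,2) by (auto simp: inj_def)
    obtain n where n: "n \<in> N" "l = GapC n" using \<open>l \<in> S\<close> N(2) by auto
    have "d n = 0"
    proof (cases "l' = Inner")
      case True
      then have "pol Lin * \<rho> + emb (\<Sum>n\<in>N. d n * (s * u powi n)) \<in> LM Lin"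
        using rel Lin N(4) by simp
      from Lin_mod_Lin(1)[OF assms(3) this N(5)] show ?thesis
        using s_combination_independent[OF N(1) _ _ n(1)] N(3) by blast
    next
      case False
      then obtain k where k: "l' = GapE k" using True by blast
      then have "pol Lin * \<rho> + emb (\<Sum>n\<in>N. d n * (s * u powi n)) \<in> LM Quad"
        using rel Lin N(4) by simp
      from Lin_mod_Quad[OF assms(3) this N(5)] obtain e where
        "\<sigma> e = e" "(\<Sum>n\<in>N. d n * (s * u powi n)) + s * e = 0" by blast
      moreover have "0 \<notin> N" using assms(2)[of "GapC 0"] N(2) k by auto
      ultimately show ?thesis
        using s_combination_independent_0[OF N(1) _ _ _ _ n(1)] N(3) by blast
    qed
    then show ?thesis using N(3) n by (simp add: emb_simps)
  next
    case Quad
    have "\<exists>n. l = GapE n" if "l \<in> S" for l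
      using assms(2)[OF that] True Quad by (cases l) auto
    then obtain N d where N: "finite N" "S = GapE ` N" "\<forall>n\<in>N. \<sigma> (d n) = d n \<and> c (GapE n) = emb (d n)"
      "(\<Sum>l\<in>S. c l * coef l) = emb (\<Sum>n\<in>N. d n * (s * u powi n))" "gap (\<Sum>n\<in>N. d n * (s * u powi n))"
      using gap_letters[of S GapE c] assms(1,2) by (auto simp: inj_def)
    obtain n where n: "n \<in> N" "l = GapE n" using \<open>l \<in> S\<close> N(2) by auto
    have "d n = 0"
    proof (cases "l' = Inner")
      case True
      then have "pol Quad * \<rho> + emb (\<Sum>n\<in>N. d n * (s * u powi n)) \<in> LM Lin"
        using rel Quad N(4) by simp
      from Quad_mod_Lin[OF assms(3) this N(5)] obtain e where
        "\<sigma> e = e" "(\<Sum>n\<in>N. d n * (s * u powi n)) + s * e = 0" by blast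
      moreover have "0 \<notin> N" using assms(2)[of "GapE 0"] N(2) True by auto
      ultimately show ?thesis
        using s_combination_independent_0[OF N(1) _ _ _ _ n(1)] N(3) by blast
    next
      case False
      then have "pol Quad * \<rho> + emb (\<Sum>n\<in>N. d n * (s * u powi n)) \<in> LM Quad"
        using rel Quad N(4) \<open>l' = Inner \<or> _\<close> by auto
      from Quad_mod_Quad(1)[OF assms(3) this N(5)] show ?thesis
        using s_combination_independent[OF N(1) _ _ n(1)] N(3) by blast
    qed
    then show ?thesis using N(3) n by (simp add: emb_simps)
  qed
next
  case False
  then obtain k where k: "l' = GapC k" by (cases l') auto
  have "l = Inner" if "l \<in> S" for l
    using assms(2)[OF that] k by (cases l) auto
  then have S: "S = {Inner}" "l = Inner" using \<open>l \<in> S\<close> by auto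
  have t: "t = Lin" using assms(2)[OF \<open>l \<in> S\<close>] S by simp
  obtain e where e: "c Inner = emb e" "\<sigma> e = e" using assms(2)[OF \<open>l \<in> S\<close>] S by (auto simp: F_def)
  have rel1: "pol Lin * \<rho> + emb e * x \<in> LM Lin" using rel S(1) t k e by simp
  have "pol Lin * \<rho> + emb e = pol Lin * \<rho> + emb e * x - (emb e * x - emb e)" by simp
  also have "\<dots> \<in> LM Lin" by (intro LM_diff rel1 LM_Lin_x)
  finally have "e = 0" using Lin_mod_Lin(1)[OF assms(3)] gap_fixed[OF e(2)] by blast
  then show ?thesis using S e by (simp add: emb_simps)
qed

lemma ext_end_letters:
  assumes "finite S" "\<And>l. l \<in> S \<Longrightarrow> letter_pole l = t \<and> letter_okend l \<and> c l \<in> F" "\<rho> \<in> R"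
    and rel: "pol t * \<rho> + (\<Sum>l\<in>S. c l * coef l) = 0" and "l \<in> S"
  shows "c l = 0"
proof -
  obtain K where K: "inj K" "\<And>n. coef (K n) = emb (s * u powi n)" "\<And>l. l \<in> S \<Longrightarrow> \<exists>n. l = K n"
  proof (cases t)
    case Lin
    have "\<exists>n. l = GapC n" if "l \<in> S" for l using assms(2)[OF that] Lin by (cases l) auto
    then show thesis by (intro that[of GapC]) (auto simp: inj_def)
  next
    case Quad
    have "\<exists>n. l = GapE n" if "l \<in> S" for l using assms(2)[OF that] Quad by (cases l) auto
    then show thesis by (intro that[of GapE]) (auto simp: inj_def)
  qed
  obtain N d where N: "finite N" "S = K ` N" "\<forall>n\<in>N. \<sigma> (d n) = d n \<and> c (K n) = emb (d n)"
    "(\<Sum>l\<in>S. c l * coef l) = emb (\<Sum>n\<in>N. d n * (s * u powi n))"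
    using gap_letters[of S K c] assms(1,2) K by blast
  have "pol t * \<rho> = emb (- (\<Sum>n\<in>N. d n * (s * u powi n)))"
    using rel unfolding N(4) emb_simps(5) by (simp add: eq_neg_iff_add_eq_0)
  then have "- (\<Sum>n\<in>N. d n * (s * u powi n)) = 0" by (rule pol_left_emb[OF assms(3)])
  then have z: "(\<Sum>n\<in>N. d n * (s * u powi n)) = 0" by simp
  obtain n where n: "n \<in> N" "l = K n" using \<open>l \<in> S\<close> N(2) by auto
  have "d n = 0" using s_combination_independent[OF N(1) _ z n(1)] N(3) by blast
  then show ?thesis using N(3) n by (simp add: emb_simps)
qed

end

sublocale quantum_extension \<subseteq> quiver: ext_quiver R F pol letter_pole coef letter_ok letter_okend
proof
  show "coef l \<in> R" for l by (cases l) (auto intro: R_x R_emb)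
  show "F \<subseteq> R" by (auto simp: F_def intro: R_emb)
  show "0 \<in> F" unfolding F_def by (rule image_eqI[of _ _ 0]) (simp_all add: emb_simps \<sigma>_simps)
  show "\<exists>\<kappa>\<in>R. \<kappa> * \<rho> - 1 \<in> LM t" if "\<rho> \<in> R" "\<rho> \<notin> LM t" for \<rho> t
    using that simple_Lin simple_Quad by (cases t) auto
  have gap0: "gap 0" using gap_fixed[of 0] by (simp add: \<sigma>_simps)
  have e0: "a + emb 0 = a" for a by (simp add: emb_simps)
  show "\<exists>k\<in>F. \<rho> - k \<in> LM t" if \<rho>: "\<rho> \<in> R" and p: "pol t * \<rho> \<in> LM t" for \<rho> t
  proof -
    have "\<exists>k. \<sigma> k = k \<and> \<rho> - emb k \<in> LM t"
      using Lin_mod_Lin(2)[OF \<rho> _ gap0] Quad_mod_Quad(2)[OF \<rho> _ gap0] p by (cases t) (auto simp: e0)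
    then show ?thesis by (auto simp: F_def)
  qed
  show "\<rho> \<in> LM t'" if tt: "t \<noteq> t'" and \<rho>: "\<rho> \<in> R" and p: "pol t * \<rho> \<in> LM t'" for t t' \<rho>
  proof (cases t)
    case Lin
    then have "t' = Quad" using tt by (cases t') auto
    then show ?thesis using Lin_mod_Quad[OF \<rho> _ gap0] p Lin by (auto simp: e0)
  next
    case Quad
    then have t': "t' = Lin" using tt by (cases t') auto
    then obtain k where k: "s * k = 0" "\<rho> - emb k \<in> LM Lin"
      using Quad_mod_Lin[OF \<rho> _ gap0] p Quad by (auto simp: e0)
    then have "k = 0" using s_nz by simp
    then show ?thesis using k(2) t' by (simp add: emb_simps)
  qed
qed (fact R_0 R_1 R_add R_uminus R_mult pol_R pol_nz F_central ext_letters ext_end_letters)+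

datatype syllable = SylC | SylE

fun expand :: "(syllable \<times> int) list \<Rightarrow> letter list" where
  "expand [] = []"
| "expand ((SylC, n) # w) = Inner # GapC n # expand w"
| "expand ((SylE, n) # w) = GapE n # expand w"

text \<open>A pair \<open>(H, n)\<close> stands for the factor \<open>H u\<^sup>n\<close>.\<close>

fun admissible :: "(syllable \<times> int) list \<Rightarrow> bool" where
  "admissible [] \<longleftrightarrow> True"
| "admissible [a] \<longleftrightarrow> True"
| "admissible ((H, n) # (H', n') # w) \<longleftrightarrow> (H = H' \<or> n \<noteq> 0) \<and> admissible ((H', n') # w)"

lemma expand_inj: "expand w = expand w' \<Longrightarrow> w = w'"
proof (induction w arbitrary: w' rule: expand.induct)
  case 1
  then show ?case by (cases w' rule: expand.cases) auto
next
  case (2 n w)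
  then show ?case by (cases w' rule: expand.cases) auto
next
  case (3 n w)
  then show ?case by (cases w' rule: expand.cases) auto
qed

context quantum_extension
begin

abbreviation U where "U \<equiv> emb u"
abbreviation A where "A \<equiv> emb koebe"
abbreviation C where "C \<equiv> A * x * inverse (1 - x) * inverse (1 - x) * A"
abbreviation E where "E \<equiv> A * inverse (pol Quad) * A"

fun syl :: "syllable \<Rightarrow> 'd" where
  "syl SylC = C"
| "syl SylE = E"

fun syllables :: "(syllable \<times> int) list \<Rightarrow> 'd" where
  "syllables [] = 1"
| "syllables ((H, n) # w) = syl H * U powi n * syllables w"

lemma path_expand: "admissible w \<Longrightarrow> quiver.path (expand w)"
proof (induction w rule: admissible.induct)
  case (2 a)
  then show ?case by (cases a; cases "fst a") auto
next
  case (3 H n H' n' w)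
  then show ?case by (cases H; cases H') auto
qed simp

text \<open>The factors \<open>A\<close> on both sides of a power of \<open>u\<close> form the gap; the last one is supplied by multiplication
  with \<open>A\<close> from the right.\<close>

lemma syllables_expand: "syllables w * A = A * quiver.val (expand w)"
proof (induction w rule: expand.induct)
  case (2 n w)
  have x1: "x * inverse (1 - x) = inverse (1 - x) * x"
    using commute_inverse_left[of "1 - x" x] by (simp add: algebra_simps)
  have "syllables ((SylC, n) # w) * A = A * (x * inverse (1 - x)) * inverse (1 - x) * (A * U powi n * A) * quiver.val (expand w)"
    using 2 by (simp add: mult.assoc)
  also have "\<dots> = A * (inverse (1 - x) * x) * inverse (1 - x) * (A * U powi n * A) * quiver.val (expand w)"
    by (simp only: x1)
  also have "A * U powi n * A = emb (s * u powi n)"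
    by (simp add: power2_eq_square mult_ac flip: emb_simps(3,13))
  finally show ?case
    by (simp only: mult.assoc expand.simps quiver.val.simps letter_pole.simps coef.simps pol.simps)
next
  case (3 n w)
  have "syllables ((SylE, n) # w) * A = A * inverse (pol Quad) * (A * U powi n * A) * quiver.val (expand w)"
    using 3 by (simp add: mult.assoc)
  also have "A * U powi n * A = emb (s * u powi n)"
    by (simp add: power2_eq_square mult_ac flip: emb_simps(3,13))
  finally show ?case by (simp add: mult.assoc)
qed simp

text \<open>The coefficient of a path collects the possible initial powers of \<open>u\<close>. It lies in \<open>K(y)\<close> and therefore is
  reduced.\<close>

theorem normal_forms_independent:
  assumes W: "finite W" "\<And>n w. (n, w) \<in> W \<Longrightarrow> admissible w \<and> \<sigma> (\<kappa> (n, w)) = \<kappa> (n, w)"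
    and rel: "(\<Sum>(n, w)\<in>W. emb (\<kappa> (n, w)) * U powi n * syllables w) = 0"
    and nw: "(n, w) \<in> W"
  shows "\<kappa> (n, w) = 0"
proof -
  define V where "V = (\<lambda>nw. expand (snd nw)) ` W"
  define fib where "fib v = {nw \<in> W. expand (snd nw) = v}" for v
  define f where "f v = (\<Sum>nw\<in>fib v. \<kappa> nw * u powi (fst nw) * koebe)" for v
  have fin: "finite V" "finite (fib v)" for v using W by (simp_all add: V_def fib_def)
  have "(\<Sum>v\<in>V. emb (f v) * quiver.val v) =
      (\<Sum>v\<in>V. \<Sum>nw\<in>fib v. emb (\<kappa> nw) * U powi (fst nw) * syllables (snd nw) * A)"
  proof (rule sum.cong)
    fix v
    have "emb (f v) * quiver.val v = (\<Sum>nw\<in>fib v. emb (\<kappa> nw) * U powi (fst nw) * (A * quiver.val v))"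
      unfolding f_def by (simp add: emb_simps(8,3,13) sum_distrib_right mult.assoc)
    also have "\<dots> = (\<Sum>nw\<in>fib v. emb (\<kappa> nw) * U powi (fst nw) * syllables (snd nw) * A)"
      by (intro sum.cong) (auto simp: fib_def mult.assoc syllables_expand)
    finally show "emb (f v) * quiver.val v = \<dots>" .
  qed simp
  also have "\<dots> = (\<Sum>nw\<in>W. emb (\<kappa> nw) * U powi (fst nw) * syllables (snd nw) * A)"
    unfolding fib_def using W(1) fin(1) by (intro sum.group) (auto simp: V_def)
  also have "\<dots> = (\<Sum>(n, w)\<in>W. emb (\<kappa> (n, w)) * U powi n * syllables w) * A"
    by (simp add: sum_distrib_right case_prod_unfold)
  finally have "(\<Sum>v\<in>V. emb (f v) * quiver.val v) = 0" using rel by simp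
  moreover have "quiver.path v \<and> emb (f v) \<in> R" if "v \<in> V" for v
    using that W(2) R_emb by (fastforce simp: V_def intro: path_expand)
  moreover have "emb g = 0" if "emb g \<in> LM t" for g t
    using that LM_Lin_emb[of g] LM_Quad_emb(1)[of g 0] by (cases t) (auto simp: emb_simps)
  ultimately have "emb (f v) = 0" if "v \<in> V" for v
    using quiver.paths_independent[OF fin(1), of "\<lambda>v. emb (f v)"] that by blast
  then have f0: "f (expand w) = 0" using nw by (force simp: V_def emb_simps)
  define N where "N = {n. (n, w) \<in> W}"
  have fib: "fib (expand w) = (\<lambda>n. (n, w)) ` N"
    by (auto simp: fib_def N_def dest: expand_inj)
  have finN: "finite N"
    using finite_vimageI[OF W(1), of "\<lambda>n. (n, w)"] by (auto simp: N_def inj_def vimage_def)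
  have "f (expand w) = koebe * (\<Sum>n\<in>N. \<kappa> (n, w) * u powi n)"
    unfolding f_def fib by (subst sum.reindex) (auto simp: inj_on_def sum_distrib_left mult_ac)
  then have "(\<Sum>n\<in>N. \<kappa> (n, w) * u powi n) = 0"
    using f0 by (simp add: koebe_def)
  from independent_u_powers[OF finN this] show ?thesis
    using W(2) nw by (auto simp: N_def)
qed

end

section \<open>Normal forms in the group algebra of the free group\<close>

lemma poly_mapping_eq_sum_single:
  "a = (\<Sum>g\<in>Poly_Mapping.keys a. Poly_Mapping.single g (Poly_Mapping.lookup a g))"
  by (rule poly_mapping_eqI) (simp add: lookup_sum lookup_single when_def not_in_keys_iff_lookup_eq_zero)

definition group_algebra_hom :: "('k::field \<Rightarrow> 'd::ring_1) \<Rightarrow> ('g::group_add \<Rightarrow> 'd) \<Rightarrow> ('g \<Rightarrow>\<^sub>0 'k) \<Rightarrow> 'd" where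
  "group_algebra_hom \<eta> \<chi> a = (\<Sum>g\<in>Poly_Mapping.keys a. \<eta> (Poly_Mapping.lookup a g) * \<chi> g)"

lemma group_algebra_hom_eq_sum:
  assumes "unital_ring_hom \<eta>" "finite S" "Poly_Mapping.keys a \<subseteq> S"
  shows "group_algebra_hom \<eta> \<chi> a = (\<Sum>g\<in>S. \<eta> (Poly_Mapping.lookup a g) * \<chi> g)"
  unfolding group_algebra_hom_def using assms
  by (intro sum.mono_neutral_left) (auto simp: unital_ring_homD not_in_keys_iff_lookup_eq_zero)

lemma group_algebra_hom_single:
  assumes "unital_ring_hom \<eta>"
  shows "group_algebra_hom \<eta> \<chi> (Poly_Mapping.single g c) = \<eta> c * \<chi> g"
  using group_algebra_hom_eq_sum[OF assms, of "{g}"] by simp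

lemma group_algebra_hom_add:
  assumes \<eta>: "unital_ring_hom \<eta>"
  shows "group_algebra_hom \<eta> \<chi> (a + b) = group_algebra_hom \<eta> \<chi> a + group_algebra_hom \<eta> \<chi> b"
proof -
  let ?S = "Poly_Mapping.keys a \<union> Poly_Mapping.keys b"
  have "group_algebra_hom \<eta> \<chi> (a + b) = (\<Sum>g\<in>?S. \<eta> (Poly_Mapping.lookup (a + b) g) * \<chi> g)"
    by (rule group_algebra_hom_eq_sum[OF \<eta>]) (simp_all add: Poly_Mapping.keys_add)
  then show ?thesis
    by (simp add: group_algebra_hom_eq_sum[OF \<eta>, of ?S] lookup_add unital_ring_homD[OF \<eta>] distrib_right sum.distrib)
qed

lemma group_algebra_hom_sum:
  assumes \<eta>: "unital_ring_hom \<eta>"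
  shows "group_algebra_hom \<eta> \<chi> (sum f S) = (\<Sum>i\<in>S. group_algebra_hom \<eta> \<chi> (f i))"
proof -
  have "group_algebra_hom \<eta> \<chi> 0 = 0" by (simp add: group_algebra_hom_def)
  then show ?thesis
    by (induction S rule: infinite_finite_induct) (simp_all add: group_algebra_hom_add[OF \<eta>])
qed

lemma unital_ring_hom_group_algebra_hom:
  assumes \<eta>: "unital_ring_hom \<eta>" and \<chi>: "\<chi> 0 = 1" "\<And>g h. \<chi> (g + h) = \<chi> g * \<chi> h"
    and comm: "\<And>c g. \<eta> c * \<chi> g = \<chi> g * \<eta> c"
  shows "unital_ring_hom (group_algebra_hom \<eta> \<chi>)"
proof -
  let ?\<phi> = "group_algebra_hom \<eta> \<chi>"
  note single = group_algebra_hom_single[OF \<eta>, of \<chi>] and sum = group_algebra_hom_sum[OF \<eta>, of \<chi>]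
  have "?\<phi> (a * b) = ?\<phi> a * ?\<phi> b" for a b
  proof -
    let ?a = "\<lambda>g. Poly_Mapping.single g (Poly_Mapping.lookup a g)"
    let ?b = "\<lambda>g. Poly_Mapping.single g (Poly_Mapping.lookup b g)"
    have mono: "?\<phi> (?a g * ?b h) = ?\<phi> (?a g) * ?\<phi> (?b h)" for g h
    proof -
      have "\<eta> (Poly_Mapping.lookup b h) * \<chi> g = \<chi> g * \<eta> (Poly_Mapping.lookup b h)" by (rule comm)
      then show ?thesis
        by (simp add: mult_single single \<chi>(2) unital_ring_homD(3)[OF \<eta>] mult.assoc)
          (simp flip: mult.assoc)
    qed
    have "?\<phi> (a * b) = ?\<phi> ((\<Sum>g\<in>Poly_Mapping.keys a. ?a g) * (\<Sum>h\<in>Poly_Mapping.keys b. ?b h))"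
      by (simp flip: poly_mapping_eq_sum_single)
    also have "\<dots> = ?\<phi> (\<Sum>g\<in>Poly_Mapping.keys a. ?a g) * ?\<phi> (\<Sum>h\<in>Poly_Mapping.keys b. ?b h)"
      unfolding sum_product sum by (simp add: mono)
    finally show ?thesis by (simp flip: poly_mapping_eq_sum_single)
  qed
  moreover have "?\<phi> 1 = 1"
    using single[of 0 1] by (simp add: unital_ring_homD(1)[OF \<eta>] \<chi>(1))
  ultimately show ?thesis
    by (simp add: unital_ring_hom_def group_algebra_hom_add[OF \<eta>])
qed

lemma single_0_central:
  fixes a :: "'g::group_add \<Rightarrow>\<^sub>0 'k::field"
  shows "Poly_Mapping.single 0 c * a = a * Poly_Mapping.single 0 c"
proof -
  have "Poly_Mapping.single 0 c * (\<Sum>g\<in>Poly_Mapping.keys a. Poly_Mapping.single g (Poly_Mapping.lookup a g)) =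
      (\<Sum>g\<in>Poly_Mapping.keys a. Poly_Mapping.single g (Poly_Mapping.lookup a g)) * Poly_Mapping.single 0 c"
    by (simp add: sum_distrib_left sum_distrib_right mult_single mult.commute)
  then show ?thesis by (simp flip: poly_mapping_eq_sum_single)
qed

definition letter_value :: "'d::division_ring \<Rightarrow> 'd \<Rightarrow> gen \<times> bool \<Rightarrow> 'd" where
  "letter_value u v l = (let b = (case fst l of GenX \<Rightarrow> u | GenY \<Rightarrow> v) in if snd l then inverse b else b)"

fun word_value :: "'d::division_ring \<Rightarrow> 'd \<Rightarrow> word \<Rightarrow> 'd" where
  "word_value u v [] = 1"
| "word_value u v (l # w) = letter_value u v l * word_value u v w"

lemma word_value_append: "word_value u v (w @ w') = word_value u v w * word_value u v w'"
  by (induction w) (simp_all add: mult.assoc)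

lemma word_value_pres_eq:
  assumes "pres_eq {} w w'" "u \<noteq> 0" "v \<noteq> 0"
  shows "word_value u v w = word_value u v w'"
  using assms
proof (induction rule: pres_eq.induct)
  case (cancel w g e w')
  then have "letter_value u v (g, e) * letter_value u v (g, \<not> e) = 1"
    by (cases g; cases e) (simp_all add: letter_value_def)
  then show ?case by (simp add: word_value_append flip: mult.assoc)
qed simp_all

definition free2_hom :: "'d::division_ring \<Rightarrow> 'd \<Rightarrow> free2 \<Rightarrow> 'd" where
  "free2_hom u v g = word_value u v (rep_free2 g)"

lemma free2_hom_abs:
  assumes "u \<noteq> 0" "v \<noteq> 0"
  shows "free2_hom u v (abs_free2 w) = word_value u v w"
proof -
  have "pres_eq {} (rep_free2 (abs_free2 w)) w"
    using Quotient_rep_abs[OF Quotient_free2] by (simp add: pres_eq.refl)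
  then show ?thesis unfolding free2_hom_def by (rule word_value_pres_eq[OF _ assms])
qed

lemma abs_rep_free2: "abs_free2 (rep_free2 g) = g"
  by (rule Quotient_abs_rep[OF Quotient_free2])

lemma free2_hom:
  assumes "u \<noteq> 0" "v \<noteq> 0"
  shows "free2_hom u v 0 = 1" "free2_hom u v (g + h) = free2_hom u v g * free2_hom u v h"
    "free2_hom u v free_x = u" "free2_hom u v free_y = v"
proof -
  show "free2_hom u v 0 = 1"
    by (simp add: zero_free2.abs_eq free2_hom_abs assms)
  have "abs_free2 (rep_free2 g) + abs_free2 (rep_free2 h) = abs_free2 (rep_free2 g @ rep_free2 h)"
    by (rule plus_free2.abs_eq)
  then show "free2_hom u v (g + h) = free2_hom u v g * free2_hom u v h"
    by (simp add: abs_rep_free2 free2_hom_abs assms word_value_append) (simp add: free2_hom_def)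
  show "free2_hom u v free_x = u" "free2_hom u v free_y = v"
    by (simp_all add: free_x.abs_eq free_y.abs_eq free2_hom_abs assms letter_value_def)
qed

lemma free2_induct [case_names zero step]:
  assumes "P 0" "\<And>g h. g \<in> {free_x, - free_x, free_y, - free_y} \<Longrightarrow> P h \<Longrightarrow> P (g + h)"
  shows "P g"
proof -
  have "P (abs_free2 w)" for w
  proof (induction w)
    case Nil
    then show ?case using assms(1) by (simp add: zero_free2.abs_eq)
  next
    case (Cons l w)
    obtain b e where l: "l = (b, e)" by (cases l)
    have "abs_free2 [l] \<in> {free_x, - free_x, free_y, - free_y}"
      unfolding l by (cases b; cases e)
        (simp_all add: free_x.abs_eq free_y.abs_eq uminus_free2.abs_eq winv_def)
    moreover have "abs_free2 (l # w) = abs_free2 [l] + abs_free2 w"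
      by (simp add: plus_free2.abs_eq)
    ultimately show ?case using assms(2) Cons by simp
  qed
  then show ?thesis using abs_rep_free2 by metis
qed

type_synonym 'k fga = "free2 \<Rightarrow>\<^sub>0 'k"

abbreviation (input) mon :: "'g \<Rightarrow> 'g \<Rightarrow>\<^sub>0 'k::field" where "mon g \<equiv> Poly_Mapping.single g 1"

abbreviation (input) scal :: "'k::field \<Rightarrow> 'k fga" where "scal c \<equiv> Poly_Mapping.single 0 c"

text \<open>Integer powers are spelled out because the group algebra is not a division ring.\<close>

definition x_power :: "int \<Rightarrow> 'k::field fga" where
  "x_power n = (if n \<ge> 0 then mon free_x ^ nat n else mon (- free_x) ^ nat (- n))"

fun syllable_element :: "syllable \<Rightarrow> 'k::field fga" where
  "syllable_element SylC = mon free_y - 1"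
| "syllable_element SylE = 1 - mon (- free_y)"

fun syllable_product :: "(syllable \<times> int) list \<Rightarrow> 'k::field fga" where
  "syllable_product [] = 1"
| "syllable_product ((H, n) # w) = syllable_element H * x_power n * syllable_product w"

definition normal_form :: "int \<times> (syllable \<times> int) list \<Rightarrow> 'k::field fga" where
  "normal_form \<alpha> = x_power (fst \<alpha>) * syllable_product (snd \<alpha>)"

definition normal_span :: "'k::field fga set" where
  "normal_span = {a. \<exists>W c. finite W \<and> (\<forall>\<alpha>\<in>W. admissible (snd \<alpha>)) \<and> a = (\<Sum>\<alpha>\<in>W. scal (c \<alpha>) * normal_form \<alpha>)}"

lemma mon_mult [simp]: "mon g * mon h = mon (g + h)"
  by (simp add: mult_single)

lemma x_power_shift:
  shows "mon free_x * x_power n = (x_power (n + 1) :: 'k::field fga)"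
    and "mon (- free_x) * x_power n = (x_power (n - 1) :: 'k fga)"
proof -
  have inv: "mon free_x * (mon (- free_x) * a) = a" "mon (- free_x) * (mon free_x * a) = a" for a :: "'k fga"
    by (simp_all flip: mult.assoc)
  have n: "nat (n + 1) = Suc (nat n)" if "n \<ge> 0" for n using that by simp
  show "mon free_x * x_power n = (x_power (n + 1) :: 'k fga)"
  proof (cases "n \<ge> 0")
    case False
    then have "nat (- n) = Suc (nat (- n - 1))" by simp
    then show ?thesis using False by (auto simp: x_power_def inv)
  qed (simp add: x_power_def n)
  show "mon (- free_x) * x_power n = (x_power (n - 1) :: 'k fga)"
  proof (cases "n > 0")
    case True
    then have "nat n = Suc (nat (n - 1))" by simp
    then show ?thesis using True by (auto simp: x_power_def inv)
  next
    case False
    then have "nat (- (n - 1)) = Suc (nat (- n))" by simp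
    then show ?thesis using False by (auto simp: x_power_def)
  qed
qed

lemma x_power_0 [simp]: "x_power 0 = 1"
  by (simp add: x_power_def)

lemma normal_span_add: "a \<in> normal_span \<Longrightarrow> b \<in> normal_span \<Longrightarrow> a + b \<in> normal_span"
proof -
  assume "a \<in> normal_span" "b \<in> normal_span"
  then obtain W c W' c' where W: "finite W" "\<forall>\<alpha>\<in>W. admissible (snd \<alpha>)" "a = (\<Sum>\<alpha>\<in>W. scal (c \<alpha>) * normal_form \<alpha>)"
    "finite W'" "\<forall>\<alpha>\<in>W'. admissible (snd \<alpha>)" "b = (\<Sum>\<alpha>\<in>W'. scal (c' \<alpha>) * normal_form \<alpha>)"
    unfolding normal_span_def by blast
  let ?e = "\<lambda>\<alpha>. (if \<alpha> \<in> W then c \<alpha> else 0) + (if \<alpha> \<in> W' then c' \<alpha> else 0)"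
  have "a = (\<Sum>\<alpha>\<in>W \<union> W'. scal (if \<alpha> \<in> W then c \<alpha> else 0) * normal_form \<alpha>)"
    unfolding W(3) using W by (intro sum.mono_neutral_cong_left) auto
  moreover have "b = (\<Sum>\<alpha>\<in>W \<union> W'. scal (if \<alpha> \<in> W' then c' \<alpha> else 0) * normal_form \<alpha>)"
    unfolding W(6) using W by (intro sum.mono_neutral_cong_left) auto
  ultimately have "a + b = (\<Sum>\<alpha>\<in>W \<union> W'. scal (?e \<alpha>) * normal_form \<alpha>)"
    by (simp add: single_add distrib_right flip: sum.distrib)
  then show ?thesis unfolding normal_span_def using W
    by (intro CollectI exI[of _ "W \<union> W'"] exI[of _ ?e]) auto
qed

lemma normal_span_scal: "a \<in> normal_span \<Longrightarrow> scal c * a \<in> normal_span"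
proof -
  assume "a \<in> normal_span"
  then obtain W e where W: "finite W" "\<forall>\<alpha>\<in>W. admissible (snd \<alpha>)" "a = (\<Sum>\<alpha>\<in>W. scal (e \<alpha>) * normal_form \<alpha>)"
    unfolding normal_span_def by blast
  have "scal c * (scal d * b) = scal (c * d) * b" for d b
    by (simp add: mult_single flip: mult.assoc)
  then have "scal c * a = (\<Sum>\<alpha>\<in>W. scal (c * e \<alpha>) * normal_form \<alpha>)"
    unfolding W(3) sum_distrib_left by simp
  then show ?thesis unfolding normal_span_def using W(1,2)
    by (intro CollectI exI[of _ W] exI[of _ "\<lambda>\<alpha>. c * e \<alpha>"]) simp
qed

lemma normal_span_diff: "a \<in> normal_span \<Longrightarrow> b \<in> normal_span \<Longrightarrow> a - b \<in> normal_span"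
  using normal_span_add[of a "scal (-1) * b"] normal_span_scal[of b "-1"] by (simp add: single_uminus)

lemma normal_form_span: "admissible (snd \<alpha>) \<Longrightarrow> normal_form \<alpha> \<in> normal_span"
  unfolding normal_span_def
  by (intro CollectI exI[of _ "{\<alpha>}"] exI[of _ "\<lambda>_. 1"]) simp

lemma normal_span_left_mult:
  assumes "a \<in> normal_span" "\<And>\<alpha>. admissible (snd \<alpha>) \<Longrightarrow> t * normal_form \<alpha> \<in> normal_span"
  shows "t * a \<in> normal_span"
proof -
  obtain W c where W: "finite W" "\<forall>\<alpha>\<in>W. admissible (snd \<alpha>)" "a = (\<Sum>\<alpha>\<in>W. scal (c \<alpha>) * normal_form \<alpha>)"
    using assms(1) unfolding normal_span_def by blast
  have "t * (scal e * b) = scal e * (t * b)" for e b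
    using single_0_central[of e t] by (simp flip: mult.assoc)
  then have "t * a = (\<Sum>\<alpha>\<in>W. scal (c \<alpha>) * (t * normal_form \<alpha>))"
    by (simp add: W(3) sum_distrib_left)
  also have "\<dots> \<in> normal_span"
    using W(1,2)
  proof (induction W rule: finite_induct)
    case empty
    show ?case using normal_span_scal[OF normal_form_span[of "(0, [])"], of 0] by simp
  qed (auto intro: normal_span_add normal_span_scal assms(2))
  finally show ?thesis .
qed

lemma syllable_elements_mult:
  "syllable_element SylC * syllable_element SylE = (syllable_element SylC - syllable_element SylE :: 'k::field fga)"
  "syllable_element SylE * syllable_element SylC = (syllable_element SylC - syllable_element SylE :: 'k::field fga)"
  by (simp_all add: algebra_simps)

text \<open>A forbidden succession is replaced by \<open>C E = E C = C - E\<close>. One of the two resulting terms is the normal form with the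
  first factor dropped, the other is shorter.\<close>

lemma syllable_normal_form_span:
  "admissible w \<Longrightarrow> syllable_element H * normal_form (n, w) \<in> (normal_span :: 'k::field fga set)"
proof (induction w arbitrary: n H)
  case Nil
  show ?case using normal_form_span[of "(0, [(H, n)])"] by (simp add: normal_form_def mult.assoc)
next
  case (Cons a w)
  obtain H' n' where a: "a = (H', n')" by (cases a)
  have w: "admissible w" using Cons.prems unfolding a by (cases w) auto
  show ?case
  proof (cases "H = H' \<or> n \<noteq> 0")
    case True
    then have "admissible ((H, n) # a # w)" using Cons.prems by (simp add: a)
    then show ?thesis
      using normal_form_span[of "(0, (H, n) # a # w)"] by (simp add: normal_form_def mult.assoc)
  next
    case False
    then have "syllable_element H * normal_form (n, a # w) =
        (syllable_element H * syllable_element H') * (normal_form (n', w) :: 'k fga)"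
      by (simp add: a normal_form_def mult.assoc)
    also have "syllable_element H * syllable_element H' = (syllable_element SylC - syllable_element SylE :: 'k fga)"
      using False by (cases H; cases H') (simp_all only: syllable_elements_mult simp_thms syllable.distinct)
    also have "(syllable_element SylC - syllable_element SylE) * (normal_form (n', w) :: 'k fga) =
        syllable_element SylC * normal_form (n', w) - syllable_element SylE * normal_form (n', w)"
      by (rule left_diff_distrib)
    also have "\<dots> \<in> normal_span"
      by (intro normal_span_diff Cons.IH w)
    finally show ?thesis .
  qed
qed

text \<open>The span contains 1 and is stable under left multiplication with the generators and their inverses,
  since \<open>v = 1 + C\<close> and \<open>v\<^sup>-\<^sup>1 = 1 - E\<close>.\<close>

theorem normal_span_UNIV: "(a :: 'k::field fga) \<in> normal_span"
proof -
  have mon: "mon g \<in> (normal_span :: 'k fga set)" for g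
  proof (induction g rule: free2_induct)
    case zero
    show ?case using normal_form_span[of "(0, [])"] by (simp add: normal_form_def)
  next
    case (step g h)
    have "mon g * normal_form \<alpha> \<in> (normal_span :: 'k fga set)" if \<alpha>: "admissible (snd \<alpha>)" for \<alpha>
    proof -
      obtain n w where nw: "\<alpha> = (n, w)" by (cases \<alpha>)
      have x: "mon free_x * normal_form (n, w) = (normal_form (n + 1, w) :: 'k fga)"
        "mon (- free_x) * normal_form (n, w) = (normal_form (n - 1, w) :: 'k fga)"
        by (simp_all only: normal_form_def fst_conv snd_conv x_power_shift flip: mult.assoc)
      have y: "mon free_y * normal_form (n, w) = syllable_element SylC * normal_form (n, w) + (normal_form (n, w) :: 'k fga)"
        "mon (- free_y) * normal_form (n, w) = (normal_form (n, w) :: 'k fga) - syllable_element SylE * normal_form (n, w)"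
        by (simp_all add: left_diff_distrib)
      have adm: "admissible w" using \<alpha> by (simp add: nw)
      have "normal_form (k, w) \<in> (normal_span :: 'k fga set)" for k
        by (rule normal_form_span) (simp add: adm)
      moreover have "mon free_y * normal_form (n, w) \<in> (normal_span :: 'k fga set)"
        unfolding y by (intro normal_span_add syllable_normal_form_span calculation adm)
      moreover have "mon (- free_y) * normal_form (n, w) \<in> (normal_span :: 'k fga set)"
        unfolding y by (intro normal_span_diff syllable_normal_form_span calculation(1) adm)
      ultimately show ?thesis
        using step(1) unfolding nw by (auto simp: x)
    qed
    from normal_span_left_mult[OF step(2) this] show ?case by simp
  qed
  have "Poly_Mapping.single g c \<in> (normal_span :: 'k fga set)" for g c
    using normal_span_scal[OF mon[of g], of c] by (simp add: mult_single)
  then have "sum (\<lambda>g. Poly_Mapping.single g (Poly_Mapping.lookup a g)) S \<in> normal_span" for S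
    using normal_span_scal[OF mon[of 0], of 0]
    by (induction S rule: infinite_finite_induct) (simp_all add: normal_span_add)
  then show ?thesis by (subst poly_mapping_eq_sum_single)
qed

section \<open>The symmetric pair in the division ring\<close>

context quantum_extension
begin

abbreviation V where "V \<equiv> 1 + C"

text \<open>With \<open>Q\<close> the inverse of \<open>B\<close> and \<open>P = Q + A\<^sup>2\<close>, the resolvent identity \<open>B A\<^sup>2 P\<^sup>-\<^sup>1 = B - P\<^sup>-\<^sup>1\<close> gives
  \<open>C E = C - E\<close>.\<close>

lemma inverse_V: "V \<noteq> 0" "inverse V = 1 - E"
proof -
  let ?T = "inverse (1 - x)" and ?P = "pol Quad"
  let ?B = "x * ?T * ?T"
  have nz: "1 - x \<noteq> 0" "?P \<noteq> 0" using pol_nz[of Lin] pol_nz[of Quad] by (simp_all add: pol.simps)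
  have xT: "x * ?T = ?T * x"
    using commute_inverse_left[of "1 - x" x] by (simp add: algebra_simps)
  have BQ: "?B * (?P - emb s) = 1"
  proof -
    have "?P - emb s = x - 2 + inverse x"
      by (simp add: pol.simps emb_simps(6,9))
    also have "\<dots> = (1 - x) * (1 - x) * inverse x"
      using x_nz by (simp add: algebra_simps)
    finally have Q: "?P - emb s = (1 - x) * (1 - x) * inverse x" .
    have "?B * (?P - emb s) = x * ?T * (?T * (1 - x)) * (1 - x) * inverse x"
      unfolding Q by (simp only: mult.assoc)
    also have "\<dots> = x * (?T * (1 - x)) * inverse x"
      using nz by (simp add: mult.assoc)
    finally show ?thesis using nz x_nz by simp
  qed
  have As: "A * A = emb s" by (simp add: power2_eq_square flip: emb_simps(3))
  have "?B * emb s * inverse ?P = ?B - inverse ?P"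
  proof -
    have "?B * emb s = ?B * ?P - 1" using BQ by (simp add: right_diff_distrib algebra_simps)
    then have "?B * emb s * inverse ?P = ?B * (?P * inverse ?P) - inverse ?P"
      by (simp add: left_diff_distrib mult.assoc)
    then show ?thesis using nz by simp
  qed
  then have "A * (?B * (A * A) * inverse ?P) * A = A * (?B - inverse ?P) * A"
    by (simp only: As)
  then have "C * E = C - E"
    by (simp add: mult.assoc left_diff_distrib right_diff_distrib)
  then have "V * (1 - E) = 1" by (simp add: algebra_simps)
  then show "V \<noteq> 0" "inverse V = 1 - E" by (auto intro: inverse_unique)
qed

text \<open>An element of the kernel is a combination of normal forms, and its coefficients vanish because the images of the
  normal forms are independent.\<close>

theorem free_group_algebra:
  fixes \<eta> :: "'k::field \<Rightarrow> 'd"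
  assumes \<eta>: "unital_ring_hom \<eta>" "\<And>c. \<exists>e. \<eta> c = emb e \<and> \<sigma> e = e"
  shows "freely_generate_group_algebra \<eta> U V"
proof -
  have U: "U \<noteq> 0" using u_nz by (simp only: emb_simps(10) not_False_eq_True)
  note nz = U inverse_V(1)
  obtain e where e: "\<And>c. \<eta> c = emb (e c)" "\<And>c. \<sigma> (e c) = e c" using \<eta>(2) by metis
  let ?\<chi> = "free2_hom U V"
  note \<chi> = free2_hom[OF nz]
  have \<eta>x: "\<eta> c * x = x * \<eta> c" for c by (simp add: e(1) x_emb e(2))
  have \<eta>emb: "\<eta> c * emb f = emb f * \<eta> c" for c f unfolding e(1) by (rule emb_simps)
  have cent: "\<eta> c * (a * b) = a * b * \<eta> c" if "\<eta> c * a = a * \<eta> c" "\<eta> c * b = b * \<eta> c" for c a b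
    using that by (metis mult.assoc)
  have inv: "\<eta> c * inverse a = inverse a * \<eta> c" if "\<eta> c * a = a * \<eta> c" for c a
    using commute_inverse_left[of a "\<eta> c"] that by simp
  have \<eta>T: "\<eta> c * (1 - x) = (1 - x) * \<eta> c" for c by (simp add: algebra_simps \<eta>x)
  have \<eta>C: "\<eta> c * C = C * \<eta> c" for c
    by (intro cent inv \<eta>x \<eta>emb \<eta>T)
  have \<eta>V: "\<eta> c * V = V * \<eta> c" for c by (simp only: distrib_left distrib_right \<eta>C) simp
  have comm: "\<eta> c * ?\<chi> g = ?\<chi> g * \<eta> c" for c g
  proof -
    have "\<eta> c * word_value U V w = word_value U V w * \<eta> c" for w
    proof (induction w)
      case (Cons l w)
      have "\<eta> c * letter_value U V l = letter_value U V l * \<eta> c"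
        unfolding letter_value_def Let_def by (simp add: \<eta>emb \<eta>V inv split: gen.split)
      then show ?case unfolding word_value.simps by (rule cent[OF _ Cons.IH])
    qed simp
    then show ?thesis by (simp add: free2_hom_def)
  qed
  define \<phi> where "\<phi> = group_algebra_hom \<eta> ?\<chi>"
  have \<phi>: "unital_ring_hom \<phi>"
    unfolding \<phi>_def by (rule unital_ring_hom_group_algebra_hom[OF \<eta>(1) \<chi>(1,2) comm])
  note h = unital_ring_homD[OF \<phi>]
  have single: "\<phi> (Poly_Mapping.single g c) = \<eta> c * ?\<chi> g" for g c
    unfolding \<phi>_def by (rule group_algebra_hom_single[OF \<eta>(1)])
  have \<eta>1: "\<eta> 1 = 1" using \<eta>(1) by (simp add: unital_ring_homD)
  have \<chi>inv: "?\<chi> (- g) = inverse (?\<chi> g)" for g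
    using \<chi>(1) \<chi>(2)[of g "- g"] by (simp add: inverse_unique)
  have \<phi>x: "\<phi> (x_power n) = U powi n" for n
    by (simp add: x_power_def h single \<eta>1 \<chi> \<chi>inv power_int_def)
  have \<phi>s: "\<phi> (syllable_element H) = syl H" for H
    by (cases H) (simp_all add: h single \<eta>1 \<chi> \<chi>inv inverse_V)
  have \<phi>w: "\<phi> (syllable_product w) = syllables w" for w
    by (induction w rule: syllable_product.induct) (simp_all add: h \<phi>x \<phi>s del: syllable_element.simps syl.simps)
  have \<phi>n: "\<phi> (normal_form (n, w)) = U powi n * syllables w" for n w
    by (simp add: normal_form_def h \<phi>x \<phi>w)
  have "a = 0" if "\<phi> a = 0" for a
  proof -
    obtain W c where W: "finite W" "\<forall>\<alpha>\<in>W. admissible (snd \<alpha>)" "a = (\<Sum>\<alpha>\<in>W. scal (c \<alpha>) * normal_form \<alpha>)"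
      using normal_span_UNIV[of a] unfolding normal_span_def by blast
    have "\<phi> a = (\<Sum>\<alpha>\<in>W. \<eta> (c \<alpha>) * \<phi> (normal_form \<alpha>))"
      unfolding W(3) h(8) h(3) single by (simp add: \<chi>)
    also have "\<dots> = (\<Sum>(n, w)\<in>W. emb (e (c (n, w))) * U powi n * syllables w)"
      by (intro sum.cong) (auto simp: \<phi>n e(1) mult.assoc)
    finally have rel: "(\<Sum>(n, w)\<in>W. emb (e (c (n, w))) * U powi n * syllables w) = 0"
      using that by simp
    have "e (c (n, w)) = 0" if "(n, w) \<in> W" for n w
    proof (rule normal_forms_independent[OF W(1) _ rel that])
      show "admissible w \<and> \<sigma> (e (c (n, w))) = e (c (n, w))" if "(n, w) \<in> W" for n w
        using bspec[OF W(2) that] e(2) by simp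
    qed
    then have "\<eta> (c \<alpha>) = 0" if "\<alpha> \<in> W" for \<alpha>
      using that by (cases \<alpha>) (simp add: e(1) emb_simps)
    then have "c \<alpha> = 0" if "\<alpha> \<in> W" for \<alpha>
      using that by (simp add: unital_ring_hom_field(1)[OF \<eta>(1)])
    then show ?thesis by (simp add: W(3))
  qed
  then have "inj \<phi>"
    by (intro injI) (metis eq_iff_diff_eq_0 h(6))
  moreover have "free_group_algebra_hom \<eta> U V \<phi>"
    using \<phi> by (simp add: free_group_algebra_hom_def h single \<chi> \<eta>1)
  ultimately show ?thesis unfolding freely_generate_group_algebra_def by blast
qed

end

text \<open>Triples stand for upper unitriangular integer matrices of size 3. They detect that the commutator has infinite
  order.\<close>

type_synonym heis = "int \<times> int \<times> int"

fun heis_mult :: "heis \<Rightarrow> heis \<Rightarrow> heis" where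
  "heis_mult (a, b, c) (a', b', c') = (a + a', b + b', c + c' + a * b')"

definition heis_letter :: "gen \<times> bool \<Rightarrow> heis" where
  "heis_letter l = (let k = (if snd l then -1 else 1) in case fst l of GenX \<Rightarrow> (k, 0, 0) | GenY \<Rightarrow> (0, k, 0))"

fun heis_word :: "word \<Rightarrow> heis" where
  "heis_word [] = (0, 0, 0)"
| "heis_word (l # w) = heis_mult (heis_letter l) (heis_word w)"

lemma heis_mult_assoc: "heis_mult (heis_mult g h) k = heis_mult g (heis_mult h k)"
  by (cases g; cases h; cases k) (simp add: algebra_simps)

lemma heis_mult_0 [simp]: "heis_mult (0, 0, 0) g = g" "heis_mult g (0, 0, 0) = g"
  by (cases g; simp)+

lemma heis_word_append: "heis_word (u @ v) = heis_mult (heis_word u) (heis_word v)"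
  by (induction u) (simp_all add: heis_mult_assoc)

lemma heis_word_pres_eq:
  assumes "pres_eq nil2_relators u v"
  shows "heis_word u = heis_word v"
  using assms
proof (induction rule: pres_eq.induct)
  case (cancel u g e v)
  have "heis_mult (heis_letter (g, e)) (heis_letter (g, \<not> e)) = (0, 0, 0)"
    by (cases g; cases e) (simp_all add: heis_letter_def)
  then have "heis_word [(g, e), (g, \<not> e)] = (0, 0, 0)" by simp
  then show ?case by (simp only: heis_word_append heis_mult_0)
next
  case (relator r u v)
  have "heis_word r = (0, 0, 0)"
    using relator by (auto simp: nil2_relators_def Let_def wcomm_def winv_def heis_letter_def)
  then show ?case by (simp only: heis_word_append heis_mult_0)
qed simp_all

lemma add_eq_add_commutator:
  fixes a b :: "'g::group_add"
  shows "a + b = b + a + (- a + - b + a + b)"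
  by (simp only: add.assoc add_minus_cancel)

definition nil2_z :: nil2 where
  "nil2_z = - nil2_x + - nil2_y + nil2_x + nil2_y"

lemma nil2_x_y: "nil2_x + nil2_y = nil2_y + nil2_x + nil2_z"
  unfolding nil2_z_def by (rule add_eq_add_commutator)

lemma nil2_relator: "r \<in> nil2_relators \<Longrightarrow> abs_nil2 r = 0"
  unfolding zero_nil2.abs_eq
  using Quotient_rel_abs[OF Quotient_nil2] pres_eq.relator[of r nil2_relators "[]" "[]"]
  by simp

lemma abs_nil2_wcomm: "abs_nil2 (wcomm u v) = - abs_nil2 u + - abs_nil2 v + abs_nil2 u + abs_nil2 v"
  by (simp add: wcomm_def uminus_nil2.abs_eq plus_nil2.abs_eq)

lemma nil2_z_commute: "nil2_z + nil2_x = nil2_x + nil2_z" "nil2_z + nil2_y = nil2_y + nil2_z"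
proof -
  let ?x = "[(GenX, False)]" and ?y = "[(GenY, False)]"
  have z: "abs_nil2 (wcomm ?x ?y) = nil2_z"
    by (simp only: nil2_z_def abs_nil2_wcomm nil2_x.abs_eq nil2_y.abs_eq)
  have "abs_nil2 (wcomm (wcomm ?x ?y) ?x) = 0" "abs_nil2 (wcomm (wcomm ?x ?y) ?y) = 0"
    by (rule nil2_relator, simp add: nil2_relators_def Let_def)+
  then have "- nil2_z + - nil2_x + nil2_z + nil2_x = 0" "- nil2_z + - nil2_y + nil2_z + nil2_y = 0"
    by (simp_all only: abs_nil2_wcomm[of "wcomm ?x ?y"] z nil2_x.abs_eq nil2_y.abs_eq)
  then show "nil2_z + nil2_x = nil2_x + nil2_z" "nil2_z + nil2_y = nil2_y + nil2_z"
    using add_eq_add_commutator[of nil2_z nil2_x] add_eq_add_commutator[of nil2_z nil2_y]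
    by (simp_all only: add_0_right)
qed

fun nil2_z_multiple :: "nat \<Rightarrow> nil2" where
  "nil2_z_multiple 0 = 0"
| "nil2_z_multiple (Suc n) = nil2_z + nil2_z_multiple n"

lemma inj_nil2_z_multiple: "inj nil2_z_multiple"
proof -
  define h where "h g = heis_word (rep_nil2 g)" for g
  have abs: "h (abs_nil2 w) = heis_word w" for w
  proof -
    have "pres_eq nil2_relators (rep_nil2 (abs_nil2 w)) w"
      using Quotient_rep_abs[OF Quotient_nil2] by (simp add: pres_eq.refl)
    then show ?thesis unfolding h_def by (rule heis_word_pres_eq)
  qed
  have add: "h (g + g') = heis_mult (h g) (h g')" for g g'
  proof -
    have "abs_nil2 (rep_nil2 g) + abs_nil2 (rep_nil2 g') = abs_nil2 (rep_nil2 g @ rep_nil2 g')"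
      by (rule plus_nil2.abs_eq)
    then have "g + g' = abs_nil2 (rep_nil2 g @ rep_nil2 g')"
      by (simp add: Quotient_abs_rep[OF Quotient_nil2])
    then show ?thesis by (simp add: abs heis_word_append) (simp add: h_def)
  qed
  have "h nil2_z = heis_word (wcomm [(GenX, False)] [(GenY, False)])"
    unfolding abs[symmetric] by (simp add: nil2_z_def abs_nil2_wcomm nil2_x.abs_eq nil2_y.abs_eq)
  then have z: "h nil2_z = (0, 0, 1)"
    by (simp add: wcomm_def winv_def heis_letter_def)
  have "h (nil2_z_multiple n) = (0, 0, int n)" for n
    by (induction n) (simp_all add: add z, simp add: zero_nil2.abs_eq abs)
  then show ?thesis by (intro injI) (metis of_nat_eq_iff prod.inject)
qed

lemma mon_nil2_z_power: "mon nil2_z ^ n = (mon (nil2_z_multiple n) :: nil2 \<Rightarrow>\<^sub>0 'k::field)"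
  by (induction n) simp_all

lemma unital_ring_hom_conjugate:
  fixes y :: "'d::division_ring"
  assumes f: "unital_ring_hom f" and y: "y \<noteq> 0"
  shows "unital_ring_hom (\<lambda>a. y * f a * inverse y)"
proof -
  have "y * (a * b) * inverse y = y * a * inverse y * (y * b * inverse y)" for a b
  proof -
    have "inverse y * y = 1" using y by simp
    then have "y * a * (inverse y * y) * b * inverse y = y * (a * b) * inverse y"
      by (simp add: mult.assoc)
    then show ?thesis by (simp only: mult.assoc)
  qed
  then show ?thesis
    using y unital_ring_homD(1-3)[OF f] by (simp add: unital_ring_hom_def distrib_left distrib_right)
qed

text \<open>Conjugation by \<open>y\<close> fixes the constants and \<open>t\<close>, hence all rational functions of \<open>t\<close>.\<close>

lemma commute_ratfun_hom:
  fixes \<phi> :: "'a::field \<Rightarrow> 'd::division_ring"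
  assumes \<phi>: "unital_ring_hom \<phi>" and comm: "\<And>a. t * \<phi> a = \<phi> a * t"
    and nz: "\<And>p. p \<noteq> 0 \<Longrightarrow> poly_hom \<phi> t p \<noteq> 0"
    and y: "\<And>a. y * \<phi> a = \<phi> a * y" "y * t = t * y"
  shows "y * ratfun_hom \<phi> t f = ratfun_hom \<phi> t f * y"
proof (cases "y = 0")
  case False
  note r = ratfun_hom[OF \<phi> comm nz]
  have "y * ratfun_hom \<phi> t f * inverse y = ratfun_hom \<phi> t f"
  proof (rule ratfun_hom_unique[where f = "\<lambda>f. y * ratfun_hom \<phi> t f * inverse y"])
    show "unital_ring_hom (\<lambda>f. y * ratfun_hom \<phi> t f * inverse y)"
      by (rule unital_ring_hom_conjugate[OF r(1) False])
  qed (use r False y in \<open>simp_all add: mult.assoc\<close>)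
  then have "y * ratfun_hom \<phi> t f * inverse y * y = ratfun_hom \<phi> t f * y" by simp
  then show ?thesis using False by (simp add: mult.assoc)
qed simp

lemma power_int_minus_two:
  fixes a :: "'d::division_ring"
  shows "a powi (-2) = inverse a * inverse a"
proof -
  have "a powi (-2) = inverse (a ^ 2)" by (simp add: power_int_minus)
  also have "\<dots> = inverse a ^ 2" by (rule power_inverse[symmetric])
  finally show ?thesis by (simp only: power2_eq_square)
qed

text \<open>The symmetry of the Koebe function, valid also for \<open>y = 1\<close> with the convention that 0 is the inverse of 0.\<close>

lemma inverse_square_symmetric:
  fixes y :: "'d::division_ring"
  assumes "y \<noteq> 0"
  shows "(1 - inverse y) powi (-2) * inverse y = y * (1 - y) powi (-2)"
proof (cases "y = 1")
  case False
  let ?t = "inverse (1 - y)"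
  have nz: "1 - y \<noteq> 0" using False by simp
  have com: "?t * y = y * ?t"
    by (rule commute_inverse_left) (simp add: algebra_simps)
  have "(1 - inverse y) * (- (y * ?t)) = - ((y - 1) * ?t)"
    using assms by (simp add: algebra_simps flip: mult.assoc)
  also have "\<dots> = (1 - y) * ?t" by (simp flip: mult_minus_left)
  finally have "inverse (1 - inverse y) = - (y * ?t)"
    using nz by (intro inverse_unique) simp
  then have "(1 - inverse y) powi (-2) * inverse y = y * ?t * (y * ?t) * inverse y"
    by (simp add: power_int_minus_two)
  also have "\<dots> = y * ?t * (?t * y) * inverse y" by (simp only: com)
  also have "\<dots> = y * (?t * ?t)" using assms by (simp add: mult.assoc)
  also have "?t * ?t = (1 - y) powi (-2)"
    by (simp add: power_int_minus_two)
  finally show ?thesis .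
qed simp

lemma involution_inverse_square:
  assumes inv: "involution_over \<eta> \<sigma>" and y: "y \<noteq> 0" "\<sigma> y = inverse y"
  shows "\<sigma> (y * (1 - y) powi (-2)) = y * (1 - y) powi (-2)"
proof -
  have add: "\<sigma> (a + b) = \<sigma> a + \<sigma> b" and anti: "\<sigma> (a * b) = \<sigma> b * \<sigma> a" and invol: "\<sigma> (\<sigma> a) = a" for a b
    using inv by (simp_all add: involution_over_def)
  have 1: "\<sigma> 1 = 1" using anti[of "\<sigma> 1" 1] invol[of 1] by simp
  have 0: "\<sigma> 0 = 0" using add[of 0 0] by simp
  have minus: "\<sigma> (a - b) = \<sigma> a - \<sigma> b" for a b
    using add[of "a - b" b] by simp
  have sinv: "\<sigma> (inverse a) = inverse (\<sigma> a)" for a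
  proof (cases "a = 0")
    case False
    then have "\<sigma> a * \<sigma> (inverse a) = 1" using anti[of "inverse a" a] by (simp add: 1)
    then show ?thesis by (simp add: inverse_unique)
  qed (simp add: 0)
  have "\<sigma> (a powi (-2)) = (\<sigma> a) powi (-2)" for a
    by (simp add: power_int_minus_two sinv anti)
  then show ?thesis
    using inverse_square_symmetric[OF y(1)] by (simp only: anti minus 1 y(2))
qed

theorem theorem1p1:
  fixes \<iota> :: "(nil2 \<Rightarrow>\<^sub>0 'k::field) \<Rightarrow> 'd::division_ring"
    and \<sigma> :: "'d \<Rightarrow> 'd"
  assumes "ore_field_of_fractions \<iota>"
    and "canonical_involution \<iota> \<sigma>"
  shows "let x = \<iota> (Poly_Mapping.single nil2_x 1);
             y = \<iota> (Poly_Mapping.single nil2_y 1);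
             u = 1 + y * (1 - y) powi (-2);
             v = 1 + y * (1 - y) powi (-2) * x * (1 - x) powi (-2) * y * (1 - y) powi (-2)
         in \<sigma> u = u \<and> \<sigma> v = v \<and>
            freely_generate_group_algebra (scalar_image \<iota>) u v"
proof -
  have \<iota>: "unital_ring_hom \<iota>" and inj: "inj \<iota>"
    using assms(1) by (simp_all add: ore_field_of_fractions_def)
  note h = unital_ring_homD[OF \<iota>]
  define x y z where "x = \<iota> (mon nil2_x)" and "y = \<iota> (mon nil2_y)" and "z = \<iota> (mon nil2_z)"
  define \<eta> where "\<eta> = scalar_image \<iota>"
  have \<eta>_eq: "\<eta> c = \<iota> (Poly_Mapping.single 0 c)" for c by (simp add: \<eta>_def scalar_image_def)
  have \<eta>: "unital_ring_hom \<eta>"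
    by (simp add: unital_ring_hom_def \<eta>_eq single_add h mult_single flip: h(3))
  have mon_inv: "\<iota> (mon g) * \<iota> (mon (- g)) = 1" for g
    by (simp add: h(1) flip: h(3))
  then have inv: "\<iota> (mon (- g)) = inverse (\<iota> (mon g))" and mon_nz: "\<iota> (mon g) \<noteq> 0" for g
    by (metis inverse_unique, metis mult_zero_left zero_neq_one)
  have nz: "x \<noteq> 0" "y \<noteq> 0" "z \<noteq> 0" by (simp_all add: x_def y_def z_def mon_nz)
  have scalar: "\<iota> a * \<eta> c = \<eta> c * \<iota> a" for a c
    unfolding \<eta>_eq by (simp only: single_0_central flip: h(3))
  have zx: "z * x = x * z" and zy: "z * y = y * z"
    by (simp_all add: x_def y_def z_def nil2_z_commute flip: h(3))
  \<comment> \<open>From here on \<open>z\<close> plays the role of the parameter \<open>q\<close>.\<close>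
  have xy: "x * y = z * y * x"
  proof -
    have "x * y = y * x * z" by (simp add: x_def y_def z_def nil2_x_y flip: h(3))
    then show ?thesis by (simp add: mult.assoc zx flip: zy) (simp flip: zx zy mult.assoc)
  qed
  \<comment> \<open>A polynomial in \<open>z\<close> is the image of a group algebra element with the same coefficients.\<close>
  have z_trans: "poly_hom \<eta> z p \<noteq> 0" if "p \<noteq> 0" for p
  proof
    assume "poly_hom \<eta> z p = 0"
    then have "\<iota> (\<Sum>i\<le>degree p. Poly_Mapping.single (nil2_z_multiple i) (coeff p i)) = \<iota> 0"
      by (simp add: poly_hom_def \<eta>_eq z_def h(4,8) mult_single mon_nil2_z_power flip: h(3,7))
    then have "(\<Sum>i\<le>degree p. Poly_Mapping.single (nil2_z_multiple i) (coeff p i)) = 0"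
      using inj by (simp add: inj_eq)
    then have "Poly_Mapping.lookup (\<Sum>i\<le>degree p. Poly_Mapping.single (nil2_z_multiple i) (coeff p i))
        (nil2_z_multiple (degree p)) = 0" by simp
    then have "lead_coeff p = 0"
      by (simp add: lookup_sum lookup_single when_def inj_eq[OF inj_nil2_z_multiple])
    then show False using that by simp
  qed
  \<comment> \<open>The field \<open>k(z)\<close> is embedded by \<open>emb0\<close>, and \<open>k(z)(y)\<close> by \<open>emb\<close> below.\<close>
  define emb0 where "emb0 = ratfun_hom \<eta> z"
  have z\<eta>: "z * \<eta> c = \<eta> c * z" for c unfolding z_def by (rule scalar)
  note emb0 = ratfun_hom[OF \<eta> z\<eta> z_trans, folded emb0_def]
  note emb0_simps = unital_ring_homD[OF emb0(1)] unital_ring_hom_field[OF emb0(1)]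
  have comm0: "x * emb0 f = emb0 f * x" "y * emb0 f = emb0 f * y" for f
  proof -
    have "x * \<eta> c = \<eta> c * x" "y * \<eta> c = \<eta> c * y" for c
      unfolding x_def y_def by (rule scalar)+
    then show "x * emb0 f = emb0 f * x" "y * emb0 f = emb0 f * y"
      unfolding emb0_def using commute_ratfun_hom[OF \<eta> z\<eta> z_trans] zx zy by metis+
  qed
  let ?q = "rvar :: 'k poly fract"
  have q_free: "?q ^ n \<noteq> 1" if "n > 0" for n
  proof
    assume "?q ^ n = 1"
    then have "to_fract ([:0, 1 :: 'k:] ^ n) = to_fract 1" by (simp add: rvar_def to_fract_power)
    then have "[:0, 1 :: 'k:] ^ n = 1" by (simp only: to_fract_eq_iff)
    then have "poly ([:0, 1 :: 'k:] ^ n) 0 = 1" by simp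
    then show False using that by (simp add: power_0_left)
  qed
  interpret generic_parameter ?q
    by standard (simp, rule q_free)
  have xyi: "x * y ^ i = emb0 (?q ^ i) * y ^ i * x" for i
  proof (induction i)
    case (Suc i)
    have "x * y ^ Suc i = x * y * y ^ i" by (simp add: mult.assoc)
    also have "\<dots> = z * y * (x * y ^ i)" by (simp add: xy mult.assoc)
    also have "\<dots> = z * (y * emb0 (?q ^ i)) * y ^ i * x" by (simp add: Suc mult.assoc)
    also have "\<dots> = (z * emb0 (?q ^ i)) * y ^ Suc i * x" by (simp add: comm0 mult.assoc)
    finally show ?case by (simp add: emb0(3) emb0_simps)
  qed (simp add: emb0_simps)
  \<comment> \<open>Conjugation by \<open>x\<close> has the powers of \<open>y\<close> as eigenvectors.\<close>
  have y_indep: "c i = 0" if S: "finite S" "(\<Sum>i\<in>S. emb0 (c i) * y ^ i) = 0" "i \<in> S" for S c i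
  proof (rule dedekind_independence[OF emb0(1), of "\<lambda>i. y ^ i" "\<lambda>i. ?q ^ i" "\<lambda>a. x * a" "\<lambda>a. a * x",
        OF _ _ _ _ _ _ _ S])
    show "inj (\<lambda>i. ?q ^ i)"
      using powi_inj_if_infinite_order[OF q_nz q_free, of "int _" "int _"] by (intro injI) simp
    show "x * (emb0 a * y ^ i) = emb0 (a * ?q ^ i) * y ^ i * x" for a i
    proof -
      have "x * (emb0 a * y ^ i) = emb0 a * (x * y ^ i)" by (simp add: comm0 flip: mult.assoc)
      then show ?thesis by (simp add: xyi emb0_simps(3) mult.assoc)
    qed
  qed (use nz in \<open>simp_all add: distrib_left distrib_right\<close>)
  have y_trans: "poly_hom emb0 y p \<noteq> 0" if "p \<noteq> 0" for p
    using y_indep[of "{..degree p}" "coeff p" "degree p"] that by (auto simp: poly_hom_def)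
  define emb where "emb = ratfun_hom emb0 y"
  note emb = ratfun_hom[OF emb0(1) comm0(2) y_trans, folded emb_def]
  note emb_simps = unital_ring_homD[OF emb(1)] unital_ring_hom_field[OF emb(1)]
  have xemb: "x * emb f = emb (dilate ?q f) * x" for f
  proof -
    have "x * emb f * inverse x = emb (dilate ?q f)"
    proof (rule ratfun_hom_unique[where f = "\<lambda>f. x * emb f * inverse x" and g = "\<lambda>f. emb (dilate ?q f)"])
      show "unital_ring_hom (\<lambda>f. emb (dilate ?q f))"
        by (rule unital_ring_hom_comp[OF emb(1) unital_ring_hom_dilate[OF q_nz]])
      show "x * emb (rconst c) * inverse x = emb (dilate ?q (rconst c))" for c
        using nz by (simp add: emb(2) dilate_rconst q_nz comm0 mult.assoc)
      show "x * emb rvar * inverse x = emb (dilate ?q rvar)"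
        using nz by (simp add: emb(2,3) dilate_rvar q_nz emb_simps(3) emb0(3) xy mult.assoc)
    qed (rule unital_ring_hom_conjugate[OF emb(1) nz(1)])
    then have "x * emb f * inverse x * x = emb (dilate ?q f) * x" by simp
    then show ?thesis using nz by (simp add: mult.assoc)
  qed
  interpret quantum_extension ?q emb x
    by standard (use emb(1) nz xemb in auto)
  have A: "emb koebe = y * (1 - y) powi (-2)"
    by (simp add: koebe_def power_int_minus_two emb_simps(1,3,6,11) emb(3) power2_eq_square inverse_mult_distrib)
  define u v where "u = 1 + y * (1 - y) powi (-2)"
    and "v = 1 + y * (1 - y) powi (-2) * x * (1 - x) powi (-2) * y * (1 - y) powi (-2)"
  have uU: "u = U" by (simp add: u_def A emb_simps(1,2))
  have vV: "v = V" by (simp add: v_def A power_int_minus_two[of "1 - x"] mult.assoc)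
  have "freely_generate_group_algebra \<eta> U V"
  proof (rule free_group_algebra[OF \<eta>])
    show "\<exists>e. \<eta> c = emb e \<and> dilate ?q e = e" for c
      by (intro exI[of _ "rconst (rconst c)"]) (simp add: emb(2) emb0(2) dilate_rconst q_nz)
  qed
  then have free: "freely_generate_group_algebra (scalar_image \<iota>) u v"
    by (simp only: uU vV \<eta>_def)
  have invol: "involution_over (scalar_image \<iota>) \<sigma>" and ext: "\<sigma> (\<iota> a) = \<iota> (group_algebra_involution a)" for a
    using assms(2) by (simp_all add: canonical_involution_def)
  have s: "\<sigma> (\<iota> (mon g)) = inverse (\<iota> (mon g))" for g
    by (simp add: ext group_algebra_involution_def inv)
  have sA: "\<sigma> (y * (1 - y) powi (-2)) = y * (1 - y) powi (-2)"
    by (rule involution_inverse_square[OF invol]) (simp_all add: nz s y_def mon_nz)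
  have sB: "\<sigma> (x * (1 - x) powi (-2)) = x * (1 - x) powi (-2)"
    by (rule involution_inverse_square[OF invol]) (simp_all add: nz s x_def mon_nz)
  have add: "\<sigma> (a + b) = \<sigma> a + \<sigma> b" and anti: "\<sigma> (a * b) = \<sigma> b * \<sigma> a" and id: "\<sigma> (\<sigma> a) = a" for a b
    using invol by (simp_all add: involution_over_def)
  have one: "\<sigma> 1 = 1" using anti[of "\<sigma> 1" 1] id[of 1] by simp
  have "\<sigma> u = u" unfolding u_def by (simp only: add one sA)
  moreover have "\<sigma> v = v"
  proof -
    have v: "v = 1 + (y * (1 - y) powi (-2)) * (x * (1 - x) powi (-2)) * (y * (1 - y) powi (-2))"
      by (simp add: v_def mult.assoc)
    have "\<sigma> (a * b * a) = a * b * a" if "\<sigma> a = a" "\<sigma> b = b" for a b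
      using that by (simp add: anti mult.assoc)
    from this[OF sA sB] show ?thesis unfolding v by (simp only: add one)
  qed
  ultimately show ?thesis
    using free unfolding u_def v_def x_def y_def Let_def by blast
qed

end
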